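(* Let $T=(\mathbb{S}^1)^\ell$ be a torus and let $X$ be an affine definable space that admits a definable $T$-action. Then $\chi(X)=\chi(X^T)$, where $X^T=\{x\in X: tx=x\ \forall t\in T\}$. In particular, $\chi(X)=0$ if $X^T=\emptyset$.
   Context: Fix an o-minimal structure on $\mathbb{R}$ that contains the semialgebraic sets. A subset $A\subseteq\mathbb{R}^n$ in this structure is called definable; a function $f\colon A\to\mathbb{R}^m$ is definable if its graph is definable. An affine definable space is a topological space $X$ with a topological embedding $\iota_X\colon X\to\mathbb{R}^n$ whose image is definable; $A\subseteq X$ is definable if $\iota_X(A)$ is. A morphism of affine definable spaces $(X,\iota_X)\to(Y,\iota_Y)$ is a continuous map $f$ such that $\iota_Y\circ f\circ\iota_X^{-1}$ is a definable function on $\iota_X(X)$. Every compact Lie group $G$ is identified with a compact linear algebraic group and so has a unique structure of an affine definable topological group. A definable $G$-action on an affine definable space $X$ is a continuous action such that $G\times X\to X$ is a morphism of affine definable spaces. For a definable set $A$, $\chi(A)=\sum_C(-1)^{\dim C}$ over the cells $C$ of any finite cell decomposition of $A$; for a definable subset $A$ of an affine definable space $(X,\iota_X)$, $\chi(A):=\chi(\iota_X(A))$. *)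

theory Defs
  imports
    "HOL-Analysis.Analysis"
    "HOL-Algebra.Group_Action"
    "HOL-Algebra.Product_Groups"
begin

section \<open>O-minimal structures on the real field\<close>

text \<open>
  Euclidean n-space is the library's \<^const>\<open>Euclidean_space\<close>: a point is a sequence of reals that
  vanishes from index \<open>n\<close> on. Hence, for \<open>x\<close> in n-space, \<open>x(n := t)\<close> is the point \<open>(x, t)\<close> of
  (n+1)-space, and \<open>x(n := 0)\<close> is the image of a point \<open>x\<close> of (n+1)-space under the projection
  to the first \<open>n\<close> coordinates.
\<close>

abbreviation Rn :: "nat \<Rightarrow> (nat \<Rightarrow> real) set"
  where "Rn n \<equiv> topspace (Euclidean_space n)"

definition pair_pt :: "nat \<Rightarrow> (nat \<Rightarrow> real) \<Rightarrow> (nat \<Rightarrow> real) \<Rightarrow> nat \<Rightarrow> real"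
  where "pair_pt m x y = (\<lambda>i. if i < m then x i else y (i - m))"

inductive_set polynomial_fun :: "nat \<Rightarrow> ((nat \<Rightarrow> real) \<Rightarrow> real) set" for n :: nat
  where
    const: "(\<lambda>_. c) \<in> polynomial_fun n"
  | coord: "i < n \<Longrightarrow> (\<lambda>x. x i) \<in> polynomial_fun n"
  | add: "p \<in> polynomial_fun n \<Longrightarrow> q \<in> polynomial_fun n \<Longrightarrow> (\<lambda>x. p x + q x) \<in> polynomial_fun n"
  | mult: "p \<in> polynomial_fun n \<Longrightarrow> q \<in> polynomial_fun n \<Longrightarrow> (\<lambda>x. p x * q x) \<in> polynomial_fun n"

inductive_set semialgebraic :: "nat \<Rightarrow> (nat \<Rightarrow> real) set set" for n :: nat
  where
    eq: "p \<in> polynomial_fun n \<Longrightarrow> {x \<in> Rn n. p x = 0} \<in> semialgebraic n"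
  | pos: "p \<in> polynomial_fun n \<Longrightarrow> {x \<in> Rn n. p x > 0} \<in> semialgebraic n"
  | un: "A \<in> semialgebraic n \<Longrightarrow> B \<in> semialgebraic n \<Longrightarrow> A \<union> B \<in> semialgebraic n"
  | compl: "A \<in> semialgebraic n \<Longrightarrow> Rn n - A \<in> semialgebraic n"

text \<open>
  \<open>D n\<close> is the collection of definable subsets of n-space. The usual requirements that the
  diagonals, the graph of the order, the singletons and the empty set are definable are subsumed
  by \<open>semialgebraic_definable\<close>. In \<open>o_minimal\<close>, an interval is any convex set of reals: it may be
  unbounded, open, half-open or closed, a single point, or empty.
\<close>

locale o_minimal_structure =
  fixes D :: "nat \<Rightarrow> (nat \<Rightarrow> real) set set"
  assumes definable_subset: "A \<in> D n \<Longrightarrow> A \<subseteq> Rn n"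
    and definable_Un: "A \<in> D n \<Longrightarrow> B \<in> D n \<Longrightarrow> A \<union> B \<in> D n"
    and definable_compl: "A \<in> D n \<Longrightarrow> Rn n - A \<in> D n"
    and definable_times_line: "A \<in> D n \<Longrightarrow> {x(n := t) | x t. x \<in> A} \<in> D (Suc n)"
    and definable_line_times: "A \<in> D n \<Longrightarrow> {x. (\<lambda>i. x (Suc i)) \<in> A} \<in> D (Suc n)"
    and definable_proj: "A \<in> D (Suc n) \<Longrightarrow> (\<lambda>x. x(n := 0)) ` A \<in> D n"
    and semialgebraic_definable: "A \<in> semialgebraic n \<Longrightarrow> A \<in> D n"
    and o_minimal: "A \<in> D 1 \<Longrightarrow>
      \<exists>F. finite F \<and> (\<forall>I\<in>F. is_interval I) \<and> (\<lambda>x. x 0) ` A = (\<Union>F :: real set)"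

definition definable_map :: "(nat \<Rightarrow> (nat \<Rightarrow> real) set set) \<Rightarrow> nat \<Rightarrow> nat
    \<Rightarrow> (nat \<Rightarrow> real) set \<Rightarrow> ((nat \<Rightarrow> real) \<Rightarrow> nat \<Rightarrow> real) \<Rightarrow> bool"
  where "definable_map D n m A f \<longleftrightarrow>
    A \<subseteq> Rn n \<and> f \<in> A \<rightarrow> Rn m \<and> {pair_pt n x (f x) | x. x \<in> A} \<in> D (n + m)"


section \<open>Cells and the Euler characteristic\<close>

text \<open>
  Boundary functions of cells: continuous definable real-valued functions, or one of the constants
  \<open>-\<infinity>\<close> and \<open>\<infinity>\<close>.
\<close>

definition cell_fun :: "(nat \<Rightarrow> (nat \<Rightarrow> real) set set) \<Rightarrow> nat
    \<Rightarrow> (nat \<Rightarrow> real) set \<Rightarrow> ((nat \<Rightarrow> real) \<Rightarrow> real) \<Rightarrow> bool"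
  where "cell_fun D n C f \<longleftrightarrow>
    continuous_map (subtopology (Euclidean_space n) C) euclideanreal f \<and>
    {x(n := f x) | x. x \<in> C} \<in> D (Suc n)"

definition cell_bound :: "(nat \<Rightarrow> (nat \<Rightarrow> real) set set) \<Rightarrow> nat
    \<Rightarrow> (nat \<Rightarrow> real) set \<Rightarrow> ((nat \<Rightarrow> real) \<Rightarrow> ereal) \<Rightarrow> bool"
  where "cell_bound D n C f \<longleftrightarrow>
    f = (\<lambda>_. -\<infinity>) \<or> f = (\<lambda>_. \<infinity>) \<or> (\<exists>h. cell_fun D n C h \<and> f = (\<lambda>x. ereal (h x)))"

text \<open>
  \<open>cell D n d C\<close>: \<open>C\<close> is an \<open>(i\<^sub>1, \<dots>, i\<^sub>n)\<close>-cell in n-space with \<open>d = i\<^sub>1 + \<dots> + i\<^sub>n\<close>.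
\<close>

inductive cell :: "(nat \<Rightarrow> (nat \<Rightarrow> real) set set) \<Rightarrow> nat \<Rightarrow> nat \<Rightarrow> (nat \<Rightarrow> real) set \<Rightarrow> bool"
  for D :: "nat \<Rightarrow> (nat \<Rightarrow> real) set set"
  where
    point: "cell D 0 0 {\<lambda>_. 0}"
  | graph: "cell D n d C \<Longrightarrow> cell_fun D n C f \<Longrightarrow> cell D (Suc n) d {x(n := f x) | x. x \<in> C}"
  | band: "cell D n d C \<Longrightarrow> cell_bound D n C f \<Longrightarrow> cell_bound D n C g \<Longrightarrow> (\<forall>x\<in>C. f x < g x) \<Longrightarrow>
      cell D (Suc n) (Suc d) {x(n := t) | x t. x \<in> C \<and> f x < ereal t \<and> ereal t < g x}"

definition cell_dim :: "(nat \<Rightarrow> (nat \<Rightarrow> real) set set) \<Rightarrow> nat \<Rightarrow> (nat \<Rightarrow> real) set \<Rightarrow> nat"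
  where "cell_dim D n C = (THE d. cell D n d C)"

definition cell_decomposition :: "(nat \<Rightarrow> (nat \<Rightarrow> real) set set) \<Rightarrow> nat
    \<Rightarrow> (nat \<Rightarrow> real) set \<Rightarrow> (nat \<Rightarrow> real) set set \<Rightarrow> bool"
  where "cell_decomposition D n A P \<longleftrightarrow>
    finite P \<and> partition_on A P \<and> (\<forall>C\<in>P. \<exists>d. cell D n d C)"

text \<open>
  The value does not depend on the choice of the decomposition, which exists for every definable
  set; on sets that are not definable the value is meaningless.
\<close>

definition euler_char :: "(nat \<Rightarrow> (nat \<Rightarrow> real) set set) \<Rightarrow> nat \<Rightarrow> (nat \<Rightarrow> real) set \<Rightarrow> int"
  where "euler_char D n A =
    (\<Sum>C \<in> (SOME P. cell_decomposition D n A P). (-1) ^ cell_dim D n C)"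


section \<open>Affine definable spaces\<close>

record 'a embedded_space =
  top_of :: "'a topology"
  ambient_dim :: nat
  embed :: "'a \<Rightarrow> nat \<Rightarrow> real"

abbreviation points :: "'a embedded_space \<Rightarrow> 'a set"
  where "points X \<equiv> topspace (top_of X)"

definition affine_definable_space ::
    "(nat \<Rightarrow> (nat \<Rightarrow> real) set set) \<Rightarrow> 'a embedded_space \<Rightarrow> bool"
  where "affine_definable_space D X \<longleftrightarrow>
    embedding_map (top_of X) (Euclidean_space (ambient_dim X)) (embed X) \<and>
    embed X ` points X \<in> D (ambient_dim X)"

definition definable_morphism :: "(nat \<Rightarrow> (nat \<Rightarrow> real) set set)
    \<Rightarrow> 'a embedded_space \<Rightarrow> 'b embedded_space \<Rightarrow> ('a \<Rightarrow> 'b) \<Rightarrow> bool"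
  where "definable_morphism D X Y f \<longleftrightarrow>
    continuous_map (top_of X) (top_of Y) f \<and>
    definable_map D (ambient_dim X) (ambient_dim Y) (embed X ` points X)
      (embed Y \<circ> f \<circ> inv_into (points X) (embed X))"

definition prod_space ::
    "'a embedded_space \<Rightarrow> 'b embedded_space \<Rightarrow> ('a \<times> 'b) embedded_space"
  where "prod_space X Y =
    \<lparr>top_of = prod_topology (top_of X) (top_of Y),
     ambient_dim = ambient_dim X + ambient_dim Y,
     embed = (\<lambda>(x, y). pair_pt (ambient_dim X) (embed X x) (embed Y y))\<rparr>"

definition space_euler_char ::
    "(nat \<Rightarrow> (nat \<Rightarrow> real) set set) \<Rightarrow> 'a embedded_space \<Rightarrow> 'a set \<Rightarrow> int"
  where "space_euler_char D X A = euler_char D (ambient_dim X) (embed X ` A)"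


section \<open>The torus and definable actions\<close>

definition circle_group :: "complex monoid"
  where "circle_group = \<lparr>carrier = sphere 0 1, monoid.mult = (*), one = 1\<rparr>"

definition torus :: "nat \<Rightarrow> (nat \<Rightarrow> complex) monoid"
  where "torus l = product_group {..<l} (\<lambda>_. circle_group)"

text \<open>
  The structure of an affine definable space that the torus has as a compact linear algebraic
  group: \<open>z\<close> is sent to \<open>(Re z\<^sub>0, Im z\<^sub>0, Re z\<^sub>1, Im z\<^sub>1, \<dots>)\<close>.
\<close>

definition torus_space :: "nat \<Rightarrow> (nat \<Rightarrow> complex) embedded_space"
  where "torus_space l =
    \<lparr>top_of = product_topology (\<lambda>_. top_of_set (sphere 0 1)) {..<l},
     ambient_dim = 2 * l,
     embed = (\<lambda>z i. if i < 2 * l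
                     then (if even i then Re (z (i div 2)) else Im (z (i div 2))) else 0)\<rparr>"

definition definable_action :: "(nat \<Rightarrow> (nat \<Rightarrow> real) set set) \<Rightarrow> 'g monoid
    \<Rightarrow> 'g embedded_space \<Rightarrow> 'a embedded_space \<Rightarrow> ('g \<Rightarrow> 'a \<Rightarrow> 'a) \<Rightarrow> bool"
  where "definable_action D G G_sp X \<phi> \<longleftrightarrow>
    group_action G (points X) \<phi> \<and>
    definable_morphism D (prod_space G_sp X) X (\<lambda>(g, x). \<phi> g x)"

definition fixed_points :: "'g monoid \<Rightarrow> 'a embedded_space \<Rightarrow> ('g \<Rightarrow> 'a \<Rightarrow> 'a) \<Rightarrow> 'a set"
  where "fixed_points G X \<phi> = {x \<in> points X. \<forall>g \<in> carrier G. \<phi> g x = x}"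

end

theory Submission
  imports Defs
begin

text \<open>
  The Euler characteristic is an iterated Euler integral: integrating the indicator function of a cell
  over the last coordinate gives \<open>1\<close> or \<open>-1\<close> times that of its base. By cell decomposition this
  integral is defined and additive on constructible functions, and by a Fubini theorem, which comes
  down to cells in the plane with monotone boundary functions, it does not depend on the order of the
  coordinates.

  For a circle action, the non-fixed points with stabilizer of order \<open>c\<close> form a definable invariant
  set \<open>Y\<close>, and the lexicographically least points of the orbits form a definable transversal \<open>S\<close>.
  Integrating the indicator function of \<open>{(y, s, g). s \<in> S \<and> g s = y}\<close> in both orders gives
  \<open>c \<chi>(Y) = \<chi>(S) \<chi>(S\<^sup>1) = 0\<close>. A torus is treated one circle factor at a time.
\<close>

section \<open>First-order definability\<close>

text \<open>Cells are adapted to one order of the coordinates, so a count of cells says little about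
  projections in another order. Treating the Euler characteristic as an integral reduces all
  invariance to the exchange of two coordinates. The other obstacle is uniformity in families:
  finite fibres must vary continuously over large parts of a cell, and boundary functions must be
  piecewise monotone. Both come from one device. An interval is uncountable while rational data are
  countable, so if countably many definable sets cover an interval, one of them contains a
  subinterval. For cells of any dimension this becomes the property \<open>baire\<close>. Applied to
  gap sizes, to scales of discontinuity and to lists of rational intervals, it shows that the points
  near which finite fibres vary continuously are dense in a cell; the others lie in cells of smaller
  dimension, where induction applies. On the line it shows that a continuous definable function has,
  apart from finitely many points, no local extrema where it is not locally constant.\<close>

lemma Rn_iff: "x \<in> Rn n \<longleftrightarrow> (\<forall>i\<ge>n. x i = 0)"
  by (simp add: topspace_Euclidean_space)

text \<open>A retraction of all sequences onto n-space. On (n+1)-space it agrees with the projection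
  \<open>x(n := 0)\<close>, but it also cuts an environment of unknown length down to
  n-space.\<close>

definition restr :: "nat \<Rightarrow> (nat \<Rightarrow> real) \<Rightarrow> nat \<Rightarrow> real"
  where "restr n x = (\<lambda>i. if i < n then x i else 0)"

lemma restr_in [simp]: "restr n x \<in> Rn n"
  by (simp add: Rn_iff restr_def)

lemma restr_id: "x \<in> Rn n \<Longrightarrow> restr n x = x"
  by (force simp: Rn_iff restr_def)

lemma restr_restr [simp]: "restr n (restr m x) = restr (min n m) x"
  by (auto simp: restr_def)

lemma restr_apply: "i < n \<Longrightarrow> restr n x i = x i"
  by (simp add: restr_def)

lemma upd_in_Rn: "x \<in> Rn n \<Longrightarrow> x(n := t) \<in> Rn (Suc n)"
  by (auto simp: Rn_iff)

lemma pair_pt_in: "y \<in> Rn m \<Longrightarrow> pair_pt n x y \<in> Rn (n + m)"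
  by (auto simp: Rn_iff pair_pt_def)

lemma pair_pt_split: "z \<in> Rn (n + m) \<Longrightarrow> pair_pt n (restr n z) (\<lambda>i. z (n + i)) = z"
  by (auto simp: Rn_iff pair_pt_def restr_def fun_eq_iff)

section \<open>Polynomial functions and polynomial maps of environments\<close>

lemma polynomial_fun_mono: "p \<in> polynomial_fun n \<Longrightarrow> n \<le> m \<Longrightarrow> p \<in> polynomial_fun m"
  by (induction rule: polynomial_fun.induct) (auto intro: polynomial_fun.intros)

lemma polynomial_fun_restr: "p \<in> polynomial_fun n \<Longrightarrow> p (restr n x) = p x"
  by (induction rule: polynomial_fun.induct) (auto simp: restr_apply)

lemma polynomial_fun_local:
  "p \<in> polynomial_fun n \<Longrightarrow> (\<And>i. i < n \<Longrightarrow> x i = y i) \<Longrightarrow> p x = p y"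
  by (induction rule: polynomial_fun.induct) auto

text \<open>Hiding the number of variables frees the closure rules from side conditions on
  dimensions.\<close>

definition poly_fun :: "((nat \<Rightarrow> real) \<Rightarrow> real) \<Rightarrow> bool"
  where "poly_fun t \<longleftrightarrow> (\<exists>n. t \<in> polynomial_fun n)"

named_theorems def_intros

lemma poly_fun_const [def_intros]: "poly_fun (\<lambda>e. c)"
  by (auto simp: poly_fun_def intro: polynomial_fun.const)

lemma poly_fun_coord [def_intros]: "poly_fun (\<lambda>e. e i)"
  unfolding poly_fun_def by (rule exI[of _ "Suc i"]) (auto intro: polynomial_fun.coord)

lemma poly_fun_add [def_intros]: "poly_fun s \<Longrightarrow> poly_fun t \<Longrightarrow> poly_fun (\<lambda>e. s e + t e)"
  unfolding poly_fun_def
proof (elim exE)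
  fix n m assume "s \<in> polynomial_fun n" "t \<in> polynomial_fun m"
  then show "\<exists>n. (\<lambda>e. s e + t e) \<in> polynomial_fun n"
    by (intro exI[of _ "max n m"] polynomial_fun.add)
      (auto intro: polynomial_fun_mono)
qed

lemma poly_fun_mult [def_intros]: "poly_fun s \<Longrightarrow> poly_fun t \<Longrightarrow> poly_fun (\<lambda>e. s e * t e)"
  unfolding poly_fun_def
proof (elim exE)
  fix n m assume "s \<in> polynomial_fun n" "t \<in> polynomial_fun m"
  then show "\<exists>n. (\<lambda>e. s e * t e) \<in> polynomial_fun n"
    by (intro exI[of _ "max n m"] polynomial_fun.mult)
      (auto intro: polynomial_fun_mono)
qed

lemma poly_fun_uminus [def_intros]: "poly_fun t \<Longrightarrow> poly_fun (\<lambda>e. - t e)"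
  using poly_fun_mult[OF poly_fun_const[of "-1"]] by simp

lemma poly_fun_diff [def_intros]: "poly_fun s \<Longrightarrow> poly_fun t \<Longrightarrow> poly_fun (\<lambda>e. s e - t e)"
  using poly_fun_add[OF _ poly_fun_uminus] by simp

text \<open>The condition does not depend on the environment: it compares indices, as in the
  coordinates of an updated point or of \<open>pair_pt\<close>.\<close>

lemma poly_fun_if [def_intros]:
  "(b \<Longrightarrow> poly_fun s) \<Longrightarrow> (\<not> b \<Longrightarrow> poly_fun t) \<Longrightarrow> poly_fun (\<lambda>e. if b then s e else t e)"
  by (cases b) auto

definition poly_vec :: "nat \<Rightarrow> ((nat \<Rightarrow> real) \<Rightarrow> nat \<Rightarrow> real) \<Rightarrow> bool"
  where "poly_vec m v \<longleftrightarrow> (\<forall>i. poly_fun (\<lambda>e. v e i)) \<and> (\<forall>e. v e \<in> Rn m)"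

lemma poly_fun_vec: "poly_vec m v \<Longrightarrow> poly_fun (\<lambda>e. v e i)"
  by (simp add: poly_vec_def)

text \<open>The shape that \<open>Def_bex_Rn\<close> gives to a bound point and that
  \<open>restr\<close> has when unfolded.\<close>

lemma poly_vec_if [def_intros]:
  "(\<And>i. i < n \<Longrightarrow> poly_fun (\<lambda>e. v e i)) \<Longrightarrow> poly_vec n (\<lambda>e i. if i < n then v e i else 0)"
  by (auto simp: poly_vec_def Rn_iff intro: poly_fun_if poly_fun_const)

lemma poly_vec_restr [def_intros]:
  "(\<And>i. i < n \<Longrightarrow> poly_fun (\<lambda>e. v e i)) \<Longrightarrow> poly_vec n (\<lambda>e. restr n (v e))"
  unfolding restr_def by (rule poly_vec_if)

lemma poly_vec_const [def_intros]: "x \<in> Rn n \<Longrightarrow> poly_vec n (\<lambda>e. x)"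
  by (auto simp: poly_vec_def intro: poly_fun_const)

lemma poly_vec_upd [def_intros]:
  "poly_vec n v \<Longrightarrow> poly_fun t \<Longrightarrow> poly_vec (Suc n) (\<lambda>e. (v e)(n := t e))"
  unfolding poly_vec_def fun_upd_def by (auto simp: Rn_iff intro!: poly_fun_if)

lemma poly_vec_pair [def_intros]:
  assumes "poly_vec n v" "poly_vec m w" shows "poly_vec (n + m) (\<lambda>e. pair_pt n (v e) (w e))"
  using assms unfolding poly_vec_def
  by (auto simp: pair_pt_in) (auto simp: pair_pt_def intro!: poly_fun_if)

text \<open>A point of m-space has only \<open>m\<close> coordinates that can differ from 0, so
  finitely many polynomials are involved and one number of variables serves them all.\<close>

lemma poly_vec_bound:
  assumes "poly_vec m v"
  obtains N where "\<And>i. (\<lambda>e. v e i) \<in> polynomial_fun N"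
proof -
  have "\<forall>i. \<exists>n. (\<lambda>e. v e i) \<in> polynomial_fun n"
    using assms by (auto simp: poly_vec_def poly_fun_def)
  then obtain k where k: "\<And>i. (\<lambda>e. v e i) \<in> polynomial_fun (k i)"
    by metis
  \<comment> \<open>The sum merely serves as a common upper bound of the \<open>k i\<close>.\<close>
  define N where "N = (\<Sum>i<m. k i)"
  have "(\<lambda>e. v e i) \<in> polynomial_fun N" for i
  proof (cases "i < m")
    case True
    then have "k i \<le> N" unfolding N_def by (intro member_le_sum) auto
    then show ?thesis using k polynomial_fun_mono by blast
  next
    case False
    then have "(\<lambda>e. v e i) = (\<lambda>e. 0)" using assms by (auto simp: poly_vec_def Rn_iff)
    then show ?thesis by (simp add: polynomial_fun.const)
  qed
  then show ?thesis using that by blast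
qed

section \<open>Boolean operations, projections and formulas over an o-minimal structure\<close>

context o_minimal_structure
begin

lemma definable_Rn [simp]: "Rn n \<in> D n"
proof -
  have "{x \<in> Rn n. (0::real) = 0} \<in> D n"
    by (rule semialgebraic_definable, rule semialgebraic.eq, rule polynomial_fun.const)
  then show ?thesis by simp
qed

lemma definable_empty [simp]: "{} \<in> D n"
  using definable_compl[OF definable_Rn] by simp

lemma definable_Int: "A \<in> D n \<Longrightarrow> B \<in> D n \<Longrightarrow> A \<inter> B \<in> D n"
proof -
  assume "A \<in> D n" "B \<in> D n"
  moreover have "A \<inter> B = Rn n - ((Rn n - A) \<union> (Rn n - B))"
    using \<open>A \<in> D n\<close> definable_subset by blast
  ultimately show ?thesis by (simp add: definable_Un definable_compl)
qed

lemma definable_Diff: "A \<in> D n \<Longrightarrow> B \<in> D n \<Longrightarrow> A - B \<in> D n"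
proof -
  assume "A \<in> D n" "B \<in> D n"
  moreover have "A - B = A \<inter> (Rn n - B)"
    using \<open>A \<in> D n\<close> definable_subset by blast
  ultimately show ?thesis by (simp add: definable_Int definable_compl)
qed

lemma definable_UNION: "finite I \<Longrightarrow> (\<And>i. i \<in> I \<Longrightarrow> A i \<in> D n) \<Longrightarrow> (\<Union>i\<in>I. A i) \<in> D n"
  by (induction I rule: finite_induct) (auto intro: definable_Un)

lemma definable_Ball_finite:
  assumes "finite I" "\<And>i. i \<in> I \<Longrightarrow> {x \<in> Rn n. P i x} \<in> D n"
  shows "{x \<in> Rn n. \<forall>i\<in>I. P i x} \<in> D n"
  using assms
proof (induction I rule: finite_induct)
  case (insert j I)
  have "{x \<in> Rn n. \<forall>i\<in>insert j I. P i x} = {x \<in> Rn n. P j x} \<inter> {x \<in> Rn n. \<forall>i\<in>I. P i x}"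
    by auto
  then show ?case using insert by (simp add: definable_Int)
qed auto

lemma definable_space_times: "A \<in> D m \<Longrightarrow> {z. (\<lambda>i. z (n + i)) \<in> A} \<in> D (n + m)"
proof (induction n)
  case (Suc n)
  show ?case using definable_line_times[OF Suc.IH[OF Suc.prems]] by simp
qed auto

lemma definable_restr: "A \<in> D (n + m) \<Longrightarrow> restr n ` A \<in> D n"
proof (induction m arbitrary: A)
  case 0
  then have "restr n ` A = A" using definable_subset[OF 0] by (force simp: restr_id)
  then show ?case using 0 by simp
next
  case (Suc m)
  have "restr n ` ((\<lambda>x. x(n + m := 0)) ` A) \<in> D n"
    using Suc definable_proj[of A "n + m"] by simp
  moreover have "restr n (x(n + m := 0)) = restr n x" for x
    by (auto simp: restr_def)
  ultimately show ?case by (simp add: image_image)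
qed

text \<open>The set is the projection of the part of \<open>B\<close> whose last coordinates lie in
  \<open>A\<close>. With the graph of a polynomial map as \<open>B\<close> this gives preimages
  (\<open>Def_in\<close>); with a \<open>B\<close> that identifies coordinates it gives existential
  quantifiers (\<open>Def_bex_Rn\<close>).\<close>

lemma definable_subst:
  assumes "A \<in> D m" "B \<in> D (n + m)"
  shows "{e \<in> Rn n. \<exists>f\<in>A. pair_pt n e f \<in> B} \<in> D n"
proof -
  have "{e \<in> Rn n. \<exists>f\<in>A. pair_pt n e f \<in> B} = restr n ` ({z. (\<lambda>i. z (n + i)) \<in> A} \<inter> B)" (is "?L = ?R")
  proof
    show "?L \<subseteq> ?R"
    proof
      fix e assume "e \<in> ?L"
      then obtain f where f: "e \<in> Rn n" "f \<in> A" "pair_pt n e f \<in> B" by auto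
      have "e = restr n (pair_pt n e f)" using f(1) by (auto simp: pair_pt_def restr_def Rn_iff)
      moreover have "(\<lambda>i. pair_pt n e f (n + i)) = f" by (auto simp: pair_pt_def)
      ultimately show "e \<in> ?R" using f by (intro image_eqI) auto
    qed
    show "?R \<subseteq> ?L"
    proof
      fix e assume "e \<in> ?R"
      then obtain z where z: "e = restr n z" "(\<lambda>i. z (n + i)) \<in> A" "z \<in> B" by auto
      then have "pair_pt n e (\<lambda>i. z (n + i)) = z"
        using definable_subset[OF assms(2)] pair_pt_split by blast
      then have "pair_pt n e (\<lambda>i. z (n + i)) \<in> B" using z(3) by simp
      then show "e \<in> ?L" using z(1,2) by auto
    qed
  qed
  moreover have "{z. (\<lambda>i. z (n + i)) \<in> A} \<inter> B \<in> D (n + m)"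
    using assms by (intro definable_Int definable_space_times)
  ultimately show ?thesis using definable_restr by metis
qed

text \<open>
  Definable predicates of an environment \<open>e\<close>, a sequence of reals of which only finitely many
  entries matter. The variable bound by an outermost quantifier over a real is entry \<open>0\<close>, as for
  de Bruijn indices, so that definability of a formula can be shown by backward chaining.
\<close>

definition Def :: "((nat \<Rightarrow> real) \<Rightarrow> bool) \<Rightarrow> bool"
  where "Def P \<longleftrightarrow> (\<exists>n. (\<forall>e. P (restr n e) = P e) \<and> {x \<in> Rn n. P x} \<in> D n)"

text \<open>Each dummy variable is added as a product with a line; \<open>P\<close> does not see the
  new coordinate because it factors through \<open>restr n\<close>.\<close>

lemma Def_weaken1:
  assumes "\<forall>e. P (restr n e) = P e" "{x \<in> Rn n. P x} \<in> D n"
  shows "{x \<in> Rn (n + k). P x} \<in> D (n + k)"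
proof (induction k)
  case (Suc k)
  have r: "P (x(n + k := t)) = P x" for x t
  proof -
    have "restr n (x(n + k := t)) = restr n x" by (auto simp: restr_def)
    then show ?thesis using assms(1) by metis
  qed
  have "{x \<in> Rn (n + Suc k). P x} = {x(n + k := t) | x t. x \<in> {x \<in> Rn (n + k). P x}}" (is "?L = ?R")
  proof
    show "?L \<subseteq> ?R"
    proof
      fix x assume x: "x \<in> ?L"
      have "x = (x(n + k := 0))(n + k := x (n + k))" by simp
      moreover have "x(n + k := 0) \<in> {x \<in> Rn (n + k). P x}"
        using x r[of x 0] by (auto simp: Rn_iff)
      ultimately show "x \<in> ?R" by blast
    qed
    show "?R \<subseteq> ?L" using r by (auto simp: upd_in_Rn)
  qed
  then show ?case using definable_times_line[OF Suc] by simp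
qed (use assms in auto)

lemma Def_dim:
  assumes "Def P"
  obtains n where "\<And>m e. n \<le> m \<Longrightarrow> P (restr m e) = P e" "\<And>m. n \<le> m \<Longrightarrow> {x \<in> Rn m. P x} \<in> D m"
proof -
  obtain n where n: "\<forall>e. P (restr n e) = P e" "{x \<in> Rn n. P x} \<in> D n"
    using assms Def_def by auto
  show ?thesis
  proof (rule that)
    fix m e assume "n \<le> m"
    then show "P (restr m e) = P e" using n(1) by (metis min.absorb1 restr_restr)
    show "{x \<in> Rn m. P x} \<in> D m" using Def_weaken1[OF n, of "m - n"] \<open>n \<le> m\<close> by simp
  qed
qed

lemma DefI: "(\<And>e. P (restr n e) = P e) \<Longrightarrow> {x \<in> Rn n. P x} \<in> D n \<Longrightarrow> Def P"
  by (auto simp: Def_def)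

lemma Def_not [def_intros]: "Def P \<Longrightarrow> Def (\<lambda>e. \<not> P e)"
proof -
  assume "Def P"
  then obtain n where n: "\<forall>e. P (restr n e) = P e" "{x \<in> Rn n. P x} \<in> D n"
    using Def_def by auto
  have "{x \<in> Rn n. \<not> P x} = Rn n - {x \<in> Rn n. P x}" by auto
  then show ?thesis using n by (intro DefI[of _ n]) (auto simp: definable_compl)
qed

lemma Def_conj [def_intros]: "Def P \<Longrightarrow> Def Q \<Longrightarrow> Def (\<lambda>e. P e \<and> Q e)"
proof -
  assume P: "Def P" and Q: "Def Q"
  obtain n where n: "\<And>m e. n \<le> m \<Longrightarrow> P (restr m e) = P e" "\<And>m. n \<le> m \<Longrightarrow> {x \<in> Rn m. P x} \<in> D m"
    using Def_dim[OF P] by blast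
  obtain k where k: "\<And>m e. k \<le> m \<Longrightarrow> Q (restr m e) = Q e" "\<And>m. k \<le> m \<Longrightarrow> {x \<in> Rn m. Q x} \<in> D m"
    using Def_dim[OF Q] by blast
  let ?m = "max n k"
  have "{x \<in> Rn ?m. P x \<and> Q x} = {x \<in> Rn ?m. P x} \<inter> {x \<in> Rn ?m. Q x}" by auto
  then show ?thesis using n k by (intro DefI[of _ ?m]) (auto simp: definable_Int)
qed

lemma Def_disj [def_intros]: "Def P \<Longrightarrow> Def Q \<Longrightarrow> Def (\<lambda>e. P e \<or> Q e)"
  using Def_not[OF Def_conj[OF Def_not Def_not]] by simp

lemma Def_imp [def_intros]: "Def P \<Longrightarrow> Def Q \<Longrightarrow> Def (\<lambda>e. P e \<longrightarrow> Q e)"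
  unfolding imp_conv_disj by (intro Def_disj Def_not)

lemma Def_iff [def_intros]: "Def P \<Longrightarrow> Def Q \<Longrightarrow> Def (\<lambda>e. P e \<longleftrightarrow> Q e)"
  unfolding iff_conv_conj_imp by (intro Def_conj Def_imp)

lemma Def_const [def_intros]: "Def (\<lambda>e. b)"
  by (cases b) (auto intro!: DefI[of _ 0])

lemma Def_Ball_finite:
  "finite I \<Longrightarrow> (\<And>i. i \<in> I \<Longrightarrow> Def (P i)) \<Longrightarrow> Def (\<lambda>e. \<forall>i\<in>I. P i e)"
proof (induction I rule: finite_induct)
  case empty then show ?case using Def_const[of True] by simp
next
  case (insert j I)
  then show ?case using Def_conj[of "P j" "\<lambda>e. \<forall>i\<in>I. P i e"] by simp
qed

lemma Def_all_less [def_intros]: "(\<And>i. i < n \<Longrightarrow> Def (\<lambda>e. P e i)) \<Longrightarrow> Def (\<lambda>e. \<forall>i<n. P e i)"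
  for n :: nat
  using Def_Ball_finite[of "{..<n}" "\<lambda>i e. P e i"] by (simp add: Ball_def)

text \<open>Preimages under polynomial maps are definable because the graph of \<open>v\<close> is
  semialgebraic: \<open>v e\<close> lies in \<open>A\<close> iff some point of \<open>A\<close> lies
  over \<open>e\<close> on the graph.\<close>

lemma Def_in:
  assumes "A \<in> D m" "poly_vec m v" shows "Def (\<lambda>e. v e \<in> A)"
proof -
  obtain N where N: "\<And>i. (\<lambda>e. v e i) \<in> polynomial_fun N"
    using poly_vec_bound[OF assms(2)] by blast
  define B where "B = {z \<in> Rn (N + m). \<forall>i\<in>{..<m}. z (N + i) = v z i}"
  \<comment> \<open>Only sums and products generate \<open>polynomial_fun\<close>, hence the factor
    \<open>-1\<close> in place of a difference.\<close>
  have "{z \<in> Rn (N + m). z (N + i) + (-1) * v z i = 0} \<in> D (N + m)" if "i < m" for i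
    using that N[of i]
    by (intro semialgebraic_definable semialgebraic.eq polynomial_fun.intros)
      (auto intro: polynomial_fun_mono)
  then have B: "B \<in> D (N + m)" unfolding B_def by (intro definable_Ball_finite) auto
  have "v (pair_pt N e f) i = v e i" for e f i
    using N[of i] by (rule polynomial_fun_local) (auto simp: pair_pt_def)
  have *: "pair_pt N e f \<in> B \<longleftrightarrow> f = v e" if "f \<in> A" for e f
  proof -
    have f: "f \<in> Rn m" using that definable_subset[OF assms(1)] by auto
    moreover have "pair_pt N e f (N + i) = f i" for i by (simp add: pair_pt_def)
    ultimately have "pair_pt N e f \<in> B \<longleftrightarrow> (\<forall>i<m. f i = v e i)"
      using \<open>\<And>e f i. v (pair_pt N e f) i = v e i\<close> by (simp add: B_def pair_pt_in Ball_def)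
    also have "\<dots> \<longleftrightarrow> f = v e"
    proof
      assume *: "\<forall>i<m. f i = v e i"
      have "f i = v e i" for i
        using * f assms(2) by (cases "i < m") (auto simp: poly_vec_def Rn_iff)
      then show "f = v e" by auto
    qed auto
    finally show ?thesis .
  qed
  then have "{e \<in> Rn N. \<exists>f\<in>A. pair_pt N e f \<in> B} = {e \<in> Rn N. v e \<in> A}"
    by auto
  moreover have "v (restr N e) = v e" for e
    using polynomial_fun_restr[OF N] by auto
  ultimately show ?thesis
    using definable_subst[OF assms(1) B] by (intro DefI[of _ N]) auto
qed

lemma Def_in_Rn [def_intros]: "poly_vec m v \<Longrightarrow> Def (\<lambda>e. v e \<in> Rn m)"
  by (rule Def_in) auto

lemma Def_eq [def_intros]: "poly_fun s \<Longrightarrow> poly_fun t \<Longrightarrow> Def (\<lambda>e. s e = t e)"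
proof -
  assume "poly_fun s" "poly_fun t"
  then have "poly_fun (\<lambda>e. s e - t e)" by (rule poly_fun_diff)
  then obtain n where n: "(\<lambda>e. s e - t e) \<in> polynomial_fun n" by (auto simp: poly_fun_def)
  have "{x \<in> Rn n. s x - t x = 0} \<in> D n"
    using n by (intro semialgebraic_definable semialgebraic.eq)
  then show ?thesis using polynomial_fun_restr[OF n] by (intro DefI[of _ n]) (auto, (metis eq_iff_diff_eq_0)+)
qed

lemma Def_less [def_intros]: "poly_fun s \<Longrightarrow> poly_fun t \<Longrightarrow> Def (\<lambda>e. s e < t e)"
proof -
  assume "poly_fun s" "poly_fun t"
  then have "poly_fun (\<lambda>e. t e - s e)" by (intro poly_fun_diff)
  then obtain n where n: "(\<lambda>e. t e - s e) \<in> polynomial_fun n" by (auto simp: poly_fun_def)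
  have "{x \<in> Rn n. t x - s x > 0} \<in> D n"
    using n by (intro semialgebraic_definable semialgebraic.pos)
  then show ?thesis using polynomial_fun_restr[OF n] by (intro DefI[of _ n]) (auto, (metis diff_gt_0_iff_gt)+)
qed

lemma Def_le [def_intros]: "poly_fun s \<Longrightarrow> poly_fun t \<Longrightarrow> Def (\<lambda>e. s e \<le> t e)"
  using Def_not[OF Def_less, of t s] by (simp add: not_less)

text \<open>The bound point takes the first \<open>m\<close> entries and the old environment moves
  up by \<open>m\<close>. In the proof, \<open>A\<close> is the set defined by the body,
  \<open>B\<close> says that the entries from \<open>m\<close> on repeat the environment, and
  \<open>definable_subst\<close> projects.\<close>

lemma Def_bex_Rn [def_intros]:
  assumes "Def (\<lambda>e. P (\<lambda>i. e (i + m)) (\<lambda>i. if i < m then e i else 0))"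
  shows "Def (\<lambda>e. \<exists>y\<in>Rn m. P e y)"
proof -
  let ?Q = "\<lambda>e. P (\<lambda>i. e (i + m)) (\<lambda>i. if i < m then e i else 0)"
  obtain N where N: "\<And>k e. N \<le> k \<Longrightarrow> ?Q (restr k e) = ?Q e" "\<And>k. N \<le> k \<Longrightarrow> {x \<in> Rn k. ?Q x} \<in> D k"
    using Def_dim[OF assms] by blast
  define A where "A = {x \<in> Rn (m + N). ?Q x}"
  have A: "A \<in> D (m + N)" unfolding A_def by (rule N(2)) simp
  define B where "B = {z \<in> Rn (N + (m + N)). \<forall>i\<in>{..<N}. z (N + (m + i)) = z i}"
  have "{z \<in> Rn (N + (m + N)). z (N + (m + i)) + (-1) * z i = 0} \<in> D (N + (m + N))" if "i < N" for i
    using that by (intro semialgebraic_definable semialgebraic.eq polynomial_fun.intros) auto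
  then have B: "B \<in> D (N + (m + N))" unfolding B_def by (intro definable_Ball_finite) auto
  have Q: "?Q (pair_pt m y e) = P e y" if "y \<in> Rn m" for y e
  proof -
    have "(\<lambda>i. pair_pt m y e (i + m)) = e" "(\<lambda>i. if i < m then pair_pt m y e i else 0) = y"
      using that by (auto simp: pair_pt_def Rn_iff)
    then show ?thesis by simp
  qed
  have "(\<exists>f\<in>A. pair_pt N e f \<in> B) \<longleftrightarrow> (\<exists>y\<in>Rn m. P e y)" if e: "e \<in> Rn N" for e
  proof
    assume "\<exists>f\<in>A. pair_pt N e f \<in> B"
    then obtain f where f: "f \<in> Rn (m + N)" "?Q f" "pair_pt N e f \<in> B" by (auto simp: A_def)
    from f(3) have "f (m + i) = e i" if "i < N" for i
      using that by (auto simp: B_def pair_pt_def)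
    moreover have "f (m + i) = e i" if "\<not> i < N" for i
      using that f(1) e by (auto simp: Rn_iff)
    ultimately have "f (i + m) = e i" for i
      by (cases "i < N") (simp_all add: add.commute)
    then have "(\<lambda>i. f (i + m)) = e" by blast
    moreover have "(\<lambda>i. if i < m then f i else 0) \<in> Rn m" by (auto simp: Rn_iff)
    ultimately show "\<exists>y\<in>Rn m. P e y" using f(2) by auto
  next
    assume "\<exists>y\<in>Rn m. P e y"
    then obtain y where y: "y \<in> Rn m" "P e y" by auto
    have "pair_pt m y e \<in> A" using Q[OF y(1)] y e by (auto simp: A_def pair_pt_in)
    moreover have "pair_pt N e (pair_pt m y e) \<in> B"
      using e y(1) by (auto simp: B_def pair_pt_in) (auto simp: pair_pt_def)
    ultimately show "\<exists>f\<in>A. pair_pt N e f \<in> B" by blast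
  qed
  then have "{e \<in> Rn N. \<exists>y\<in>Rn m. P e y} = {e \<in> Rn N. \<exists>f\<in>A. pair_pt N e f \<in> B}" by auto
  moreover have "P (restr N e) y = P e y" if "y \<in> Rn m" for e y
  proof -
    have "restr (m + N) (pair_pt m y e) = pair_pt m y (restr N e)"
      by (rule ext) (auto simp: restr_def pair_pt_def)
    then show ?thesis
      using N(1)[of "m + N" "pair_pt m y e", unfolded \<open>restr (m + N) (pair_pt m y e) = _\<close>]
      unfolding Q[OF that] by simp
  qed
  ultimately show ?thesis using definable_subst[OF A B] by (intro DefI[of _ N]) auto
qed

lemma Def_ball_Rn [def_intros]:
  assumes "Def (\<lambda>e. P (\<lambda>i. e (i + m)) (\<lambda>i. if i < m then e i else 0))"
  shows "Def (\<lambda>e. \<forall>y\<in>Rn m. P e y)"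
  using Def_not[OF Def_bex_Rn[of "\<lambda>e y. \<not> P e y", OF Def_not[OF assms]]] by simp

lemma Def_ex [def_intros]:
  assumes "Def (\<lambda>e. P (\<lambda>i. e (Suc i)) (e 0))"
  shows "Def (\<lambda>e. \<exists>a. P e a)"
proof -
  have "Def (\<lambda>e. \<exists>y\<in>Rn 1. P e (y 0))"
    by (rule Def_bex_Rn) (use assms in simp)
  moreover have "(\<exists>y\<in>Rn 1. P e (y 0)) \<longleftrightarrow> (\<exists>a. P e a)" for e
  proof
    assume "\<exists>a. P e a"
    then obtain a where "P e a" by auto
    then have "P e (restr 1 (\<lambda>_. a) 0)" by (simp add: restr_def)
    then show "\<exists>y\<in>Rn 1. P e (y 0)" using restr_in by blast
  qed auto
  ultimately show ?thesis by simp
qed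

lemma Def_all [def_intros]:
  assumes "Def (\<lambda>e. P (\<lambda>i. e (Suc i)) (e 0))"
  shows "Def (\<lambda>e. \<forall>a. P e a)"
  using Def_not[OF Def_ex[of "\<lambda>e y. \<not> P e y", OF Def_not[OF assms]]] by simp

text \<open>Composing with \<open>restr n\<close> makes the hypothesis independent of what
  \<open>P\<close> does off n-space. Since \<open>Def\<close> may involve more than \<open>n\<close>
  variables, the set is obtained in a larger space and projected back.\<close>

lemma definable_Collect:
  assumes "Def (\<lambda>e. P (restr n e))" shows "{x \<in> Rn n. P x} \<in> D n"
proof -
  obtain N where "\<And>k e. N \<le> k \<Longrightarrow> P (restr n (restr k e)) = P (restr n e)"
    and N: "\<And>k. N \<le> k \<Longrightarrow> {x \<in> Rn k. P (restr n x)} \<in> D k"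
    by (rule Def_dim[OF assms]) auto
  have "restr n ` {x \<in> Rn (n + N). P (restr n x)} \<in> D n"
    by (rule definable_restr[OF N]) simp
  moreover have "{x \<in> Rn n. P x} = restr n ` {x \<in> Rn (n + N). P (restr n x)}" (is "?L = ?R")
  proof
    show "?L \<subseteq> ?R"
    proof
      fix x assume x: "x \<in> ?L"
      then have "x \<in> Rn (n + N)" "restr n x = x"
        by (auto simp: restr_id Rn_iff)
      then show "x \<in> ?R" using x by (intro image_eqI[of _ _ x]) auto
    qed
    show "?R \<subseteq> ?L" by (rule image_subsetI) simp
  qed
  ultimately show ?thesis by simp
qed

lemma Def_subst:
  assumes "Def P" "\<And>i. poly_fun (\<lambda>e. v e i)"
  shows "Def (\<lambda>e. P (v e))"
proof -
  obtain N where N: "\<And>m e. N \<le> m \<Longrightarrow> P (restr m e) = P e" "\<And>k. N \<le> k \<Longrightarrow> {x \<in> Rn k. P x} \<in> D k"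
    using Def_dim[OF assms(1)] by blast
  have "Def (\<lambda>e. restr N (v e) \<in> {x \<in> Rn N. P x})"
    using assms(2) by (intro Def_in[OF N(2)] poly_vec_restr) auto
  then show ?thesis using N(1) by simp
qed

end

section \<open>Local properties of cells\<close>

text \<open>A basic neighbourhood of \<open>x\<close> in n-space. Being given by finitely many
  polynomial inequalities, it may occur inside definable formulas.\<close>

definition cube :: "nat \<Rightarrow> (nat \<Rightarrow> real) \<Rightarrow> real \<Rightarrow> (nat \<Rightarrow> real) set"
  where "cube n x d = {y \<in> Rn n. \<forall>i<n. \<bar>y i - x i\<bar> < d}"

abbreviation graph_on :: "nat \<Rightarrow> ((nat \<Rightarrow> real) \<Rightarrow> real) \<Rightarrow> (nat \<Rightarrow> real) set \<Rightarrow> (nat \<Rightarrow> real) set"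
  where "graph_on n f C \<equiv> {x(n := f x) | x. x \<in> C}"

abbreviation band_on :: "nat \<Rightarrow> ((nat \<Rightarrow> real) \<Rightarrow> ereal) \<Rightarrow> ((nat \<Rightarrow> real) \<Rightarrow> ereal)
    \<Rightarrow> (nat \<Rightarrow> real) set \<Rightarrow> (nat \<Rightarrow> real) set"
  where "band_on n f g C \<equiv> {x(n := t) | x t. x \<in> C \<and> f x < ereal t \<and> ereal t < g x}"

lemma cubeD: "y \<in> cube n x d \<Longrightarrow> y \<in> Rn n"
  by (simp add: cube_def)

lemma cube_self: "x \<in> Rn n \<Longrightarrow> 0 < d \<Longrightarrow> x \<in> cube n x d"
  by (simp add: cube_def)

lemma cube_mono: "d \<le> e \<Longrightarrow> cube n x d \<subseteq> cube n x e"
  by (auto simp: cube_def intro: less_le_trans)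

lemma cube_refine:
  assumes "y \<in> cube n x d"
  shows "\<exists>e>0. cube n y e \<subseteq> cube n x d"
proof (intro exI conjI subsetI)
  \<comment> \<open>The extra element 1 keeps the minimum defined when \<open>n = 0\<close>.\<close>
  define e where "e = Min (insert 1 ((\<lambda>i. d - \<bar>y i - x i\<bar>) ` {..<n}))"
  show "e > 0" unfolding e_def using assms by (auto simp: cube_def)
  fix z assume z: "z \<in> cube n y e"
  have "\<bar>z i - x i\<bar> < d" if "i < n" for i
  proof -
    have "e \<le> d - \<bar>y i - x i\<bar>" unfolding e_def using that by (intro Min_le) auto
    moreover have "\<bar>z i - y i\<bar> < e" using z that by (auto simp: cube_def)
    ultimately show ?thesis by linarith
  qed
  then show "z \<in> cube n x d" using z by (auto simp: cube_def)
qed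

lemma upd_eq_iff:
  assumes "x \<in> Rn n" "y \<in> Rn n"
  shows "x(n := s) = y(n := t) \<longleftrightarrow> x = y \<and> s = t"
proof
  assume eq: "x(n := s) = y(n := t)"
  have "x i = y i" for i
    using fun_cong[OF eq, of i] assms by (cases "i = n") (auto simp: Rn_iff)
  moreover have "s = t" using fun_cong[OF eq, of n] by simp
  ultimately show "x = y \<and> s = t" by auto
qed auto

lemma Rn_Suc_cases:
  assumes "z \<in> Rn (Suc n)"
  obtains x t where "z = x(n := t)" "x \<in> Rn n"
proof (rule that)
  show "z = (z(n := 0))(n := z n)" by simp
  show "z(n := 0) \<in> Rn n" using assms by (auto simp: Rn_iff)
qed

lemma restr_upd [simp]: "x \<in> Rn n \<Longrightarrow> restr n (x(n := t)) = x"
  by (force simp: restr_def Rn_iff)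

lemma Rn_Suc_eq: "z \<in> Rn (Suc n) \<Longrightarrow> (restr n z)(n := z n) = z"
  by (auto simp: restr_def Rn_iff fun_eq_iff)

lemma upd_in_cube:
  assumes "y \<in> Rn n"
  shows "y(n := t) \<in> cube (Suc n) (x(n := s)) d \<longleftrightarrow> y \<in> cube n x d \<and> \<bar>t - s\<bar> < d"
  using assms by (auto simp: cube_def upd_in_Rn less_Suc_eq)

lemma cyl_eq:
  assumes "C \<subseteq> Rn n"
  shows "{x(n := t) | x t. x \<in> C \<and> P x t} = {z \<in> Rn (Suc n). restr n z \<in> C \<and> P (restr n z) (z n)}"
    (is "?L = ?R")
proof
  show "?L \<subseteq> ?R" using assms by (auto simp: upd_in_Rn subset_iff)
  show "?R \<subseteq> ?L"
  proof
    fix z assume z: "z \<in> ?R"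
    then have "z = (restr n z)(n := z n)" by (simp add: Rn_Suc_eq)
    then show "z \<in> ?L" using z by blast
  qed
qed

section \<open>Continuity on subsets of n-space\<close>

lemma subtopology_Euclidean_space:
  "C \<subseteq> Rn n \<Longrightarrow> subtopology (Euclidean_space n) C = top_of_set C"
  unfolding Euclidean_space_def euclidean_product_topology[symmetric]
  by (simp add: subtopology_subtopology topspace_Euclidean_space[unfolded Euclidean_space_def] Int_absorb1)

lemma open_contains_cube:
  assumes "open A" "x \<in> A" "x \<in> Rn n"
  shows "\<exists>d>0. cube n x d \<subseteq> A"
proof -
  have "openin (product_topology (\<lambda>i::nat. euclideanreal) UNIV) A"
    using assms(1) by (simp add: euclidean_product_topology)
  from product_topology_open_contains_basis[OF this assms(2)]
  obtain X where X: "x \<in> Pi\<^sub>E UNIV X" "\<And>i. open (X i)" "Pi\<^sub>E UNIV X \<subseteq> A"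
    by auto
  have "\<exists>d>0. \<forall>t. \<bar>t - x i\<bar> < d \<longrightarrow> t \<in> X i" for i
  proof -
    have "x i \<in> X i" using X(1) by auto
    then show ?thesis using X(2)[of i] by (auto simp: open_dist dist_real_def)
  qed
  then obtain r where r: "\<And>i. r i > 0" "\<And>i t. \<bar>t - x i\<bar> < r i \<Longrightarrow> t \<in> X i" by metis
  \<comment> \<open>Bounds on the first \<open>n\<close> coordinates suffice, since all points of
    n-space vanish from index \<open>n\<close> on.\<close>
  define d where "d = Min (insert 1 (r ` {..<n}))"
  have "y i \<in> X i" if "y \<in> cube n x d" for y i
  proof (cases "i < n")
    case True
    have "d \<le> r i" unfolding d_def using True by (intro Min_le) auto
    then show ?thesis using that True by (intro r(2)) (auto simp: cube_def intro: less_le_trans)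
  next
    case False
    then have "y i = x i" using that assms(3) by (auto simp: cube_def Rn_iff)
    then show ?thesis using r by auto
  qed
  moreover have "d > 0" unfolding d_def using r(1) by auto
  ultimately show ?thesis using X(3) by (intro exI[of _ d]) auto
qed

lemma cube_open:
  assumes "0 < d"
  obtains A where "open A" "x \<in> A" "A \<inter> Rn n \<subseteq> cube n x d"
proof (rule that)
  let ?A = "\<Inter>i\<in>{..<n}. {y. \<bar>y i - x i\<bar> < d}"
  show "open ?A"
    by (intro open_INT ballI open_Collect_less continuous_intros) auto
  show "x \<in> ?A" using assms by auto
  show "?A \<inter> Rn n \<subseteq> cube n x d" by (auto simp: cube_def)
qed

lemma continuous_map_Rn_iff:
  assumes "C \<subseteq> Rn n"
  shows "continuous_map (subtopology (Euclidean_space n) C) euclideanreal f \<longleftrightarrow>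
    (\<forall>x\<in>C. \<forall>e>0. \<exists>d>0. \<forall>y\<in>cube n x d \<inter> C. \<bar>f y - f x\<bar> < e)" (is "?L \<longleftrightarrow> ?R")
proof -
  have L: "?L \<longleftrightarrow> continuous_on C f"
    by (simp add: subtopology_Euclidean_space assms)
  show ?thesis
  proof
    assume "?L"
    then have c: "continuous_on C f" using L by simp
    show "?R"
    proof (intro ballI allI impI)
      fix x e assume x: "x \<in> C" "(e::real) > 0"
      obtain A where A: "open A" "x \<in> A" "\<forall>y\<in>C. y \<in> A \<longrightarrow> f y \<in> ball (f x) e"
        using c x unfolding continuous_on_topological by (metis centre_in_ball open_ball)
      obtain d where "d > 0" "cube n x d \<subseteq> A"
        using open_contains_cube[OF A(1,2), of n] x assms by auto
      then show "\<exists>d>0. \<forall>y\<in>cube n x d \<inter> C. \<bar>f y - f x\<bar> < e"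
        using A(3) by (intro exI[of _ d]) (auto simp: dist_real_def abs_minus_commute)
    qed
  next
    assume R: "?R"
    have "continuous_on C f"
      unfolding continuous_on_topological
    proof (intro ballI allI impI)
      fix x B assume x: "x \<in> C" "open B" "f x \<in> B"
      then obtain e where e: "e > 0" "ball (f x) e \<subseteq> B" using openE by blast
      then obtain d where d: "d > 0" "\<forall>y\<in>cube n x d \<inter> C. \<bar>f y - f x\<bar> < e" using R x by blast
      obtain A where A: "open A" "x \<in> A" "A \<inter> Rn n \<subseteq> cube n x d"
        using cube_open[of d x n] d(1) by blast
      have "f y \<in> B" if "y \<in> C" "y \<in> A" for y
        using that A(3) assms d(2) e(2) by (force simp: dist_real_def abs_minus_commute)
      then show "\<exists>A. open A \<and> x \<in> A \<and> (\<forall>y\<in>C. y \<in> A \<longrightarrow> f y \<in> B)" using A by blast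
    qed
    then show "?L" using L by simp
  qed
qed

section \<open>Definable subsets of the line and a Baire property of cells\<close>

context o_minimal_structure
begin

lemma Def_cube [def_intros]:
  "poly_vec n v \<Longrightarrow> poly_vec n w \<Longrightarrow> poly_fun t \<Longrightarrow> Def (\<lambda>e. v e \<in> cube n (w e) (t e))"
  unfolding cube_def mem_Collect_eq abs_less_iff by (intro def_intros) (auto intro: poly_fun_vec)

lemma Def_fiber: "A \<in> D (Suc n) \<Longrightarrow> x \<in> Rn n \<Longrightarrow> Def (\<lambda>e. x(n := e 0) \<in> A)"
  by (rule Def_in, assumption, intro def_intros, assumption)

lemma Def_real_intervals:
  assumes "Def (\<lambda>e. P (e 0))"
  shows "\<exists>F. finite F \<and> (\<forall>I\<in>F. is_interval I) \<and> {t. P t} = \<Union>F"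
proof -
  have "Def (\<lambda>e. P (restr 1 e 0))" using assms by (simp add: restr_def)
  then have "{x \<in> Rn 1. P (x 0)} \<in> D 1" by (rule definable_Collect[where P = "\<lambda>x. P (x 0)"])
  from o_minimal[OF this]
  obtain F where F: "finite F" "\<forall>I\<in>F. is_interval I" "(\<lambda>x. x 0) ` {x \<in> Rn 1. P (x 0)} = \<Union>F"
    by (elim exE conjE) (rule that)
  have "t \<in> (\<lambda>x. x 0) ` {x \<in> Rn 1. P (x 0)}" if "P t" for t
    using that by (intro image_eqI[of _ _ "restr 1 (\<lambda>_. t)"]) (auto simp: restr_apply)
  then have "{t. P t} = (\<lambda>x. x 0) ` {x \<in> Rn 1. P (x 0)}" by auto
  then show ?thesis using F by metis
qed

text \<open>One of the finitely many intervals that make up the set is infinite, so it contains two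
  points and everything between them.\<close>

lemma infinite_definable_real:
  assumes "Def (\<lambda>e. P (e 0))" "infinite {t. P t}"
  shows "\<exists>p q. p < q \<and> {p<..<q} \<subseteq> {t. P t}"
proof -
  obtain F where F: "finite F" "\<forall>I\<in>F. is_interval I" "{t. P t} = \<Union>F"
    using Def_real_intervals[OF assms(1)] by blast
  have "infinite (\<Union>F)" using assms(2) F(3) by simp
  then obtain I where I: "I \<in> F" "infinite I" using F(1) by blast
  then have "I \<noteq> {}" by auto
  then obtain a where a: "a \<in> I" by blast
  have "infinite (I - {a})" using I(2) by simp
  then have "I - {a} \<noteq> {}" by (metis finite.emptyI)
  then obtain b where b: "b \<in> I" "b \<noteq> a" by blast
  have sub: "{min a b<..<max a b} \<subseteq> I"
  proof
    fix t assume "t \<in> {min a b<..<max a b}"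
    then have "min a b \<le> t" "t \<le> max a b" by auto
    moreover have "is_interval I" "min a b \<in> I" "max a b \<in> I"
      using F(2) I(1) a b(1) by (auto simp: min_def max_def)
    ultimately show "t \<in> I" by (meson mem_is_interval_1_I)
  qed
  show ?thesis
  proof (intro exI conjI)
    show "min a b < max a b" using b by auto
    show "{min a b<..<max a b} \<subseteq> {t. P t}" using sub I F by auto
  qed
qed

text \<open>An open interval is uncountable, so one of the sets meets it in infinitely many points
  and, being definable, contains an interval inside it. Rational end points are gained by shrinking;
  they leave countably many possibilities, as \<open>baire_band\<close> requires.\<close>

lemma interval_countable_cover:
  assumes "\<And>k::nat. Def (\<lambda>e. P k (e 0))" "p < q" "{p<..<q} \<subseteq> (\<Union>k. {t. P k t})"
  shows "\<exists>k. \<exists>p'\<in>\<rat>. \<exists>q'\<in>\<rat>. p \<le> p' \<and> p' < q' \<and> q' \<le> q \<and> {p'<..<q'} \<subseteq> {t. P k t}"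
proof -
  have "\<exists>k. infinite {t. p < t \<and> t < q \<and> P k t}"
  proof (rule ccontr)
    assume "\<not> ?thesis"
    then have "countable (\<Union>k. {t. p < t \<and> t < q \<and> P k t})"
      by (intro countable_UN) (auto intro: countable_finite)
    moreover have "{p<..<q} \<subseteq> (\<Union>k. {t. p < t \<and> t < q \<and> P k t})" using assms(3) by force
    ultimately have "countable {p<..<q}" by (rule countable_subset[rotated])
    then show False using uncountable_open_interval[of p q] assms(2) by simp
  qed
  then obtain k where k: "infinite {t. p < t \<and> t < q \<and> P k t}" by blast
  have "Def (\<lambda>e. p < e 0 \<and> e 0 < q \<and> P k (e 0))"
    by (intro def_intros assms(1))
  from infinite_definable_real[OF this k] obtain a b where
    ab: "a < b" "{a<..<b} \<subseteq> {t. p < t \<and> t < q \<and> P k t}" by blast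
  \<comment> \<open>The interval found cannot stick out: otherwise the midpoint of \<open>a\<close>
    and \<open>min p b\<close>, or of \<open>b\<close> and \<open>max q a\<close>, would lie in it
    but not between \<open>p\<close> and \<open>q\<close>.\<close>
  have pa: "p \<le> a" and bq: "b \<le> q"
  proof -
    show "p \<le> a"
    proof (rule ccontr)
      assume "\<not> p \<le> a"
      then have "(a + min p b) / 2 \<in> {a<..<b}" using ab(1) by (auto simp: min_def)
      then have "p < (a + min p b) / 2" using ab(2) by blast
      then show False using \<open>\<not> p \<le> a\<close> by (auto simp: min_def split: if_splits)
    qed
    show "b \<le> q"
    proof (rule ccontr)
      assume "\<not> b \<le> q"
      then have "(b + max q a) / 2 \<in> {a<..<b}" using ab(1) by (auto simp: max_def)
      then have "(b + max q a) / 2 < q" using ab(2) by blast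
      then show False using \<open>\<not> b \<le> q\<close> by (auto simp: max_def split: if_splits)
    qed
  qed
  obtain p' where p': "p' \<in> \<rat>" "a < p'" "p' < b" using Rats_dense_in_real[OF ab(1)] by blast
  obtain q' where q': "q' \<in> \<rat>" "p' < q'" "q' < b" using Rats_dense_in_real[OF p'(3)] by blast
  have "{p'<..<q'} \<subseteq> {t. P k t}"
  proof
    fix t assume "t \<in> {p'<..<q'}"
    then have "t \<in> {a<..<b}" using p' q' by auto
    then show "t \<in> {t. P k t}" using ab(2) by blast
  qed
  then show ?thesis using p' q' pa bq by (intro exI[of _ k] bexI[of _ p'] bexI[of _ q']) auto
qed

text \<open>
  A replacement for the Baire property that is proved without completeness: in the step to a band, each
  vertical interval is uncountable, so one of the countably many definable sets covering it contains a
  rational interval, and there are only countably many choices of such an interval.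
\<close>

definition baire :: "nat \<Rightarrow> (nat \<Rightarrow> real) set \<Rightarrow> bool"
  where "baire n C \<longleftrightarrow> (\<forall>(A :: nat \<Rightarrow> (nat \<Rightarrow> real) set) x d.
    (\<forall>k. A k \<in> D n) \<longrightarrow> x \<in> C \<longrightarrow> 0 < d \<longrightarrow> cube n x d \<inter> C \<subseteq> (\<Union>k. A k) \<longrightarrow>
    (\<exists>k y e. y \<in> C \<and> 0 < e \<and> cube n y e \<subseteq> cube n x d \<and> cube n y e \<inter> C \<subseteq> A k))"

text \<open>Countable index types other than the naturals occur below: triples with rational entries
  and lists of rational intervals.\<close>

lemma baireD:
  assumes "baire n C" "\<And>k::'b::countable. A k \<in> D n" "x \<in> C" "0 < d" "cube n x d \<inter> C \<subseteq> (\<Union>k. A k)"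
  obtains k y e where "y \<in> C" "0 < e" "cube n y e \<subseteq> cube n x d" "cube n y e \<inter> C \<subseteq> A k"
proof -
  have "cube n x d \<inter> C \<subseteq> (\<Union>k. A (from_nat k))"
  proof
    fix z assume "z \<in> cube n x d \<inter> C"
    then obtain k where "z \<in> A k" using assms(5) by blast
    then have "z \<in> A (from_nat (to_nat k))" by simp
    then show "z \<in> (\<Union>k. A (from_nat k))" by blast
  qed
  then show ?thesis
    using assms(1)[unfolded baire_def, rule_format, of "\<lambda>k. A (from_nat k)" x d] assms that by blast
qed

text \<open>Projection identifies the graph with its base, continuously in both directions. So the
  covering sets are projected and the property of the base is applied to their images.\<close>

lemma baire_graph:
  assumes "baire n C" "C \<in> D n" "cell_fun D n C f"
  shows "baire (Suc n) (graph_on n f C)"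
  unfolding baire_def
proof (intro allI impI)
  fix A :: "nat \<Rightarrow> (nat \<Rightarrow> real) set" and z and d :: real
  assume A: "\<forall>k. A k \<in> D (Suc n)" and z: "z \<in> graph_on n f C" and d: "0 < d"
    and cov: "cube (Suc n) z d \<inter> graph_on n f C \<subseteq> (\<Union>k. A k)"
  have sub: "C \<subseteq> Rn n" using assms(2) definable_subset by blast
  have cont: "\<forall>x\<in>C. \<forall>e>0. \<exists>d>0. \<forall>y\<in>cube n x d \<inter> C. \<bar>f y - f x\<bar> < e"
    using assms(3) sub unfolding cell_fun_def by (simp add: continuous_map_Rn_iff)
  have gr: "graph_on n f C \<in> D (Suc n)" using assms(3) by (simp add: cell_fun_def)
  obtain x where x: "x \<in> C" "z = x(n := f x)" using z by blast
  obtain d0 where d0: "d0 > 0" "\<forall>y\<in>cube n x d0 \<inter> C. \<bar>f y - f x\<bar> < d"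
    using cont x d by blast
  \<comment> \<open>Over the cube of radius \<open>d1\<close> the graph stays within
    \<open>d\<close> of the height of \<open>z\<close>, so the cover near \<open>z\<close> projects
    to a cover of the part of \<open>C\<close> in this cube.\<close>
  define d1 where "d1 = min d0 d"
  have d1: "d1 > 0" "d1 \<le> d" "\<forall>y\<in>cube n x d1 \<inter> C. \<bar>f y - f x\<bar> < d"
    using d0 d cube_mono[of d1 d0 n x] by (auto simp: d1_def)
  let ?B = "\<lambda>k. {x \<in> Rn n. \<exists>t. x(n := t) \<in> graph_on n f C \<inter> A k}"
  have Bdef: "?B k \<in> D n" for k
  proof (rule definable_Collect)
    have "graph_on n f C \<inter> A k \<in> D (Suc n)" using gr A by (blast intro: definable_Int)
    then show "Def (\<lambda>e. \<exists>t. (restr n e)(n := t) \<in> graph_on n f C \<inter> A k)"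
      by (intro def_intros) (rule Def_in, assumption, intro def_intros)
  qed
  have in_graph: "y(n := t) \<in> graph_on n f C \<longleftrightarrow> y \<in> C \<and> t = f y" if "y \<in> Rn n" for y t
    using that sub by (auto simp: upd_eq_iff subset_iff)
  have "cube n x d1 \<inter> C \<subseteq> (\<Union>k. ?B k)"
  proof
    fix y assume y: "y \<in> cube n x d1 \<inter> C"
    then have "y(n := f y) \<in> cube (Suc n) z d"
      using sub d1 cube_mono[of d1 d n x] by (subst x(2), subst upd_in_cube) auto
    then obtain k where "y(n := f y) \<in> A k" using cov y by blast
    then show "y \<in> (\<Union>k. ?B k)" using y sub by blast
  qed
  from assms(1) Bdef x(1) d1(1) this obtain k y e where
    y: "y \<in> C" "0 < e" "cube n y e \<subseteq> cube n x d1" "cube n y e \<inter> C \<subseteq> ?B k" by (rule baireD)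
  have yR: "y \<in> Rn n" using y sub by blast
  have yf: "\<bar>f y - f x\<bar> < d" using d1(3) y cube_self[OF yR y(2)] by blast
  \<comment> \<open>The second term leaves room in the last coordinate, so that the cube around the
    new point stays inside the cube around \<open>z\<close>.\<close>
  define e' where "e' = min e (d - \<bar>f y - f x\<bar>)"
  have "cube (Suc n) (y(n := f y)) e' \<subseteq> cube (Suc n) z d"
  proof
    fix w assume w: "w \<in> cube (Suc n) (y(n := f y)) e'"
    then obtain u t where u: "w = u(n := t)" "u \<in> Rn n" by (meson cubeD Rn_Suc_cases)
    with w have "u \<in> cube n y e'" "\<bar>t - f y\<bar> < e'" by (auto simp: upd_in_cube)
    moreover have "cube n y e' \<subseteq> cube n x d"
      using y(3) cube_mono[of e' e n y] cube_mono[of d1 d n x] d1(2) unfolding e'_def by force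
    ultimately show "w \<in> cube (Suc n) z d" using u x(2) by (auto simp: upd_in_cube e'_def)
  qed
  moreover have "cube (Suc n) (y(n := f y)) e' \<inter> graph_on n f C \<subseteq> A k"
  proof
    fix w assume w: "w \<in> cube (Suc n) (y(n := f y)) e' \<inter> graph_on n f C"
    then obtain u where u: "u \<in> C" "w = u(n := f u)" by blast
    have "u \<in> cube n y e'" using w u sub by (auto simp: upd_in_cube subset_iff)
    then have "u \<in> cube n y e \<inter> C" using u cube_mono[of e' e n y] by (auto simp: e'_def)
    then have "u \<in> ?B k" using y(4) by blast
    then obtain t where t: "u \<in> Rn n" "u(n := t) \<in> graph_on n f C" "u(n := t) \<in> A k" by blast
    then have "t = f u" using in_graph[OF t(1)] by blast
    then show "w \<in> A k" using u t by simp
  qed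
  moreover have "y(n := f y) \<in> graph_on n f C" "e' > 0" using y yf by (auto simp: e'_def)
  ultimately show "\<exists>k y e. y \<in> graph_on n f C \<and> 0 < e \<and> cube (Suc n) y e \<subseteq> cube (Suc n) z d \<and>
      cube (Suc n) y e \<inter> graph_on n f C \<subseteq> A k" by blast
qed

end

section \<open>Neighbourhoods in cells, connectedness and dimension\<close>

definition loc_const :: "nat \<Rightarrow> (nat \<Rightarrow> real) set \<Rightarrow> ((nat \<Rightarrow> real) \<Rightarrow> 'b) \<Rightarrow> bool"
  where "loc_const n C h \<longleftrightarrow> (\<forall>x\<in>C. \<exists>d>0. \<forall>y\<in>cube n x d \<inter> C. h y = h x)"

lemma loc_const_interval:
  fixes h :: "real \<Rightarrow> 'b"
  assumes "is_interval S" "\<And>t. t \<in> S \<Longrightarrow> \<exists>d>0. \<forall>s\<in>S. \<bar>s - t\<bar> < d \<longrightarrow> h s = h t" "s \<in> S" "t \<in> S"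
  shows "h s = h t"
proof (rule connected_local_const[of S])
  show "connected S" using assms(1) by (simp add: is_interval_connected)
  show "\<forall>a\<in>S. eventually (\<lambda>b. h a = h b) (at a within S)"
  proof
    fix a assume a: "a \<in> S"
    then obtain d where "d > 0" "\<forall>s\<in>S. \<bar>s - a\<bar> < d \<longrightarrow> h s = h a" using assms(2) by blast
    then show "eventually (\<lambda>b. h a = h b) (at a within S)"
      unfolding eventually_at by (intro exI[of _ d]) (auto simp: dist_real_def)
  qed
qed (use assms in auto)

context o_minimal_structure
begin

lemma cell_fun_cont:
  assumes "cell_fun D n C h" "C \<subseteq> Rn n" "x \<in> C" "0 < e"
  shows "\<exists>d>0. \<forall>y\<in>cube n x d \<inter> C. \<bar>h y - h x\<bar> < e"
  using assms(1,3,4) unfolding cell_fun_def continuous_map_Rn_iff[OF assms(2)] by blast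

lemma cell_bound_upper_nbhd:
  assumes "cell_bound D n C g" "C \<subseteq> Rn n" "x \<in> C" "ereal t < g x"
  obtains q d where "t < q" "0 < d" "\<And>y. y \<in> cube n x d \<inter> C \<Longrightarrow> ereal q < g y"
proof -
  consider "g = (\<lambda>_. \<infinity>)" | h where "cell_fun D n C h" "g = (\<lambda>x. ereal (h x))"
    using assms unfolding cell_bound_def by fastforce
  then show ?thesis
  proof cases
    case 1
    then show ?thesis by (intro that[of "t + 1" 1]) auto
  next
    case (2 h)
    let ?q = "(t + h x) / 2"
    have lt: "t < h x" using assms(4) 2 by simp
    then have "h x - ?q > 0" by simp
    from cell_fun_cont[OF 2(1) assms(2,3) this]
    obtain d where d: "d > 0" "\<forall>y\<in>cube n x d \<inter> C. \<bar>h y - h x\<bar> < h x - ?q" by blast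
    then have "ereal ?q < g y" if "y \<in> cube n x d \<inter> C" for y
      using that 2(2) by (auto simp: abs_less_iff)
    then show ?thesis using lt d(1) by (intro that[of ?q d]) auto
  qed
qed

lemma cell_bound_lower_nbhd:
  assumes "cell_bound D n C f" "C \<subseteq> Rn n" "x \<in> C" "f x < ereal t"
  obtains p d where "p < t" "0 < d" "\<And>y. y \<in> cube n x d \<inter> C \<Longrightarrow> f y < ereal p"
proof -
  consider "f = (\<lambda>_. -\<infinity>)" | h where "cell_fun D n C h" "f = (\<lambda>x. ereal (h x))"
    using assms unfolding cell_bound_def by fastforce
  then show ?thesis
  proof cases
    case 1
    then show ?thesis by (intro that[of "t - 1" 1]) auto
  next
    case (2 h)
    let ?p = "(t + h x) / 2"
    have lt: "h x < t" using assms(4) 2 by simp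
    then have "?p - h x > 0" by simp
    from cell_fun_cont[OF 2(1) assms(2,3) this]
    obtain d where d: "d > 0" "\<forall>y\<in>cube n x d \<inter> C. \<bar>h y - h x\<bar> < ?p - h x" by blast
    have "f y < ereal ?p" if "y \<in> cube n x d \<inter> C" for y
    proof -
      have "\<bar>h y - h x\<bar> < ?p - h x" using that d by blast
      then have "h y < ?p" by linarith
      then show ?thesis using 2(2) by simp
    qed
    then show ?thesis using lt d(1) by (intro that[of ?p d]) auto
  qed
qed

text \<open>A band is open in the cylinder over \<open>C\<close>. The same heights \<open>p\<close>
  and \<open>q\<close> serve a whole neighbourhood in the base, which allows products of a cube with
  a fixed vertical segment.\<close>

lemma band_nbhd:
  assumes "cell_bound D n C f" "cell_bound D n C g" "C \<subseteq> Rn n" "x \<in> C"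
    and "f x < ereal t" "ereal t < g x"
  obtains p q d where "p < t" "t < q" "0 < d"
    "\<And>y s. y \<in> cube n x d \<inter> C \<Longrightarrow> p \<le> s \<Longrightarrow> s \<le> q \<Longrightarrow> f y < ereal s \<and> ereal s < g y"
proof -
  obtain q d where q: "t < q" "0 < d" "\<And>y. y \<in> cube n x d \<inter> C \<Longrightarrow> ereal q < g y"
    using cell_bound_upper_nbhd[OF assms(2,3,4,6)] by blast
  obtain p d' where p: "p < t" "0 < d'" "\<And>y. y \<in> cube n x d' \<inter> C \<Longrightarrow> f y < ereal p"
    using cell_bound_lower_nbhd[OF assms(1,3,4,5)] by blast
  show ?thesis
  proof (rule that[of p q "min d d'"])
    fix y s assume y: "y \<in> cube n x (min d d') \<inter> C" and s: "p \<le> s" "s \<le> q"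
    then have "y \<in> cube n x d \<inter> C" "y \<in> cube n x d' \<inter> C"
      using cube_mono[of "min d d'" d n x] cube_mono[of "min d d'" d' n x] by auto
    then have "ereal q < g y" "f y < ereal p" using p q by auto
    moreover have "ereal p \<le> ereal s" "ereal s \<le> ereal q" using s by auto
    ultimately show "f y < ereal s \<and> ereal s < g y"
      by (meson le_less_trans less_le_trans)
  qed (use p q in auto)
qed

lemma band_section:
  assumes "f x < (g x :: ereal)"
  obtains s t where "f x < ereal s" "s < t" "ereal t < g x"
proof -
  obtain s where s: "f x < ereal s" "ereal s < g x" using ereal_dense2[OF assms] by auto
  obtain t where t: "ereal s < ereal t" "ereal t < g x" using ereal_dense2[OF s(2)] by auto
  show ?thesis using that s t by auto
qed

lemma definable_cell_bound_less:
  assumes "cell_bound D n C f" "C \<in> D n"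
  shows "{z \<in> Rn (Suc n). restr n z \<in> C \<and> f (restr n z) < ereal (z n)} \<in> D (Suc n)"
    and "{z \<in> Rn (Suc n). restr n z \<in> C \<and> ereal (z n) < f (restr n z)} \<in> D (Suc n)"
proof -
  have C: "{z \<in> Rn (Suc n). restr n z \<in> C} \<in> D (Suc n)"
    by (rule definable_Collect) (unfold restr_def, rule Def_in[OF assms(2)], intro def_intros)
  have sub: "C \<subseteq> Rn n" using assms(2) definable_subset by blast
  consider "f = (\<lambda>_. -\<infinity>)" | "f = (\<lambda>_. \<infinity>)" | h where "cell_fun D n C h" "f = (\<lambda>x. ereal (h x))"
    using assms unfolding cell_bound_def by fastforce
  then have "{z \<in> Rn (Suc n). restr n z \<in> C \<and> f (restr n z) < ereal (z n)} \<in> D (Suc n) \<and>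
    {z \<in> Rn (Suc n). restr n z \<in> C \<and> ereal (z n) < f (restr n z)} \<in> D (Suc n)"
  proof cases
    case (3 h)
    have in_graph: "y(n := t) \<in> graph_on n h C \<longleftrightarrow> y \<in> C \<and> t = h y" if "y \<in> Rn n" for y t
      using that sub by (auto simp: upd_eq_iff subset_iff)
    have G: "graph_on n h C \<in> D (Suc n)" using 3 by (simp add: cell_fun_def)
    have "{z \<in> Rn (Suc n). restr n z \<in> C \<and> f (restr n z) < ereal (z n)} =
      {z \<in> Rn (Suc n). \<exists>s. (restr n z)(n := s) \<in> graph_on n h C \<and> s < z n}"
      using 3(2) in_graph[OF restr_in] by auto
    moreover have "\<dots> \<in> D (Suc n)"
      by (rule definable_Collect) (unfold restr_def, intro def_intros, rule Def_in[OF G], intro def_intros)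
    moreover have "{z \<in> Rn (Suc n). restr n z \<in> C \<and> ereal (z n) < f (restr n z)} =
      {z \<in> Rn (Suc n). \<exists>s. (restr n z)(n := s) \<in> graph_on n h C \<and> z n < s}"
      using 3(2) in_graph[OF restr_in] by auto
    moreover have "\<dots> \<in> D (Suc n)"
      by (rule definable_Collect) (unfold restr_def, intro def_intros, rule Def_in[OF G], intro def_intros)
    ultimately show ?thesis by metis
  qed (use C in auto)
  then show "{z \<in> Rn (Suc n). restr n z \<in> C \<and> f (restr n z) < ereal (z n)} \<in> D (Suc n)"
    and "{z \<in> Rn (Suc n). restr n z \<in> C \<and> ereal (z n) < f (restr n z)} \<in> D (Suc n)" by auto
qed

lemma definable_band:
  assumes "cell_bound D n C f" "cell_bound D n C g" "C \<in> D n"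
  shows "band_on n f g C \<in> D (Suc n)"
proof -
  have "band_on n f g C = {z \<in> Rn (Suc n). restr n z \<in> C \<and> f (restr n z) < ereal (z n)} \<inter>
      {z \<in> Rn (Suc n). restr n z \<in> C \<and> ereal (z n) < g (restr n z)}"
    using cyl_eq[of C n "\<lambda>x t. f x < ereal t \<and> ereal t < g x"] definable_subset[OF assms(3)] by auto
  then show ?thesis using definable_cell_bound_less assms by (simp add: definable_Int)
qed

lemma definable_cell: "cell D n d C \<Longrightarrow> C \<in> D n"
proof (induction rule: cell.induct)
  case point
  have "{\<lambda>_. 0} = Rn 0" by (auto simp: Rn_iff)
  then show ?case by simp
next
  case (graph n d C f)
  then show ?case by (simp add: cell_fun_def)
next
  case (band n d C f g)
  then show ?case by (intro definable_band)
qed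

lemma cell_sub: "cell D n d C \<Longrightarrow> C \<subseteq> Rn n"
  using definable_cell definable_subset by blast

lemma cell_nonempty: "cell D n d C \<Longrightarrow> C \<noteq> {}"
proof (induction rule: cell.induct)
  case (band n d C f g)
  then obtain x where x: "x \<in> C" by auto
  with band obtain s t where "f x < ereal s" "s < t" "ereal t < g x"
    using band_section[of f x g] by blast
  then have "ereal s < g x" using less_trans[of "ereal s" "ereal t" "g x"] by simp
  then show ?case using x \<open>f x < ereal s\<close> by blast
qed auto

lemma baire_band:
  assumes "baire n C" "C \<in> D n" "cell_bound D n C f" "cell_bound D n C g"
  shows "baire (Suc n) (band_on n f g C)"
  unfolding baire_def
proof (intro allI impI)
  fix A :: "nat \<Rightarrow> (nat \<Rightarrow> real) set" and z and d :: real
  assume A: "\<forall>k. A k \<in> D (Suc n)" and z: "z \<in> band_on n f g C" and d: "0 < d"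
    and cov: "cube (Suc n) z d \<inter> band_on n f g C \<subseteq> (\<Union>k. A k)"
  have sub: "C \<subseteq> Rn n" using assms(2) definable_subset by blast
  obtain x t where x: "x \<in> C" "z = x(n := t)" "f x < ereal t" "ereal t < g x" using z by blast
  obtain p0 q0 d0 where pq0: "p0 < t" "t < q0" "0 < d0"
    and fg0: "\<And>y s. y \<in> cube n x d0 \<inter> C \<Longrightarrow> p0 \<le> s \<Longrightarrow> s \<le> q0 \<Longrightarrow> f y < ereal s \<and> ereal s < g y"
    using band_nbhd[OF assms(3,4) sub x(1,3,4)] by metis
  define p where "p = max p0 (t - d / 2)"
  define q where "q = min q0 (t + d / 2)"
  define d1 where "d1 = min d0 d"
  have pq: "p < t" "t < q" "0 < d1" "d1 \<le> d" using pq0 d by (auto simp: p_def q_def d1_def)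
  have st: "\<bar>s - t\<bar> < d" if "p \<le> s" "s \<le> q" for s
    using that d by (auto simp: p_def q_def abs_if)
  have fg: "f y < ereal s \<and> ereal s < g y" if "y \<in> cube n x d1 \<inter> C" "p \<le> s" "s \<le> q" for y s
    using that fg0[of y s] cube_mono[of d1 d0 n x] by (auto simp: p_def q_def d1_def)
  \<comment> \<open>The points over which \<open>A k\<close> contains the whole vertical segment
    between \<open>a\<close> and \<open>b\<close>. By \<open>interval_countable_cover\<close> these
    countably many sets cover the part of \<open>C\<close> in the cube of radius \<open>d1\<close>,
    so by the property of \<open>C\<close> one of them contains a smaller such part.\<close>
  let ?B = "\<lambda>(k, a, b). {y \<in> Rn n. p \<le> real_of_rat a \<and> real_of_rat a < real_of_rat b \<and> real_of_rat b \<le> q \<and>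
    (\<forall>s. real_of_rat a < s \<and> s < real_of_rat b \<longrightarrow> y(n := s) \<in> A k)}"
  have Bdef: "?B m \<in> D n" for m
  proof (cases m)
    case (fields k a b)
    have Ak: "A k \<in> D (Suc n)" using A by blast
    show ?thesis unfolding fields prod.case
      by (rule definable_Collect) (unfold restr_def, intro def_intros, rule Def_in[OF Ak], intro def_intros)
  qed
  have "cube n x d1 \<inter> C \<subseteq> (\<Union>m. ?B m)"
  proof
    fix y assume y: "y \<in> cube n x d1 \<inter> C"
    then have yR: "y \<in> Rn n" using sub by auto
    have "{p<..<q} \<subseteq> (\<Union>k. {s. y(n := s) \<in> A k})"
    proof
      fix s assume s: "s \<in> {p<..<q}"
      have "y(n := s) \<in> band_on n f g C" using fg[OF y, of s] s y by auto
      moreover have "y(n := s) \<in> cube (Suc n) z d"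
        using y s st[of s] cube_mono[OF pq(4), of n x] yR x(2) by (auto simp: upd_in_cube)
      ultimately show "s \<in> (\<Union>k. {s. y(n := s) \<in> A k})" using cov by auto
    qed
    moreover have "Def (\<lambda>e. y(n := e 0) \<in> A k)" for k using A yR by (simp add: Def_fiber)
    ultimately obtain k p' q' where pq': "p' \<in> \<rat>" "q' \<in> \<rat>" "p \<le> p'" "p' < q'" "q' \<le> q"
      "{p'<..<q'} \<subseteq> {s. y(n := s) \<in> A k}"
      using interval_countable_cover[of "\<lambda>k s. y(n := s) \<in> A k" p q] pq by auto
    then obtain a b where ab: "p' = real_of_rat a" "q' = real_of_rat b" by (auto elim!: Rats_cases)
    have "y \<in> ?B (k, a, b)" using pq' yR ab by auto
    then show "y \<in> (\<Union>m. ?B m)" by blast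
  qed
  from assms(1) Bdef x(1) pq(3) this obtain m y e where
    y: "y \<in> C" "0 < e" "cube n y e \<subseteq> cube n x d1" "cube n y e \<inter> C \<subseteq> ?B m" by (rule baireD)
  obtain k a b where m: "m = (k, a, b)" by (cases m)
  define a' where "a' = real_of_rat a"
  define b' where "b' = real_of_rat b"
  have B: "p \<le> a'" "a' < b'" "b' \<le> q" "a' < s \<Longrightarrow> s < b' \<Longrightarrow> u(n := s) \<in> A k"
    if "u \<in> cube n y e \<inter> C" for u s
    using y(4) that unfolding m a'_def b'_def by auto
  have yR: "y \<in> Rn n" using y sub by blast
  have yy: "y \<in> cube n y e \<inter> C" using cube_self[OF yR y(2)] y(1) by blast
  note ab = B(1-3)[OF yy]
  \<comment> \<open>The centre is the midpoint of the segment and the radius at most half its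
    length, so the new cube keeps its last coordinate between \<open>a'\<close> and
    \<open>b'\<close>.\<close>
  define c where "c = (a' + b') / 2"
  define e' where "e' = min e ((b' - a') / 2)"
  have e': "e' > 0" using ab y by (auto simp: e'_def)
  have c: "a' < s" "s < b'" if "\<bar>s - c\<bar> < e'" for s
    using that unfolding c_def e'_def by (auto simp: abs_less_iff field_simps)
  have "cube (Suc n) (y(n := c)) e' \<subseteq> cube (Suc n) z d"
  proof
    fix w assume w: "w \<in> cube (Suc n) (y(n := c)) e'"
    then obtain u s where u: "w = u(n := s)" "u \<in> Rn n" by (meson cubeD Rn_Suc_cases)
    with w have us: "u \<in> cube n y e'" "\<bar>s - c\<bar> < e'" by (auto simp: upd_in_cube)
    have "\<bar>s - t\<bar> < d" using c[OF us(2)] ab by (intro st) auto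
    moreover have "cube n y e' \<subseteq> cube n x d"
      using y(3) cube_mono[of e' e n y] cube_mono[of d1 d n x] pq(4) unfolding e'_def by force
    ultimately show "w \<in> cube (Suc n) z d" using u us x(2) by (auto simp: upd_in_cube)
  qed
  moreover have "cube (Suc n) (y(n := c)) e' \<inter> band_on n f g C \<subseteq> A k"
  proof
    fix w assume w: "w \<in> cube (Suc n) (y(n := c)) e' \<inter> band_on n f g C"
    then obtain u s where u: "u \<in> C" "w = u(n := s)" by blast
    have us: "u \<in> cube n y e'" "\<bar>s - c\<bar> < e'" using w u sub by (auto simp: upd_in_cube subset_iff)
    then have "u \<in> cube n y e \<inter> C" using u cube_mono[of e' e n y] by (auto simp: e'_def)
    then show "w \<in> A k" using B(4) c[OF us(2)] u by blast
  qed
  moreover have "y(n := c) \<in> band_on n f g C"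
  proof -
    have "y \<in> cube n x d1 \<inter> C" using y(3) yy by blast
    then show ?thesis using fg[of y c] ab y(1) by (auto simp: c_def)
  qed
  ultimately show "\<exists>k y e. y \<in> band_on n f g C \<and> 0 < e \<and> cube (Suc n) y e \<subseteq> cube (Suc n) z d \<and>
      cube (Suc n) y e \<inter> band_on n f g C \<subseteq> A k" using e' by blast
qed

lemma baire_cell: "cell D n d C \<Longrightarrow> baire n C"
proof (induction rule: cell.induct)
  case point
  show ?case unfolding baire_def
  proof (intro allI impI)
    fix A :: "nat \<Rightarrow> (nat \<Rightarrow> real) set" and x and d :: real
    assume x: "x \<in> {\<lambda>_. 0}" "0 < d" "cube 0 x d \<inter> {\<lambda>_. 0} \<subseteq> (\<Union>k. A k)"
    have "x \<in> cube 0 x d" using x by (intro cube_self) (auto simp: Rn_iff)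
    then obtain k where "x \<in> A k" using x by blast
    then show "\<exists>k y e. y \<in> {\<lambda>_. 0} \<and> 0 < e \<and> cube 0 y e \<subseteq> cube 0 x d \<and> cube 0 y e \<inter> {\<lambda>_. 0} \<subseteq> A k"
      using x by (intro exI[of _ k] exI[of _ x] exI[of _ d]) auto
  qed
next
  case (graph n d C f)
  then show ?case using baire_graph definable_cell by blast
next
  case (band n d C f g)
  then show ?case using baire_band definable_cell by blast
qed

text \<open>Connectedness of cells, phrased without a topology on the range of \<open>h\<close>. On
  a band, \<open>h\<close> is constant along each vertical interval, so it is enough to follow it
  along one section of the band.\<close>

lemma loc_const_cell:
  "cell D n d C \<Longrightarrow> loc_const n C h \<Longrightarrow> x \<in> C \<Longrightarrow> y \<in> C \<Longrightarrow> h x = h y"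
proof (induction arbitrary: h x y rule: cell.induct)
  case (graph n d C f)
  have sub: "C \<subseteq> Rn n" using graph cell_sub by blast
  have "loc_const n C (\<lambda>x. h (x(n := f x)))"
    unfolding loc_const_def
  proof
    fix x assume x: "x \<in> C"
    then obtain d where d: "d > 0" "\<forall>y\<in>cube (Suc n) (x(n := f x)) d \<inter> graph_on n f C. h y = h (x(n := f x))"
      using graph.prems(1) unfolding loc_const_def by blast
    from cell_fun_cont[OF graph.hyps(2) sub x d(1)] obtain d' where
      d': "d' > 0" "\<forall>y\<in>cube n x d' \<inter> C. \<bar>f y - f x\<bar> < d" by blast
    have "h (y(n := f y)) = h (x(n := f x))" if "y \<in> cube n x (min d d') \<inter> C" for y
    proof -
      have "y \<in> Rn n" "y \<in> cube n x d" "y \<in> cube n x d' \<inter> C"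
        using that sub cube_mono[of "min d d'" d n x] cube_mono[of "min d d'" d' n x] by auto
      then have "y(n := f y) \<in> cube (Suc n) (x(n := f x)) d" using d' by (auto simp: upd_in_cube)
      then show ?thesis using d(2) that by blast
    qed
    then show "\<exists>d>0. \<forall>y\<in>cube n x d \<inter> C. h (y(n := f y)) = h (x(n := f x))"
      using d d' by (intro exI[of _ "min d d'"]) auto
  qed
  then show ?case using graph.IH[of "\<lambda>x. h (x(n := f x))"] graph.prems by auto
next
  case (band n d C f g)
  have sub: "C \<subseteq> Rn n" using band cell_sub by blast
  have fib: "h (x(n := s)) = h (x(n := t))"
    if x: "x \<in> C" and s: "f x < ereal s" "ereal s < g x" and t: "f x < ereal t" "ereal t < g x" for x s t
  proof (rule loc_const_interval[of "{t. f x < ereal t \<and> ereal t < g x}" "\<lambda>t. h (x(n := t))"])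
    show "is_interval {t. f x < ereal t \<and> ereal t < g x}"
      unfolding is_interval_1 by (auto intro: le_less_trans less_le_trans)
        (meson ereal_less_eq(3) le_less_trans less_le_trans)+
    fix t assume t: "t \<in> {t. f x < ereal t \<and> ereal t < g x}"
    then have "x(n := t) \<in> band_on n f g C" using x by blast
    then obtain d where d: "d > 0" "\<forall>y\<in>cube (Suc n) (x(n := t)) d \<inter> band_on n f g C. h y = h (x(n := t))"
      using band.prems(1) unfolding loc_const_def by blast
    have "h (x(n := s)) = h (x(n := t))" if "f x < ereal s" "ereal s < g x" "\<bar>s - t\<bar> < d" for s
    proof -
      have "x(n := s) \<in> cube (Suc n) (x(n := t)) d"
        using that sub x d(1) by (auto simp: upd_in_cube cube_self subset_iff)
      then show ?thesis using d(2) that x by blast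
    qed
    then show "\<exists>d>0. \<forall>s\<in>{t. f x < ereal t \<and> ereal t < g x}. \<bar>s - t\<bar> < d \<longrightarrow> h (x(n := s)) = h (x(n := t))"
      using d(1) by blast
  qed (use s t in auto)
  \<comment> \<open>An arbitrary, possibly discontinuous section. For \<open>y\<close> near
    \<open>x\<close> the height \<open>m x\<close> still lies in the band over \<open>y\<close>, and
    moving vertically from \<open>m y\<close> to \<open>m x\<close> does not change
    \<open>h\<close>.\<close>
  define m where "m x = (SOME t. f x < ereal t \<and> ereal t < g x)" for x
  have m: "f x < ereal (m x) \<and> ereal (m x) < g x" if "x \<in> C" for x
  proof -
    have "\<exists>t. f x < ereal t \<and> ereal t < g x" using band.hyps(4) that ereal_dense2 by blast
    then show ?thesis unfolding m_def by (rule someI_ex)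
  qed
  have "loc_const n C (\<lambda>x. h (x(n := m x)))"
    unfolding loc_const_def
  proof
    fix x assume x: "x \<in> C"
    define t where "t = m x"
    have "x(n := t) \<in> band_on n f g C" using x m[OF x] by (auto simp: t_def)
    then obtain d where d: "d > 0" "\<forall>y\<in>cube (Suc n) (x(n := t)) d \<inter> band_on n f g C. h y = h (x(n := t))"
      using band.prems(1) unfolding loc_const_def by blast
    obtain p q d' where d': "p < t" "t < q" "0 < d'"
      "\<And>y s. y \<in> cube n x d' \<inter> C \<Longrightarrow> p \<le> s \<Longrightarrow> s \<le> q \<Longrightarrow> f y < ereal s \<and> ereal s < g y"
      using band_nbhd[OF band.hyps(2,3) sub x, of t] m[OF x] t_def by metis
    have "h (y(n := m y)) = h (x(n := m x))" if "y \<in> cube n x (min d d') \<inter> C" for y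
    proof -
      have y: "y \<in> C" "y \<in> Rn n" "y \<in> cube n x d" "y \<in> cube n x d' \<inter> C"
        using that sub cube_mono[of "min d d'" d n x] cube_mono[of "min d d'" d' n x] by auto
      then have t: "f y < ereal t \<and> ereal t < g y" using d' by auto
      have "y(n := t) \<in> cube (Suc n) (x(n := t)) d" using y d by (auto simp: upd_in_cube)
      then have "h (y(n := t)) = h (x(n := t))" using d(2) y(1) t by blast
      moreover have "h (y(n := m y)) = h (y(n := t))" using fib[OF y(1)] m[OF y(1)] t by blast
      ultimately show ?thesis by (simp add: t_def)
    qed
    then show "\<exists>d>0. \<forall>y\<in>cube n x d \<inter> C. h (y(n := m y)) = h (x(n := m x))"
      using d d' by (intro exI[of _ "min d d'"]) auto
  qed
  then have base: "h (x(n := m x)) = h (y(n := m y))" if "x \<in> C" "y \<in> C" for x y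
    using band.IH[of "\<lambda>x. h (x(n := m x))"] that by blast
  obtain x' s where x: "x = x'(n := s)" "x' \<in> C" "f x' < ereal s" "ereal s < g x'"
    using band.prems(2) by blast
  obtain y' t where y: "y = y'(n := t)" "y' \<in> C" "f y' < ereal t" "ereal t < g y'"
    using band.prems(3) by blast
  show ?case using base[OF x(2) y(2)] fib[of x' s "m x'"] fib[of y' t "m y'"] x y m by metis
qed auto

lemma cell_Suc_cases:
  assumes "cell D (Suc n) d C"
  obtains (graph) B f where "cell D n d B" "cell_fun D n B f" "C = graph_on n f B"
  | (band) d' B f g where "d = Suc d'" "cell D n d' B" "cell_bound D n B f" "cell_bound D n B g"
      "\<forall>x\<in>B. f x < g x" "C = band_on n f g B"
  using assms
proof (cases rule: cell.cases)
  case (graph C f)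
  show ?thesis by (rule that(1)[OF graph(2,3,1)])
next
  case (band d C f g)
  show ?thesis by (rule that(2)[OF band(1,3-6,2)])
qed

text \<open>The inequality makes the dimension of a cell unique (\<open>cell_dim_eq\<close>). By the
  second claim a subcell of full dimension has interior relative to \<open>C\<close>; thus a cell
  inside \<open>C\<close> that avoids a dense subset of \<open>C\<close> has smaller dimension, on
  which the induction in \<open>decomposable_over_cell\<close> rests.\<close>

lemma cell_subset_dim:
  "cell D n d C \<Longrightarrow> cell D n d' C' \<Longrightarrow> C' \<subseteq> C \<Longrightarrow>
    d' \<le> d \<and> (d' = d \<longrightarrow> (\<exists>y\<in>C'. \<exists>e>0. cube n y e \<inter> C \<subseteq> C'))"
proof (induction arbitrary: d' C' rule: cell.induct)
  case point
  then have "d' = 0" "C' = {\<lambda>_. 0}" by (auto elim: cell.cases)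
  then show ?case by (auto intro: exI[of _ 1])
next
  case (graph n d C f)
  have sub: "C \<subseteq> Rn n" using graph cell_sub by blast
  from graph.prems(1) show ?case
  proof (cases rule: cell_Suc_cases)
    case (graph B f')
    have B: "B \<subseteq> Rn n" using graph cell_sub by blast
    have BC: "x \<in> C \<and> f' x = f x" if "x \<in> B" for x
    proof -
      have "x(n := f' x) \<in> graph_on n f C" using graph.prems(2) graph that by blast
      then obtain y where "y \<in> C" "x(n := f' x) = y(n := f y)" by blast
      then show ?thesis using sub B that upd_eq_iff by blast
    qed
    then have BC': "B \<subseteq> C" by blast
    have IH: "d' \<le> d \<and> (d' = d \<longrightarrow> (\<exists>y\<in>B. \<exists>e>0. cube n y e \<inter> C \<subseteq> B))"
      using graph.IH[OF graph(1) BC'] .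
    show ?thesis
    proof (intro conjI impI)
      assume "d' = d"
      then obtain y e where y: "y \<in> B" "e > 0" "cube n y e \<inter> C \<subseteq> B" using IH by blast
      have "cube (Suc n) (y(n := f' y)) e \<inter> graph_on n f C \<subseteq> C'"
      proof
        fix z assume z: "z \<in> cube (Suc n) (y(n := f' y)) e \<inter> graph_on n f C"
        then obtain x where x: "x \<in> C" "z = x(n := f x)" by blast
        then have "x \<in> cube n y e" using z sub by (auto simp: upd_in_cube subset_iff)
        then have "x \<in> B" using x y by blast
        then show "z \<in> C'" using BC[of x] x graph(3) by auto
      qed
      then show "\<exists>y\<in>C'. \<exists>e>0. cube (Suc n) y e \<inter> graph_on n f C \<subseteq> C'"
        using y graph(3) by blast
    qed (use IH in auto)
  next
    case (band d'' B f' g')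
    have B: "B \<subseteq> Rn n" using band cell_sub by blast
    obtain x where x: "x \<in> B" using cell_nonempty[OF band(2)] by blast
    \<comment> \<open>A band inside a graph is impossible, as it has two points over
      \<open>x\<close>.\<close>
    obtain s t where st: "f' x < ereal s" "s < t" "ereal t < g' x"
      using band_section[of f' x g'] band(5) x by blast
    have "f' x < ereal t" "ereal s < g' x"
      using st less_trans[of "f' x" "ereal s" "ereal t"] less_trans[of "ereal s" "ereal t" "g' x"] by auto
    then have "x(n := s) \<in> C'" "x(n := t) \<in> C'" using st x band(6) by blast+
    then obtain y z where "y \<in> C" "x(n := s) = y(n := f y)" "z \<in> C" "x(n := t) = z(n := f z)"
      using graph.prems(2) by blast
    then have "x = y" "s = f y" "x = z" "t = f z" using upd_eq_iff sub x B by (metis subsetD)+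
    then show ?thesis using st by simp
  qed
next
  case (band n d C f g)
  have sub: "C \<subseteq> Rn n" using band cell_sub by blast
  from band.prems(1) show ?case
  proof (cases rule: cell_Suc_cases)
    case (graph B f')
    have B: "B \<subseteq> Rn n" using graph cell_sub by blast
    have "B \<subseteq> C"
    proof
      fix x assume x: "x \<in> B"
      then have "x(n := f' x) \<in> band_on n f g C" using graph(3) band.prems(2) by blast
      then show "x \<in> C" using sub B x upd_eq_iff by blast
    qed
    then have "d' \<le> d" using band.IH[OF graph(1)] by blast
    then show ?thesis by simp
  next
    case (band d'' B f' g')
    have B: "B \<subseteq> Rn n" using band cell_sub by blast
    have ex: "\<exists>t. f' x < ereal t \<and> ereal t < g' x" if "x \<in> B" for x
      using band(5) that ereal_dense2 by blast
    have "B \<subseteq> C"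
    proof
      fix x assume x: "x \<in> B"
      then obtain t where "x(n := t) \<in> C'" using ex band(6) by blast
      then have "x(n := t) \<in> band_on n f g C" using band.prems(2) by blast
      then show "x \<in> C" using sub B x upd_eq_iff by blast
    qed
    then have IH: "d'' \<le> d \<and> (d'' = d \<longrightarrow> (\<exists>y\<in>B. \<exists>e>0. cube n y e \<inter> C \<subseteq> B))"
      using band.IH[OF band(2)] by blast
    show ?thesis
    proof (intro conjI impI)
      assume "d' = Suc d"
      then obtain y e where y: "y \<in> B" "e > 0" "cube n y e \<inter> C \<subseteq> B" using IH band(1) by blast
      obtain t where t: "f' y < ereal t" "ereal t < g' y" using ex y by blast
      obtain p q r where r: "p < t" "t < q" "0 < r"
        "\<And>x s. x \<in> cube n y r \<inter> B \<Longrightarrow> p \<le> s \<Longrightarrow> s \<le> q \<Longrightarrow> f' x < ereal s \<and> ereal s < g' x"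
        using band_nbhd[OF band(3,4) B y(1) t] by metis
      define e' where "e' = min (min e r) (min (t - p) (q - t))"
      have "cube (Suc n) (y(n := t)) e' \<inter> band_on n f g C \<subseteq> C'"
      proof
        fix z assume z: "z \<in> cube (Suc n) (y(n := t)) e' \<inter> band_on n f g C"
        then obtain x s where x: "x \<in> C" "z = x(n := s)" by blast
        then have xs: "x \<in> cube n y e'" "\<bar>s - t\<bar> < e'" using z sub by (auto simp: upd_in_cube subset_iff)
        have "e' \<le> e" "e' \<le> r" by (auto simp: e'_def min_le_iff_disj)
        with xs have "x \<in> cube n y e" "x \<in> cube n y r" using cube_mono by blast+
        moreover then have "x \<in> B" using x y by blast
        moreover have "p \<le> s" "s \<le> q" using xs(2) by (auto simp: e'_def abs_less_iff)
        ultimately have "f' x < ereal s \<and> ereal s < g' x" using r(4) by blast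
        then show "z \<in> C'" using x \<open>x \<in> B\<close> band(6) by blast
      qed
      moreover have "y(n := t) \<in> C'" using y t band(6) by blast
      moreover have "e' > 0" using y r by (auto simp: e'_def)
      ultimately show "\<exists>y\<in>C'. \<exists>e>0. cube (Suc n) y e \<inter> band_on n f g C \<subseteq> C'" by blast
    qed (use IH band(1) in auto)
  qed
qed

lemma cell_dim_eq: "cell D n d C \<Longrightarrow> cell_dim D n C = d"
  unfolding cell_dim_def
  by (rule the_equality) (auto dest: cell_subset_dim intro: le_antisym)

end

section \<open>The cell decomposition theorem\<close>

definition fibre :: "nat \<Rightarrow> (nat \<Rightarrow> real) set \<Rightarrow> (nat \<Rightarrow> real) \<Rightarrow> real set"
  where "fibre n Y x = {r. x(n := r) \<in> Y}"

definition over :: "nat \<Rightarrow> (nat \<Rightarrow> real) set \<Rightarrow> (nat \<Rightarrow> real) set \<Rightarrow> (nat \<Rightarrow> real) set"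
  where "over n A C = {z \<in> A. restr n z \<in> C}"

text \<open>A lower bound for the distances within \<open>S\<close>. Unlike finiteness, the
  condition is first-order in \<open>S\<close>, so it can cut out definable sets of base
  points.\<close>

definition gap :: "real set \<Rightarrow> real \<Rightarrow> bool"
  where "gap S g \<longleftrightarrow> (\<forall>r\<in>S. \<forall>s\<in>S. r < s \<longrightarrow> r + g \<le> s)"

definition hausdorff_close :: "real set \<Rightarrow> real set \<Rightarrow> real \<Rightarrow> bool"
  where "hausdorff_close S T e \<longleftrightarrow>
    (\<forall>r\<in>S. \<exists>s\<in>T. \<bar>r - s\<bar> < e) \<and> (\<forall>s\<in>T. \<exists>r\<in>S. \<bar>r - s\<bar> < e)"

text \<open>The bounds \<open>1 / (m + 1)\<close> form a countable scale, to which the Baire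
  property can be applied.\<close>

lemma finite_gap:
  assumes "finite S" shows "\<exists>m::nat. gap S (1 / (real m + 1))"
  using assms
proof (induction S rule: finite_linorder_max_induct)
  case empty
  then show ?case by (auto simp: gap_def)
next
  case (insert b S)
  then obtain m where m: "gap S (1 / (real m + 1))" by blast
  show ?case
  proof (cases "S = {}")
    case True
    then show ?thesis by (auto simp: gap_def)
  next
    case False
    define M where "M = Max S"
    have M: "M \<in> S" "\<And>r. r \<in> S \<Longrightarrow> r \<le> M" using insert False by (auto simp: M_def)
    then have "0 < b - M" using insert by auto
    then obtain k where k: "inverse (real (Suc k)) < b - M" using reals_Archimedean by blast
    define j where "j = max m k"
    have j: "1 / (real j + 1) \<le> 1 / (real m + 1)" "1 / (real j + 1) \<le> inverse (real (Suc k))"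
      by (auto simp: j_def field_simps)
    have "gap (insert b S) (1 / (real j + 1))"
      unfolding gap_def
    proof (intro ballI impI)
      fix r s assume rs: "r \<in> insert b S" "s \<in> insert b S" "r < s"
      then have r: "r \<in> S" using insert by (auto dest: less_trans)
      show "r + 1 / (real j + 1) \<le> s"
      proof (cases "s = b")
        case True
        then show ?thesis using M(2)[OF r] k j by linarith
      next
        case False
        then have "r + 1 / (real m + 1) \<le> s" using m rs r by (auto simp: gap_def)
        then show ?thesis using j by linarith
      qed
    qed
    then show ?thesis by blast
  qed
qed

text \<open>Sending each point of \<open>S\<close> to a point of \<open>T\<close> within
  \<open>e\<close> is strictly increasing, since points of \<open>S\<close> are at least
  \<open>2 * e\<close> apart, and onto, since two points of \<open>T\<close> within \<open>e\<close>
  of the same point of \<open>S\<close> coincide. So it matches the sorted lists entry by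
  entry.\<close>

lemma gap_hausdorff_close_sorted:
  assumes "finite S" "finite T" "gap S g" "gap T g" "hausdorff_close S T e" "2 * e \<le> g"
  shows "card T = card S"
    and "i < card S \<Longrightarrow> \<bar>sorted_list_of_set T ! i - sorted_list_of_set S ! i\<bar> < e"
proof -
  have "\<forall>r\<in>S. \<exists>s. s \<in> T \<and> \<bar>r - s\<bar> < e" using assms(5) by (auto simp: hausdorff_close_def)
  then obtain b where b: "\<And>r. r \<in> S \<Longrightarrow> b r \<in> T \<and> \<bar>r - b r\<bar> < e" by metis
  have mono: "b r < b s" if "r \<in> S" "s \<in> S" "r < s" for r s
  proof -
    have "r + g \<le> s" using assms(3) that by (auto simp: gap_def)
    then show ?thesis using b[OF that(1)] b[OF that(2)] assms(6) by (auto simp: abs_less_iff)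
  qed
  have img: "b ` S = T"
  proof
    show "b ` S \<subseteq> T" using b by auto
    show "T \<subseteq> b ` S"
    proof
      fix s assume s: "s \<in> T"
      then obtain r where r: "r \<in> S" "\<bar>r - s\<bar> < e" using assms(5) by (auto simp: hausdorff_close_def)
      have *: "\<bar>b r - s\<bar> < g" using r(2) b[OF r(1)] assms(6) by (auto simp: abs_less_iff)
      have "b r = s"
      proof (rule ccontr)
        assume "b r \<noteq> s"
        then consider "b r < s" | "s < b r" by linarith
        then show False
          using assms(4) s b[OF r(1)] * unfolding gap_def by cases fastforce+
      qed
      then show "s \<in> b ` S" using r by auto
    qed
  qed
  let ?l = "sorted_list_of_set S"
  have l: "sorted_wrt (<) ?l" "set ?l = S" "length ?l = card S" using assms(1) by auto
  have "sorted_wrt (<) (map b ?l)"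
    unfolding sorted_wrt_map by (rule sorted_wrt_mono_rel[OF _ l(1)]) (use l mono in auto)
  then have "sorted_list_of_set (set (map b ?l)) = map b ?l"
    by (metis sorted_list_of_set.idem_if_sorted_distinct strict_sorted_iff)
  then have eq: "sorted_list_of_set T = map b ?l" using l img by simp
  then have "length (sorted_list_of_set T) = length ?l" by simp
  then show "card T = card S" by simp
  show "\<bar>sorted_list_of_set T ! i - sorted_list_of_set S ! i\<bar> < e" if "i < card S"
  proof -
    have "?l ! i \<in> S" using that l by (metis nth_mem)
    then show ?thesis using b[of "?l ! i"] that l eq by (simp add: abs_minus_commute)
  qed
qed

lemma sorted_wrt_less_nth:
  fixes l :: "real list"
  assumes "sorted_wrt (<) l" "i < length l" "j < length l"
  shows "l ! i < l ! j \<longleftrightarrow> i < j"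
  using assms by (metis linorder_neqE_nat not_less_iff_gr_or_eq sorted_wrt_iff_nth_less)

text \<open>
  By \<open>gap_hausdorff_close_sorted\<close>, near a good point the number of points in the
  fibre is constant and the points depend continuously on the base point.
\<close>

definition good :: "nat \<Rightarrow> (nat \<Rightarrow> real) set \<Rightarrow> (nat \<Rightarrow> real) set \<Rightarrow> (nat \<Rightarrow> real) \<Rightarrow> bool"
  where "good n Y C x \<longleftrightarrow>
    (\<exists>g>0. \<exists>d>0. \<forall>y\<in>Rn n. y \<in> cube n x d \<and> y \<in> C \<longrightarrow> gap (fibre n Y y) g) \<and>
    (\<forall>e>0. \<exists>d>0. \<forall>y\<in>Rn n. y \<in> cube n x d \<and> y \<in> C \<longrightarrow> hausdorff_close (fibre n Y x) (fibre n Y y) e)"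

section \<open>Decomposable sets and the density of good points\<close>

context o_minimal_structure
begin

lemma Def_ball_Collect [def_intros]:
  "Def (\<lambda>e. \<forall>r. Q e r \<longrightarrow> P e r) \<Longrightarrow> Def (\<lambda>e. \<forall>r\<in>{r. Q e r}. P e r)"
  by simp

lemma Def_bex_Collect [def_intros]:
  "Def (\<lambda>e. \<exists>r. Q e r \<and> P e r) \<Longrightarrow> Def (\<lambda>e. \<exists>r\<in>{r. Q e r}. P e r)"
  by simp

lemma definable_over:
  assumes "A \<in> D (Suc n)" "C \<in> D n" shows "over n A C \<in> D (Suc n)"
proof -
  have "{z \<in> Rn (Suc n). restr n z \<in> C} \<in> D (Suc n)"
    by (rule definable_Collect) (unfold restr_def, rule Def_in[OF assms(2)], intro def_intros)
  moreover have "over n A C = A \<inter> {z \<in> Rn (Suc n). restr n z \<in> C}"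
    using definable_subset[OF assms(1)] by (auto simp: over_def)
  ultimately show ?thesis using assms by (simp add: definable_Int)
qed

definition decomposable :: "nat \<Rightarrow> (nat \<Rightarrow> real) set \<Rightarrow> bool"
  where "decomposable n A \<longleftrightarrow> (\<exists>P. cell_decomposition D n A P)"

lemma decomposable_UN:
  assumes "finite I" "\<And>i. i \<in> I \<Longrightarrow> decomposable n (A i)"
    and "\<And>i j. i \<in> I \<Longrightarrow> j \<in> I \<Longrightarrow> i \<noteq> j \<Longrightarrow> A i \<inter> A j = {}"
  shows "decomposable n (\<Union>i\<in>I. A i)"
proof -
  obtain P where P: "\<And>i. i \<in> I \<Longrightarrow> cell_decomposition D n (A i) (P i)"
    using assms(2) unfolding decomposable_def by metis
  have U: "\<Union>(P i) = A i" "disjoint (P i)" "{} \<notin> P i" if "i \<in> I" for i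
    using P[OF that] by (auto simp: cell_decomposition_def partition_on_def)
  have "cell_decomposition D n (\<Union>i\<in>I. A i) (\<Union>i\<in>I. P i)"
    unfolding cell_decomposition_def partition_on_def
  proof (intro conjI)
    show "finite (\<Union>i\<in>I. P i)" using assms(1) P by (auto simp: cell_decomposition_def)
    have "\<Union>(\<Union>i\<in>I. P i) = (\<Union>i\<in>I. \<Union>(P i))" by blast
    also have "\<dots> = (\<Union>i\<in>I. A i)" by (rule SUP_cong) (simp_all add: U(1))
    finally show "\<Union>(\<Union>i\<in>I. P i) = (\<Union>i\<in>I. A i)" .
    show "disjoint (\<Union>i\<in>I. P i)"
    proof (rule pairwiseI)
      fix B C assume B: "B \<in> (\<Union>i\<in>I. P i)" and C: "C \<in> (\<Union>i\<in>I. P i)" and ne: "B \<noteq> C"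
      obtain i where i: "i \<in> I" "B \<in> P i" using B by blast
      obtain j where j: "j \<in> I" "C \<in> P j" using C by blast
      show "disjnt B C"
      proof (cases "i = j")
        case True
        then show ?thesis using U(2)[OF i(1)] i j ne by (simp add: pairwise_def)
      next
        case False
        then have "A i \<inter> A j = {}" using assms(3) i j by blast
        moreover have "B \<subseteq> A i" "C \<subseteq> A j" using U i j by blast+
        ultimately show ?thesis by (auto simp: disjnt_def)
      qed
    qed
    show "{} \<notin> (\<Union>i\<in>I. P i)" using U by blast
    show "\<forall>C\<in>\<Union>i\<in>I. P i. \<exists>d. cell D n d C" using P by (auto simp: cell_decomposition_def)
  qed
  then show ?thesis by (auto simp: decomposable_def)
qed

lemma decomposable_empty: "decomposable n {}"
  using decomposable_UN[of "{}" n] by simp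

lemma decomposable_Un:
  assumes "decomposable n A" "decomposable n B" "A \<inter> B = {}"
  shows "decomposable n (A \<union> B)"
proof -
  have "decomposable n (\<Union>b\<in>{True, False}. if b then A else B)"
    using assms by (intro decomposable_UN) auto
  then show ?thesis by (simp add: Un_commute)
qed

lemma decomposable_cell: "cell D n d C \<Longrightarrow> decomposable n C"
  unfolding decomposable_def cell_decomposition_def partition_on_def
  by (intro exI[of _ "{C}"]) (auto dest: cell_nonempty)

lemma cell_fun_subset:
  assumes "cell_fun D n A f" "A \<subseteq> Rn n" "C \<in> D n" "C \<subseteq> A"
  shows "cell_fun D n C f"
proof -
  have "graph_on n f C = over n (graph_on n f A) C"
    using assms(2,4) by (auto simp: over_def subset_iff)
  moreover have "continuous_map (subtopology (Euclidean_space n) C) euclideanreal f"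
    unfolding continuous_map_Rn_iff[OF order_trans[OF assms(4,2)]]
  proof (intro ballI allI impI)
    fix x e assume x: "x \<in> C" "(0::real) < e"
    then have "x \<in> A" using assms(4) by blast
    from cell_fun_cont[OF assms(1,2) this x(2)]
    show "\<exists>d>0. \<forall>y\<in>cube n x d \<inter> C. \<bar>f y - f x\<bar> < e" using assms(4) by blast
  qed
  ultimately show ?thesis using assms definable_over by (auto simp: cell_fun_def)
qed

lemma cell_bound_subset:
  assumes "cell_bound D n A f" "A \<subseteq> Rn n" "C \<in> D n" "C \<subseteq> A"
  shows "cell_bound D n C f"
  using assms cell_fun_subset unfolding cell_bound_def by blast

lemma cell_decomposition_cells:
  assumes "cell_decomposition D n A P"
  shows "finite P" "\<Union>P = A" "\<And>C C'. C \<in> P \<Longrightarrow> C' \<in> P \<Longrightarrow> C \<noteq> C' \<Longrightarrow> C \<inter> C' = {}"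
    "\<And>C. C \<in> P \<Longrightarrow> \<exists>d. cell D n d C"
  using assms by (auto simp: cell_decomposition_def partition_on_def pairwise_def disjnt_def)

lemma decomposable_graph:
  assumes "decomposable n A" "cell_fun D n A f" "A \<subseteq> Rn n"
  shows "decomposable (Suc n) (graph_on n f A)"
proof -
  obtain P where P: "cell_decomposition D n A P" using assms(1) decomposable_def by blast
  note PP = cell_decomposition_cells[OF P]
  have "decomposable (Suc n) (\<Union>C\<in>P. graph_on n f C)"
  proof (rule decomposable_UN)
    fix C assume C: "C \<in> P"
    then obtain d where d: "cell D n d C" using PP by blast
    have "cell_fun D n C f"
      using cell_fun_subset[OF assms(2,3) definable_cell[OF d]] PP C by blast
    then show "decomposable (Suc n) (graph_on n f C)" using cell.graph[OF d] decomposable_cell by blast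
  next
    fix C C' assume C: "C \<in> P" "C' \<in> P" "C \<noteq> C'"
    then have "C \<inter> C' = {}" "C \<subseteq> Rn n" "C' \<subseteq> Rn n" using PP assms(3) by blast+
    then show "graph_on n f C \<inter> graph_on n f C' = {}" by (auto simp: upd_eq_iff subset_iff)
  qed (use PP in auto)
  moreover have "(\<Union>C\<in>P. graph_on n f C) = graph_on n f A" using PP(2) by blast
  ultimately show ?thesis by simp
qed

lemma decomposable_band:
  assumes "decomposable n A" "cell_bound D n A f" "cell_bound D n A g" "A \<subseteq> Rn n" "\<forall>x\<in>A. f x < g x"
  shows "decomposable (Suc n) (band_on n f g A)"
proof -
  obtain P where P: "cell_decomposition D n A P" using assms(1) decomposable_def by blast
  note PP = cell_decomposition_cells[OF P]
  have "decomposable (Suc n) (\<Union>C\<in>P. band_on n f g C)"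
  proof (rule decomposable_UN)
    fix C assume C: "C \<in> P"
    then obtain d where d: "cell D n d C" using PP by blast
    have sub: "C \<subseteq> A" using PP C by blast
    have "cell_bound D n C f" "cell_bound D n C g"
      using cell_bound_subset[OF _ assms(4) definable_cell[OF d] sub] assms(2,3) by blast+
    moreover have "\<forall>x\<in>C. f x < g x" using assms(5) sub by blast
    ultimately show "decomposable (Suc n) (band_on n f g C)" using cell.band[OF d] decomposable_cell by blast
  next
    fix C C' assume C: "C \<in> P" "C' \<in> P" "C \<noteq> C'"
    then have "C \<inter> C' = {}" "C \<subseteq> Rn n" "C' \<subseteq> Rn n" using PP assms(4) by blast+
    then show "band_on n f g C \<inter> band_on n f g C' = {}" by (auto simp: upd_eq_iff subset_iff)
  qed (use PP in auto)
  moreover have "(\<Union>C\<in>P. band_on n f g C) = band_on n f g A" using PP(2) by blast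
  ultimately show ?thesis by simp
qed

lemma definable_good:
  assumes "Y \<in> D (Suc n)" "C \<in> D n"
  shows "{x \<in> Rn n. good n Y C x} \<in> D n"
  unfolding good_def gap_def hausdorff_close_def fibre_def abs_less_iff
  by (rule definable_Collect, unfold restr_def)
    (intro def_intros Def_in[OF assms(1)] Def_in[OF assms(2)])

text \<open>Three uses of the Baire property, each on a smaller cube. The first makes the gap
  uniform. If there were no good point, Hausdorff continuity would fail at every point, and the
  second use fixes a scale \<open>1 / (j + 1)\<close> at which it fails throughout. The third fixes
  a finite list of rational intervals, shorter than that scale, which describes all fibres; any two
  of these fibres are then closer than the scale, a contradiction.\<close>

lemma good_dense:
  assumes Y: "Y \<in> D (Suc n)" and C: "cell D n dd C" and fin: "\<And>x. x \<in> C \<Longrightarrow> finite (fibre n Y x)"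
    and x: "x \<in> C" "0 < d"
  shows "\<exists>y\<in>cube n x d \<inter> C. good n Y C y"
proof (rule ccontr)
  assume bad: "\<not> ?thesis"
  have CD: "C \<in> D n" using C definable_cell by blast
  have sub: "C \<subseteq> Rn n" using C cell_sub by blast
  have b: "baire n C" using C baire_cell by blast
  let ?G = "\<lambda>m::nat. {x \<in> Rn n. gap (fibre n Y x) (1 / (real m + 1))}"
  have Gdef: "?G m \<in> D n" for m
    unfolding gap_def fibre_def
    by (rule definable_Collect, unfold restr_def) (intro def_intros Def_in[OF Y])
  have "cube n x d \<inter> C \<subseteq> (\<Union>m. ?G m)" using finite_gap[OF fin] sub by blast
  from b Gdef x this obtain m y1 e1 where
    1: "y1 \<in> C" "0 < e1" "cube n y1 e1 \<subseteq> cube n x d" "cube n y1 e1 \<inter> C \<subseteq> ?G m" by (rule baireD)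
  let ?H = "\<lambda>j::nat. {x \<in> Rn n. \<forall>d. 0 < d \<longrightarrow> (\<exists>y\<in>Rn n. (y \<in> cube n x d \<and> y \<in> C) \<and>
    \<not> hausdorff_close (fibre n Y x) (fibre n Y y) (1 / (real j + 1)))}"
  have Hdef: "?H j \<in> D n" for j
    unfolding hausdorff_close_def fibre_def abs_less_iff
    by (rule definable_Collect, unfold restr_def) (intro def_intros Def_in[OF Y] Def_in[OF CD])
  have "cube n y1 e1 \<inter> C \<subseteq> (\<Union>j. ?H j)"
  proof
    fix y assume y: "y \<in> cube n y1 e1 \<inter> C"
    then obtain r where r: "r > 0" "cube n y r \<subseteq> cube n y1 e1" using cube_refine by blast
    have "\<exists>g>0. \<exists>d>0. \<forall>z\<in>Rn n. z \<in> cube n y d \<and> z \<in> C \<longrightarrow> gap (fibre n Y z) g"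
      using r 1(4) by (intro exI[of _ "1 / (real m + 1)"] conjI exI[of _ r]) auto
    moreover have "\<not> good n Y C y" using bad 1(3) y by blast
    ultimately obtain e where e: "e > 0" "\<forall>d>0. \<exists>z\<in>Rn n. (z \<in> cube n y d \<and> z \<in> C) \<and>
      \<not> hausdorff_close (fibre n Y y) (fibre n Y z) e"
      unfolding good_def by blast
    obtain j where "inverse (real (Suc j)) < e" using reals_Archimedean[OF e(1)] by blast
    then have j: "1 / (real j + 1) < e" by (simp add: inverse_eq_divide add.commute)
    have "hausdorff_close S T e" if "hausdorff_close S T (1 / (real j + 1))" for S T
      using that j unfolding hausdorff_close_def by (meson less_trans)
    then have "y \<in> ?H j" using e(2) y sub by blast
    then show "y \<in> (\<Union>j. ?H j)" by blast
  qed
  from b Hdef 1(1,2) this obtain j y2 e2 where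
    2: "y2 \<in> C" "0 < e2" "cube n y2 e2 \<subseteq> cube n y1 e1" "cube n y2 e2 \<inter> C \<subseteq> ?H j" by (rule baireD)
  \<comment> \<open>Each interval in \<open>L\<close> meets the fibre, and together they cover it.
    The double negation expresses an existential over \<open>set L\<close> by the universal that
    \<open>Def_Ball_finite\<close> handles.\<close>
  let ?V = "\<lambda>L::(rat \<times> rat) list. {x \<in> Rn n.
    (\<forall>p\<in>set L. of_rat (snd p) - of_rat (fst p) < 1 / (real j + 1) \<and>
      (\<exists>r. x(n := r) \<in> Y \<and> of_rat (fst p) < r \<and> r < of_rat (snd p))) \<and>
    (\<forall>r. x(n := r) \<in> Y \<longrightarrow> \<not> (\<forall>p\<in>set L. \<not> (of_rat (fst p) < r \<and> r < of_rat (snd p))))}"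
  have Vdef: "?V L \<in> D n" for L
    by (rule definable_Collect, unfold restr_def)
      (intro def_intros Def_Ball_finite Def_in[OF Y] finite_set)
  have "cube n y2 e2 \<inter> C \<subseteq> (\<Union>L. ?V L)"
  proof
    fix y assume y: "y \<in> cube n y2 e2 \<inter> C"
    have "\<exists>p. of_rat (fst p) < r \<and> r < of_rat (snd p) \<and> of_rat (snd p) - of_rat (fst p) < 1 / (real j + 1)" for r :: real
    proof -
      \<comment> \<open>Both end points are taken within half of the allowed length from
        \<open>r\<close>.\<close>
      let ?h = "1 / (2 * (real j + 1))"
      have h: "?h > 0" by simp
      obtain a where a: "r - ?h < of_rat a" "of_rat a < r" using of_rat_dense[of "r - ?h" r] h by auto
      obtain b where b: "r < of_rat b" "of_rat b < r + ?h" using of_rat_dense[of r "r + ?h"] h by auto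
      have "of_rat b - of_rat a < 2 * ?h" using a b by linarith
      then show ?thesis using a b by (intro exI[of _ "(a, b)"]) (auto simp: field_simps)
    qed
    then obtain p where p: "\<And>r::real. of_rat (fst (p r)) < r \<and> r < of_rat (snd (p r)) \<and>
      of_rat (snd (p r)) - of_rat (fst (p r)) < 1 / (real j + 1)" by metis
    obtain l where l: "set l = fibre n Y y" using fin y finite_list by blast
    have "y \<in> ?V (map p l)" using p l y sub by (auto simp: fibre_def)
    then show "y \<in> (\<Union>L. ?V L)" by blast
  qed
  from b Vdef 2(1,2) this obtain L y3 e3 where
    3: "y3 \<in> C" "0 < e3" "cube n y3 e3 \<subseteq> cube n y2 e2" "cube n y3 e3 \<inter> C \<subseteq> ?V L" by (rule baireD)
  have y3: "y3 \<in> cube n y3 e3 \<inter> C" using 3 sub cube_self by blast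
  then have "y3 \<in> ?H j" using 2(4) 3(3) by blast
  then obtain z where z: "z \<in> cube n y3 e3 \<inter> C"
    "\<not> hausdorff_close (fibre n Y y3) (fibre n Y z) (1 / (real j + 1))"
    using 3(2) by blast
  have V: "u \<in> ?V L" if "u \<in> cube n y3 e3 \<inter> C" for u using 3(4) that by blast
  have one: "\<exists>s. v(n := s) \<in> Y \<and> \<bar>r - s\<bar> < 1 / (real j + 1)" if "u \<in> ?V L" "v \<in> ?V L" "u(n := r) \<in> Y" for u v r
  proof -
    have "\<not> (\<forall>p\<in>set L. \<not> (of_rat (fst p) < r \<and> r < of_rat (snd p)))"
      using that(1,3) by simp
    then obtain p where p: "p \<in> set L" "of_rat (fst p) < r" "r < of_rat (snd p)" by blast
    have v: "of_rat (snd p) - of_rat (fst p) < 1 / (real j + 1)"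
      "\<exists>s. v(n := s) \<in> Y \<and> of_rat (fst p) < s \<and> s < of_rat (snd p)"
      using that(2) p(1) by simp_all
    then obtain s where s: "v(n := s) \<in> Y" "of_rat (fst p) < s" "s < of_rat (snd p)" by blast
    moreover note v(1)
    ultimately show ?thesis using p by (intro exI[of _ s]) (auto simp: abs_less_iff)
  qed
  have "hausdorff_close (fibre n Y y3) (fibre n Y z) (1 / (real j + 1))"
    unfolding hausdorff_close_def fibre_def
    using one[OF V[OF y3] V[OF z(1)]] one[OF V[OF z(1)] V[OF y3]]
    by (simp add: Bex_def abs_minus_commute)
  then show False using z by blast
qed

end

section \<open>Points of finite fibres in increasing order, and the frontier of a fibre\<close>

definition nth_pt :: "nat \<Rightarrow> (nat \<Rightarrow> real) set \<Rightarrow> nat \<Rightarrow> (nat \<Rightarrow> real) \<Rightarrow> real"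
  where "nth_pt n Y i x = sorted_list_of_set (fibre n Y x) ! i"

text \<open>At least \<open>i\<close> points of the fibre of \<open>Y\<close> lie strictly below the
  height of \<open>z\<close>: a count expressed by a formula, which makes the points of a fibre
  definable one by one.\<close>

primrec at_least :: "nat \<Rightarrow> (nat \<Rightarrow> real) set \<Rightarrow> nat \<Rightarrow> (nat \<Rightarrow> real) set"
  where
    "at_least n Y 0 = Rn (Suc n)"
  | "at_least n Y (Suc i) = {z \<in> Rn (Suc n). \<exists>s. s < z n \<and> (restr n z)(n := s) \<in> Y \<and>
      (restr n z)(n := s) \<in> at_least n Y i}"

text \<open>The topological boundary of \<open>A\<close> within each vertical line.\<close>

definition fibre_frontier :: "nat \<Rightarrow> (nat \<Rightarrow> real) set \<Rightarrow> (nat \<Rightarrow> real) set"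
  where "fibre_frontier n A = {z \<in> Rn (Suc n). \<forall>e>0. \<exists>t. \<bar>t - z n\<bar> < e \<and>
    \<not> ((restr n z)(n := t) \<in> A \<longleftrightarrow> z \<in> A)}"

lemma nth_pt_less:
  assumes "finite (fibre n Y x)" "i < card (fibre n Y x)" "j < card (fibre n Y x)"
  shows "nth_pt n Y i x < nth_pt n Y j x \<longleftrightarrow> i < j"
  unfolding nth_pt_def using assms by (intro sorted_wrt_less_nth) auto

lemma nth_pt_in:
  assumes "finite (fibre n Y x)" "i < card (fibre n Y x)"
  shows "nth_pt n Y i x \<in> fibre n Y x"
  unfolding nth_pt_def using assms
  by (metis length_sorted_list_of_set nth_mem set_sorted_list_of_set)

lemma nth_pt_cases:
  assumes "finite (fibre n Y x)" "r \<in> fibre n Y x"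
  obtains i where "i < card (fibre n Y x)" "r = nth_pt n Y i x"
  using assms unfolding nth_pt_def
  by (metis in_set_conv_nth length_sorted_list_of_set set_sorted_list_of_set)

text \<open>Having \<open>i > 0\<close> points below \<open>r\<close> means that the
  \<open>i\<close>-th smallest is below \<open>r\<close>; its index is \<open>i - 1\<close> since
  \<open>nth_pt\<close> counts from 0.\<close>

lemma at_least_iff:
  assumes "x \<in> Rn n" "finite (fibre n Y x)"
  shows "x(n := r) \<in> at_least n Y i \<longleftrightarrow> i = 0 \<or> i \<le> card (fibre n Y x) \<and> nth_pt n Y (i - 1) x < r"
proof (induction i arbitrary: r)
  case 0
  have "x(n := r) \<in> Rn (Suc n)" by (rule upd_in_Rn[OF assms(1)])
  then show ?case by (simp only: at_least.simps simp_thms)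
next
  case (Suc i)
  let ?k = "card (fibre n Y x)"
  have "x(n := r) \<in> at_least n Y (Suc i) \<longleftrightarrow>
      (\<exists>s<r. s \<in> fibre n Y x \<and> (i = 0 \<or> i \<le> ?k \<and> nth_pt n Y (i - 1) x < s))"
    using assms by (simp add: upd_in_Rn Suc fibre_def)
  also have "\<dots> \<longleftrightarrow> Suc i \<le> ?k \<and> nth_pt n Y i x < r"
  proof
    assume "\<exists>s<r. s \<in> fibre n Y x \<and> (i = 0 \<or> i \<le> ?k \<and> nth_pt n Y (i - 1) x < s)"
    then obtain s where s: "s < r" "s \<in> fibre n Y x" "i = 0 \<or> i \<le> ?k \<and> nth_pt n Y (i - 1) x < s" by blast
    obtain j where j: "j < ?k" "s = nth_pt n Y j x" using nth_pt_cases[OF assms(2) s(2)] .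
    have ij: "i \<le> j"
    proof (cases "i = 0")
      case False
      then have "i - 1 < j" using s(3) j nth_pt_less[OF assms(2), of "i - 1" j] by auto
      then show ?thesis by simp
    qed auto
    then have "\<not> nth_pt n Y j x < nth_pt n Y i x" using nth_pt_less[OF assms(2), of j i] j by auto
    then show "Suc i \<le> ?k \<and> nth_pt n Y i x < r" using s(1) j ij by auto
  next
    assume i: "Suc i \<le> ?k \<and> nth_pt n Y i x < r"
    then have "nth_pt n Y i x \<in> fibre n Y x" by (intro nth_pt_in[OF assms(2)]) simp
    moreover have "i = 0 \<or> nth_pt n Y (i - 1) x < nth_pt n Y i x"
    proof (cases "i = 0")
      case False
      then have "i - 1 < ?k" "i < ?k" "i - 1 < i" using i by auto
      then show ?thesis using nth_pt_less[OF assms(2)] by blast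
    qed simp
    ultimately
    show "\<exists>s<r. s \<in> fibre n Y x \<and> (i = 0 \<or> i \<le> ?k \<and> nth_pt n Y (i - 1) x < s)"
      using i by (intro exI[of _ "nth_pt n Y i x"]) auto
  qed
  finally show ?case by (simp only: nat.distinct diff_Suc_1 simp_thms)
qed

lemma fibre_fibre_frontier:
  "x \<in> Rn n \<Longrightarrow> fibre n (fibre_frontier n A) x =
    {r. \<forall>e>0. \<exists>t. \<bar>t - r\<bar> < e \<and> \<not> (x(n := t) \<in> A \<longleftrightarrow> x(n := r) \<in> A)}"
  by (auto simp: fibre_def fibre_frontier_def upd_in_Rn)

lemma constant_off_fibre_frontier:
  assumes "x \<in> Rn n" "is_interval S" "S \<inter> fibre n (fibre_frontier n A) x = {}" "s \<in> S" "t \<in> S"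
  shows "x(n := s) \<in> A \<longleftrightarrow> x(n := t) \<in> A"
proof (rule loc_const_interval[OF assms(2) _ assms(4,5)])
  fix r assume "r \<in> S"
  then have "\<not> (\<forall>e>0. \<exists>t. \<bar>t - r\<bar> < e \<and> \<not> (x(n := t) \<in> A \<longleftrightarrow> x(n := r) \<in> A))"
    using assms(3) by (auto simp: fibre_fibre_frontier[OF assms(1)])
  then show "\<exists>d>0. \<forall>s\<in>S. \<bar>s - r\<bar> < d \<longrightarrow> (x(n := s) \<in> A) = (x(n := r) \<in> A)" by blast
qed

lemma goodE:
  assumes "good n Y C x" "x \<in> C" "C \<subseteq> Rn n" "\<And>y. y \<in> C \<Longrightarrow> finite (fibre n Y y)" "0 < e"
  obtains d where "0 < d" "\<And>y. y \<in> cube n x d \<inter> C \<Longrightarrow> card (fibre n Y y) = card (fibre n Y x)"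
    "\<And>y i. y \<in> cube n x d \<inter> C \<Longrightarrow> i < card (fibre n Y x) \<Longrightarrow> \<bar>nth_pt n Y i y - nth_pt n Y i x\<bar> < e"
proof -
  obtain g d1 where g: "g > 0" "d1 > 0" "\<And>y. y \<in> cube n x d1 \<inter> C \<Longrightarrow> gap (fibre n Y y) g"
    using assms(1,3) unfolding good_def by blast
  \<comment> \<open>The bound \<open>g / 2\<close> provides the hypothesis
    \<open>2 * e' \<le> g\<close> of \<open>gap_hausdorff_close_sorted\<close>.\<close>
  define e' where "e' = min e (g / 2)"
  have "e' > 0" using g assms by (auto simp: e'_def)
  then obtain d2 where d2: "d2 > 0"
    "\<And>y. y \<in> cube n x d2 \<inter> C \<Longrightarrow> hausdorff_close (fibre n Y x) (fibre n Y y) e'"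
    using assms(1,3) unfolding good_def by blast
  show ?thesis
  proof (rule that[of "min d1 d2"])
    fix y assume y: "y \<in> cube n x (min d1 d2) \<inter> C"
    have "y \<in> cube n x d1 \<inter> C" "y \<in> cube n x d2 \<inter> C"
      using y cube_mono[of "min d1 d2" d1 n x] cube_mono[of "min d1 d2" d2 n x] by auto
    moreover have "x \<in> cube n x d1 \<inter> C" using assms(2,3) g(2) cube_self by blast
    ultimately have *: "finite (fibre n Y x)" "finite (fibre n Y y)" "gap (fibre n Y x) g" "gap (fibre n Y y) g"
      "hausdorff_close (fibre n Y x) (fibre n Y y) e'" "2 * e' \<le> g"
      using assms(4) g d2 by (auto simp: e'_def)
    show "card (fibre n Y y) = card (fibre n Y x)"
      by (rule gap_hausdorff_close_sorted(1)[OF *])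
    fix i assume "i < card (fibre n Y x)"
    from gap_hausdorff_close_sorted(2)[OF * this]
    show "\<bar>nth_pt n Y i y - nth_pt n Y i x\<bar> < e" by (simp add: nth_pt_def e'_def)
  qed (use g d2 in auto)
qed

lemma good_subset: "good n Y C x \<Longrightarrow> C' \<subseteq> C \<Longrightarrow> good n Y C' x"
  unfolding good_def by (meson subsetD)

section \<open>Decomposition of a set over a cell\<close>

context o_minimal_structure
begin

lemma definable_at_least: "Y \<in> D (Suc n) \<Longrightarrow> at_least n Y i \<in> D (Suc n)"
proof (induction i)
  case (Suc i)
  then show ?case unfolding at_least.simps
    by (intro definable_Collect, unfold restr_def)
      (intro def_intros Def_in[OF Suc.prems] Def_in[OF Suc.IH], auto intro: Suc.prems)
qed auto

text \<open>Continuity comes from \<open>goodE\<close>. For definability, the point with index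
  \<open>i\<close> is the one in the fibre with at least \<open>i\<close> but not
  \<open>i + 1\<close> points below it.\<close>

lemma cell_fun_nth_pt:
  assumes "Y \<in> D (Suc n)" "C \<in> D n" "\<And>x. x \<in> C \<Longrightarrow> finite (fibre n Y x)"
    "\<And>x. x \<in> C \<Longrightarrow> good n Y C x" "\<And>x. x \<in> C \<Longrightarrow> card (fibre n Y x) = k" "i < k"
  shows "cell_fun D n C (nth_pt n Y i)"
proof -
  have sub: "C \<subseteq> Rn n" using assms(2) definable_subset by blast
  have "continuous_map (subtopology (Euclidean_space n) C) euclideanreal (nth_pt n Y i)"
    unfolding continuous_map_Rn_iff[OF sub]
  proof (intro ballI allI impI)
    fix x e assume x: "x \<in> C" "(0::real) < e"
    obtain d where "0 < d"
      "\<And>y i. y \<in> cube n x d \<inter> C \<Longrightarrow> i < card (fibre n Y x) \<Longrightarrow> \<bar>nth_pt n Y i y - nth_pt n Y i x\<bar> < e"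
      using goodE[OF assms(4)[OF x(1)] x(1) sub assms(3) x(2)] by metis
    then show "\<exists>d>0. \<forall>y\<in>cube n x d \<inter> C. \<bar>nth_pt n Y i y - nth_pt n Y i x\<bar> < e"
      using assms(5,6) x(1) by blast
  qed
  moreover have "graph_on n (nth_pt n Y i) C = over n (Y \<inter> (at_least n Y i - at_least n Y (Suc i))) C" (is "?L = ?R")
  proof -
    have "x(n := r) \<in> Y \<inter> (at_least n Y i - at_least n Y (Suc i)) \<longleftrightarrow> r = nth_pt n Y i x" if x: "x \<in> C" for x r
    proof -
      have xR: "x \<in> Rn n" using x sub by blast
      note f = assms(3)[OF x] and k = assms(5)[OF x]
      have 1: "x(n := r) \<in> Y \<longleftrightarrow> r \<in> fibre n Y x" by (simp add: fibre_def)
      show ?thesis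
        unfolding Int_iff Diff_iff at_least_iff[OF xR f] 1
      proof
        assume r: "r \<in> fibre n Y x \<and> (i = 0 \<or> i \<le> card (fibre n Y x) \<and> nth_pt n Y (i - 1) x < r) \<and>
          \<not> (Suc i = 0 \<or> Suc i \<le> card (fibre n Y x) \<and> nth_pt n Y (Suc i - 1) x < r)"
        obtain j where j: "j < card (fibre n Y x)" "r = nth_pt n Y j x" using nth_pt_cases[OF f] r by blast
        have "\<not> i < j" using r j nth_pt_less[OF f, of i j] assms(6) k by auto
        moreover have "i = 0 \<or> i - 1 < j"
        proof (cases "i = 0")
          case False
          then have "i - 1 < card (fibre n Y x)" using assms(6) k by simp
          then show ?thesis using r j nth_pt_less[OF f, of "i - 1" j] False by blast
        qed auto
        ultimately have "i = j" by linarith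
        then show "r = nth_pt n Y i x" using j by simp
      next
        assume "r = nth_pt n Y i x"
        then show "r \<in> fibre n Y x \<and> (i = 0 \<or> i \<le> card (fibre n Y x) \<and> nth_pt n Y (i - 1) x < r) \<and>
          \<not> (Suc i = 0 \<or> Suc i \<le> card (fibre n Y x) \<and> nth_pt n Y (Suc i - 1) x < r)"
          using nth_pt_in[OF f, of i] nth_pt_less[OF f, of "i - 1" i] assms(6) k by auto
      qed
    qed
    note * = this
    show ?thesis
    proof
      show "?L \<subseteq> ?R"
      proof
        fix z assume "z \<in> ?L"
        then obtain x where "x \<in> C" "z = x(n := nth_pt n Y i x)" by blast
        then show "z \<in> ?R" using *[of x "nth_pt n Y i x"] sub by (auto simp: over_def subset_iff)
      qed
      show "?R \<subseteq> ?L"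
      proof
        fix z assume z: "z \<in> ?R"
        then have "z \<in> Rn (Suc n)" using definable_subset[OF assms(1)] by (auto simp: over_def)
        then obtain x t where x: "z = x(n := t)" "x \<in> Rn n" by (rule Rn_Suc_cases)
        then have "x \<in> C" using z by (auto simp: over_def)
        moreover have "z \<in> Y \<inter> (at_least n Y i - at_least n Y (Suc i))" using z by (auto simp: over_def)
        ultimately have "t = nth_pt n Y i x" using *[of x t] x by metis
        then show "z \<in> ?L" using x \<open>x \<in> C\<close> by blast
      qed
    qed
  qed
  moreover have "?R \<in> D (Suc n)"
    using assms(1,2) definable_at_least by (intro definable_over definable_Int definable_Diff)
  ultimately show ?thesis by (simp add: cell_fun_def)
qed

lemma definable_fibre_frontier:
  assumes "A \<in> D (Suc n)" shows "fibre_frontier n A \<in> D (Suc n)"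
  unfolding fibre_frontier_def abs_less_iff
  by (rule definable_Collect, unfold restr_def) (intro def_intros Def_in[OF assms])

text \<open>Otherwise the frontier contains an interval of the vertical line. On a part of it
  membership in \<open>A\<close> is constant, by o-minimality for \<open>A\<close> or for its
  complement, and the midpoint of that part is no frontier point.\<close>

lemma finite_fibre_frontier:
  assumes A: "A \<in> D (Suc n)" and x: "x \<in> Rn n"
  shows "finite (fibre n (fibre_frontier n A) x)"
proof (rule ccontr)
  assume "\<not> ?thesis"
  then have inf: "infinite {r. x(n := r) \<in> fibre_frontier n A}" by (simp add: fibre_def)
  have "Def (\<lambda>e. x(n := e 0) \<in> fibre_frontier n A)"
    by (rule Def_fiber[OF definable_fibre_frontier[OF A] x])
  from infinite_definable_real[OF this inf] obtain p q where
    pq: "p < q" "{p<..<q} \<subseteq> {r. x(n := r) \<in> fibre_frontier n A}" by blast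
  have dA: "Def (\<lambda>e. x(n := e 0) \<in> A)" by (rule Def_fiber[OF A x])
  have *: False if "a < b" "{a<..<b} \<subseteq> {p<..<q}" "\<forall>t\<in>{a<..<b}. (x(n := t) \<in> A) = c" for a b c
  proof -
    let ?m = "(a + b) / 2"
    have m: "?m \<in> {a<..<b}" using that by auto
    then have "?m \<in> {r. x(n := r) \<in> fibre_frontier n A}" using that(2) pq(2) by blast
    then have "?m \<in> fibre n (fibre_frontier n A) x" by (simp add: fibre_def)
    then have "\<forall>e>0. \<exists>t. \<bar>t - ?m\<bar> < e \<and> \<not> (x(n := t) \<in> A \<longleftrightarrow> x(n := ?m) \<in> A)"
      unfolding fibre_fibre_frontier[OF x] by (rule CollectD)
    moreover have "0 < (b - a) / 2" using that(1) by simp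
    ultimately obtain t where t: "\<bar>t - ?m\<bar> < (b - a) / 2" "\<not> (x(n := t) \<in> A \<longleftrightarrow> x(n := ?m) \<in> A)"
      by blast
    have "t \<in> {a<..<b}" using t(1) by (auto simp: abs_less_iff field_simps)
    then show False using t(2) m that(3) by blast
  qed
  have cases: "infinite {t. p < t \<and> t < q \<and> x(n := t) \<in> A} \<or> infinite {t. p < t \<and> t < q \<and> x(n := t) \<notin> A}"
  proof -
    have inf: "infinite {p<..<q}" using pq(1) by (simp add: infinite_Ioo)
    have "{p<..<q} = {t. p < t \<and> t < q \<and> x(n := t) \<in> A} \<union> {t. p < t \<and> t < q \<and> x(n := t) \<notin> A}" by auto
    from inf[unfolded this finite_Un] show ?thesis by blast
  qed
  then show False
  proof
    assume i: "infinite {t. p < t \<and> t < q \<and> x(n := t) \<in> A}"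
    have "Def (\<lambda>e. p < e 0 \<and> e 0 < q \<and> x(n := e 0) \<in> A)" by (intro def_intros dA)
    from infinite_definable_real[OF this i] obtain a b where
      ab: "a < b" "{a<..<b} \<subseteq> {t. p < t \<and> t < q \<and> x(n := t) \<in> A}" by blast
    show False by (rule *[of a b True]) (use ab in \<open>auto simp: subset_iff\<close>)
  next
    assume i: "infinite {t. p < t \<and> t < q \<and> x(n := t) \<notin> A}"
    have "Def (\<lambda>e. p < e 0 \<and> e 0 < q \<and> x(n := e 0) \<notin> A)" by (intro def_intros dA)
    from infinite_definable_real[OF this i] obtain a b where
      ab: "a < b" "{a<..<b} \<subseteq> {t. p < t \<and> t < q \<and> x(n := t) \<notin> A}" by blast
    show False by (rule *[of a b False]) (use ab in \<open>auto simp: subset_iff\<close>)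
  qed
qed

text \<open>Over \<open>C\<close> the frontier of \<open>A\<close> consists of \<open>k\<close>
  continuous graphs, and membership in \<open>A\<close> is constant on the vertical intervals
  between them. Hence \<open>A\<close> over \<open>C\<close> is a union of graphs and bands over
  definable subsets of \<open>C\<close>, which the hypothesis \<open>IH\<close> decomposes.\<close>

lemma decomposable_over_good:
  assumes IH: "\<And>B. B \<in> D n \<Longrightarrow> decomposable n B"
    and A: "A \<in> D (Suc n)" and C: "C \<in> D n" and Y: "Y = fibre_frontier n A"
    and gd: "\<And>x. x \<in> C \<Longrightarrow> good n Y C x" and k: "\<And>x. x \<in> C \<Longrightarrow> card (fibre n Y x) = k"
  shows "decomposable (Suc n) (over n A C)"
proof -
  have sub: "C \<subseteq> Rn n" using C definable_subset by blast
  have YD: "Y \<in> D (Suc n)" using A Y definable_fibre_frontier by simp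
  have fin: "finite (fibre n Y x)" if "x \<in> C" for x
    using finite_fibre_frontier[OF A] that sub Y by blast
  let ?y = "nth_pt n Y"
  \<comment> \<open>The \<open>k\<close> graphs separate \<open>k + 1\<close> bands; band
    \<open>i\<close> lies between the points with index \<open>i - 1\<close> and \<open>i\<close>,
    with infinite bounds at the two extremes.\<close>
  define lo where "lo i = (if i = 0 then (\<lambda>_. -\<infinity>) else (\<lambda>x. ereal (?y (i - 1) x)))" for i
  define hi where "hi i = (if i = k then (\<lambda>_. \<infinity>) else (\<lambda>x. ereal (?y i x)))" for i
  have yf: "cell_fun D n C (?y i)" if "i < k" for i
    using cell_fun_nth_pt[OF YD C fin gd k that] .
  have lob: "cell_bound D n C (lo i)" if "i \<le> k" for i
  proof (cases "i = 0")
    case False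
    then have "cell_fun D n C (?y (i - 1))" using that by (intro yf) simp
    then show ?thesis using False by (auto simp: cell_bound_def lo_def)
  qed (simp add: cell_bound_def lo_def)
  have hib: "cell_bound D n C (hi i)" if "i \<le> k" for i
  proof (cases "i = k")
    case False
    then have "cell_fun D n C (?y i)" using that by (intro yf) simp
    then show ?thesis using False by (auto simp: cell_bound_def hi_def)
  qed (simp add: cell_bound_def hi_def)
  have less: "?y i x < ?y j x \<longleftrightarrow> i < j" if "x \<in> C" "i < k" "j < k" for i j x
    using nth_pt_less[OF fin[OF that(1)]] k[OF that(1)] that by simp
  have lohi: "lo i x < hi i x" if "x \<in> C" "i \<le> k" for i x
    using less[OF that(1), of "i - 1" i] that(2) by (auto simp: lo_def hi_def)
  have inY: "?y i x \<in> fibre n Y x" if "x \<in> C" "i < k" for x i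
    using nth_pt_in[OF fin[OF that(1)]] k[OF that(1)] that by simp
  have off: "t \<notin> fibre n Y x" if "x \<in> C" "i \<le> k" "lo i x < ereal t" "ereal t < hi i x" for x i t
  proof
    assume t: "t \<in> fibre n Y x"
    note fx = fin[OF that(1)] and kx = k[OF that(1)]
    obtain j where j: "j < k" "t = ?y j x" using nth_pt_cases[OF fx t] unfolding kx by blast
    have "i = 0 \<or> i - 1 < j"
    proof (cases "i = 0")
      case False
      then have "i - 1 < k" using that(2) by simp
      then show ?thesis using that(3) j less[OF that(1), of "i - 1" j] False by (simp add: lo_def)
    qed simp
    moreover have "i = k \<or> j < i" using that(2,4) j less[OF that(1), of j i] by (auto simp: hi_def)
    ultimately show False using j(1) by linarith
  qed
  have bands: "i = j" if "x \<in> C" "i \<le> k" "j \<le> k" "lo i x < ereal t" "ereal t < hi i x"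
    "lo j x < ereal t" "ereal t < hi j x" for x i j t
  proof -
    have False if ij: "i < j" "j \<le> k" "ereal t < hi i x" "lo j x < ereal t" for i j
    proof -
      have "t < ?y i x" "?y (j - 1) x < t" using ij by (auto simp: lo_def hi_def)
      then have "?y (j - 1) x < ?y i x" by simp
      moreover have "i < k" "j - 1 < k" "\<not> j - 1 < i" using ij by auto
      ultimately show False using less[OF \<open>x \<in> C\<close>, of "j - 1" i] by blast
    qed
    then show ?thesis using that by (meson linorder_neqE_nat)
  qed
  have cover: "(\<exists>i<k. t = ?y i x) \<or> (\<exists>i\<le>k. lo i x < ereal t \<and> ereal t < hi i x)" if x: "x \<in> C" for x t
  proof (cases "t \<in> fibre n Y x")
    case True
    then show ?thesis using nth_pt_cases[OF fin[OF x] True] unfolding k[OF x] by blast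
  next
    case False
    \<comment> \<open>The first graph above \<open>t\<close> bounds the band that contains
      \<open>t\<close>; the value \<open>k\<close> stands for the absence of such a graph.\<close>
    define i where "i = (LEAST i. i = k \<or> t < ?y i x)"
    have i: "i = k \<or> t < ?y i x" unfolding i_def by (rule LeastI[of _ k]) simp
    have ik: "i \<le> k" unfolding i_def by (rule Least_le) simp
    have "lo i x < ereal t"
    proof (cases "i = 0")
      case False
      then have "i - 1 < (LEAST i. i = k \<or> t < ?y i x)" unfolding i_def by simp
      then have "\<not> (i - 1 = k \<or> t < ?y (i - 1) x)" by (rule not_less_Least)
      moreover have "i - 1 < k" using False ik by simp
      then have "?y (i - 1) x \<noteq> t" using inY[OF x] \<open>t \<notin> fibre n Y x\<close> by blast
      ultimately show ?thesis using False by (auto simp: lo_def)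
    qed (simp add: lo_def)
    moreover have "ereal t < hi i x" using i by (auto simp: hi_def)
    ultimately show ?thesis using ik by blast
  qed
  have proj: "{x \<in> Rn n. \<exists>t. x(n := t) \<in> B} \<in> D n" if "B \<in> D (Suc n)" for B
    using that by (intro definable_Collect) (intro def_intros, rule Def_in, blast, intro def_intros)
  \<comment> \<open>The base points over which the graph with index \<open>i\<close> lies in
    \<open>A\<close>. \<open>Q i\<close> plays this role for the bands, where one point of the
    vertical interval decides for all (\<open>Qall\<close>).\<close>
  define P where "P i = {x \<in> Rn n. \<exists>t. x(n := t) \<in> graph_on n (?y i) C \<inter> A}" for i
  define Q where "Q i = {x \<in> Rn n. \<exists>t. x(n := t) \<in> band_on n (lo i) (hi i) C \<inter> A}" for i
  have PD: "P i \<in> D n" if "i < k" for i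
    unfolding P_def using yf[OF that] A by (intro proj definable_Int) (auto simp: cell_fun_def)
  have QD: "Q i \<in> D n" if "i \<le> k" for i
    unfolding Q_def using lob[OF that] hib[OF that] A C by (intro proj definable_Int definable_band)
  have Pi: "P i = {x \<in> C. x(n := ?y i x) \<in> A}" for i
    unfolding P_def using sub by (auto simp: upd_eq_iff subset_iff)
  have Qi: "Q i = {x \<in> C. \<exists>t. lo i x < ereal t \<and> ereal t < hi i x \<and> x(n := t) \<in> A}" for i
  proof -
    define B where "B = band_on n (lo i) (hi i) C"
    have "x(n := t) \<in> B \<longleftrightarrow> x \<in> C \<and> lo i x < ereal t \<and> ereal t < hi i x"
      if "x \<in> Rn n" for x t
      using that sub unfolding B_def by (auto simp: upd_eq_iff subset_iff)
    then have "{x \<in> Rn n. \<exists>t. x(n := t) \<in> B \<inter> A} =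
      {x \<in> C. \<exists>t. lo i x < ereal t \<and> ereal t < hi i x \<and> x(n := t) \<in> A}"
      using sub by blast
    then show ?thesis unfolding Q_def B_def .
  qed
  have Qall: "x(n := t) \<in> A" if "i \<le> k" "x \<in> Q i" "lo i x < ereal t" "ereal t < hi i x" for i x t
  proof -
    from that(2) obtain s where s: "x \<in> C" "lo i x < ereal s" "ereal s < hi i x" "x(n := s) \<in> A"
      unfolding Qi by blast
    have "x(n := s) \<in> A \<longleftrightarrow> x(n := t) \<in> A"
    proof (rule constant_off_fibre_frontier[of x n "{t. lo i x < ereal t \<and> ereal t < hi i x}"])
      show "is_interval {t. lo i x < ereal t \<and> ereal t < hi i x}"
        unfolding is_interval_1 by (auto intro: le_less_trans less_le_trans)
          (meson ereal_less_eq(3) le_less_trans less_le_trans)+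
      show "{t. lo i x < ereal t \<and> ereal t < hi i x} \<inter> fibre n (fibre_frontier n A) x = {}"
        using off[OF s(1) that(1)] Y by blast
    qed (use s that sub in auto)
    then show ?thesis using s by simp
  qed
  have eq: "over n A C = (\<Union>i<k. graph_on n (?y i) (P i)) \<union> (\<Union>i\<le>k. band_on n (lo i) (hi i) (Q i))" (is "?L = ?R")
  proof
    show "?L \<subseteq> ?R"
    proof
      fix z assume z: "z \<in> ?L"
      then have "z \<in> Rn (Suc n)" using definable_subset[OF A] by (auto simp: over_def)
      then obtain x t where x: "z = x(n := t)" "x \<in> Rn n" by (rule Rn_Suc_cases)
      then have xC: "x \<in> C" "x(n := t) \<in> A" using z by (auto simp: over_def)
      from cover[OF xC(1), of t] show "z \<in> ?R"
      proof
        assume "\<exists>i<k. t = ?y i x"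
        then show ?thesis using x xC Pi by blast
      next
        assume "\<exists>i\<le>k. lo i x < ereal t \<and> ereal t < hi i x"
        then obtain i where i: "i \<le> k" "lo i x < ereal t" "ereal t < hi i x" by blast
        then have "x \<in> Q i" using xC Qi by blast
        then have "z \<in> band_on n (lo i) (hi i) (Q i)" using i x by blast
        then show ?thesis using i by blast
      qed
    qed
    show "?R \<subseteq> ?L"
    proof
      fix z assume "z \<in> ?R"
      then consider i x where "i < k" "x \<in> P i" "z = x(n := ?y i x)"
        | i x t where "i \<le> k" "x \<in> Q i" "lo i x < ereal t" "ereal t < hi i x" "z = x(n := t)" by blast
      then show "z \<in> ?L"
      proof cases
        case 1
        then show ?thesis using Pi sub by (auto simp: over_def subset_iff)
      next
        case 2
        then have "z \<in> A" using Qall by blast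
        moreover have "x \<in> C" using 2 Qi by blast
        ultimately show ?thesis using 2 sub by (auto simp: over_def subset_iff)
      qed
    qed
  qed
  have PC: "P i \<subseteq> C" and QC: "Q i \<subseteq> C" for i using Pi Qi by auto
  have U1: "decomposable (Suc n) (\<Union>i\<in>{..<k}. graph_on n (?y i) (P i))"
  proof (rule decomposable_UN)
    fix i assume "i \<in> {..<k}"
    then have i: "i < k" by simp
    have "cell_fun D n (P i) (?y i)" using cell_fun_subset[OF yf[OF i] sub PD[OF i] PC] .
    then show "decomposable (Suc n) (graph_on n (?y i) (P i))"
      using decomposable_graph[OF IH[OF PD[OF i]]] PC sub by blast
  next
    fix i j assume ij: "i \<in> {..<k}" "j \<in> {..<k}" "i \<noteq> j"
    show "graph_on n (?y i) (P i) \<inter> graph_on n (?y j) (P j) = {}"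
    proof (rule ccontr)
      assume "\<not> ?thesis"
      then obtain x x' where x: "x \<in> P i" "x' \<in> P j" "x(n := ?y i x) = x'(n := ?y j x')" by blast
      then have "x \<in> C" "x \<in> Rn n" "x' \<in> Rn n" using PC sub by blast+
      then have "?y i x = ?y j x" using x(3) upd_eq_iff by blast
      then show False using less[OF \<open>x \<in> C\<close>, of i j] less[OF \<open>x \<in> C\<close>, of j i] ij by auto
    qed
  qed simp
  have U2: "decomposable (Suc n) (\<Union>i\<in>{..k}. band_on n (lo i) (hi i) (Q i))"
  proof (rule decomposable_UN)
    fix i assume "i \<in> {..k}"
    then have i: "i \<le> k" by simp
    have "cell_bound D n (Q i) (lo i)" "cell_bound D n (Q i) (hi i)"
      using cell_bound_subset[OF lob[OF i] sub QD[OF i] QC] cell_bound_subset[OF hib[OF i] sub QD[OF i] QC] by auto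
    moreover have "\<forall>x\<in>Q i. lo i x < hi i x" using lohi i QC by blast
    moreover have "Q i \<subseteq> Rn n" using QC sub by blast
    ultimately show "decomposable (Suc n) (band_on n (lo i) (hi i) (Q i))"
      using decomposable_band[OF IH[OF QD[OF i]]] by blast
  next
    fix i j assume ij: "i \<in> {..k}" "j \<in> {..k}" "i \<noteq> j"
    show "band_on n (lo i) (hi i) (Q i) \<inter> band_on n (lo j) (hi j) (Q j) = {}"
    proof (rule ccontr)
      assume "\<not> ?thesis"
      then obtain x x' t t' where x: "x \<in> Q i" "x' \<in> Q j" "x(n := t) = x'(n := t')"
        "lo i x < ereal t" "ereal t < hi i x" "lo j x' < ereal t'" "ereal t' < hi j x'" by blast
      then have "x \<in> C" "x \<in> Rn n" "x' \<in> Rn n" using QC sub by blast+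
      then have "x = x'" "t = t'" using x(3) upd_eq_iff by blast+
      then show False using bands[OF \<open>x \<in> C\<close>, of i j t] ij x by auto
    qed
  qed simp
  have "(\<Union>i\<in>{..<k}. graph_on n (?y i) (P i)) \<inter> (\<Union>i\<in>{..k}. band_on n (lo i) (hi i) (Q i)) = {}"
  proof (rule ccontr)
    assume "\<not> ?thesis"
    then obtain i j x x' t where x: "i < k" "j \<le> k" "x \<in> P i" "x' \<in> Q j" "x(n := ?y i x) = x'(n := t)"
      "lo j x' < ereal t" "ereal t < hi j x'" by blast
    then have "x \<in> C" "x \<in> Rn n" "x' \<in> Rn n" using PC QC sub by blast+
    then have "x = x'" "t = ?y i x" using x(5) upd_eq_iff by metis+
    then show False using off[OF \<open>x \<in> C\<close> x(2), of t] inY[OF \<open>x \<in> C\<close> x(1)] x by simp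
  qed
  from decomposable_Un[OF U1 U2 this] show ?thesis using eq by simp
qed

text \<open>Induction on the dimension of \<open>C\<close>. The good points form a definable dense
  subset: over a cell of good points the number of frontier points is locally constant, hence
  constant, and a cell of other points has smaller dimension.\<close>

lemma decomposable_over_cell:
  assumes IH: "\<And>B. B \<in> D n \<Longrightarrow> decomposable n B" and A: "A \<in> D (Suc n)"
  shows "cell D n d C \<Longrightarrow> decomposable (Suc n) (over n A C)"
proof (induction d arbitrary: C rule: less_induct)
  case (less d)
  define Y where "Y = fibre_frontier n A"
  have YD: "Y \<in> D (Suc n)" using A Y_def definable_fibre_frontier by simp
  have CD: "C \<in> D n" and sub: "C \<subseteq> Rn n" using less.prems definable_cell cell_sub by blast+
  have fin: "finite (fibre n Y x)" if "x \<in> C" for x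
    using finite_fibre_frontier[OF A] that sub Y_def by blast
  define G where "G = {x \<in> Rn n. good n Y C x} \<inter> C"
  have G: "G \<in> D n" unfolding G_def by (intro definable_Int definable_good YD CD)
  obtain P where P: "cell_decomposition D n G P" using IH[OF G] decomposable_def by blast
  obtain Q where Q: "cell_decomposition D n (C - G) Q"
    using IH[OF definable_Diff[OF CD G]] decomposable_def by blast
  note PP = cell_decomposition_cells[OF P] and QQ = cell_decomposition_cells[OF Q]
  have 1: "decomposable (Suc n) (over n A B)" if B: "B \<in> P" for B
  proof -
    obtain d' where d': "cell D n d' B" using PP B by blast
    have BG: "B \<subseteq> G" using PP B by blast
    have BC: "B \<subseteq> C" and Bsub: "B \<subseteq> Rn n" using BG sub by (auto simp: G_def)
    have gd: "good n Y B x" if "x \<in> B" for x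
      using good_subset[OF _ BC] that BG by (auto simp: G_def)
    have "loc_const n B (\<lambda>x. card (fibre n Y x))"
      unfolding loc_const_def
    proof
      fix x assume x: "x \<in> B"
      obtain d where "0 < d" "\<And>y. y \<in> cube n x d \<inter> B \<Longrightarrow> card (fibre n Y y) = card (fibre n Y x)"
        using goodE[OF gd[OF x] x Bsub _ zero_less_one] fin BC by (metis subsetD)
      then show "\<exists>d>0. \<forall>y\<in>cube n x d \<inter> B. card (fibre n Y y) = card (fibre n Y x)" by blast
    qed
    note const = loc_const_cell[OF d' this]
    obtain x0 where x0: "x0 \<in> B" using cell_nonempty[OF d'] by blast
    show ?thesis
      by (rule decomposable_over_good[OF IH A definable_cell[OF d'] Y_def gd const[OF _ x0]])
  qed
  have 2: "decomposable (Suc n) (over n A B)" if B: "B \<in> Q" for B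
  proof -
    obtain d' where d': "cell D n d' B" using QQ B by blast
    have BC: "B \<subseteq> C" "B \<inter> G = {}" using QQ B by blast+
    note dim = cell_subset_dim[OF less.prems d' BC(1)]
    have "d' \<noteq> d"
    proof
      assume "d' = d"
      then obtain y e where y: "y \<in> B" "e > 0" "cube n y e \<inter> C \<subseteq> B" using dim by blast
      obtain z where "z \<in> cube n y e \<inter> C" "good n Y C z"
        using good_dense[OF YD less.prems fin _ y(2), of y] y(1) BC(1) by blast
      then show False using y(3) BC(2) sub by (auto simp: G_def)
    qed
    then show ?thesis using less.IH[of d' B] d' dim by auto
  qed
  have PG: "\<Union>P = G" "\<Union>Q = C - G" using PP QQ by auto
  have "decomposable (Suc n) (\<Union>B\<in>P \<union> Q. over n A B)"
  proof (rule decomposable_UN)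
    fix B B' assume B: "B \<in> P \<union> Q" "B' \<in> P \<union> Q" "B \<noteq> B'"
    have "B \<inter> B' = {}" using B PP(3) QQ(3) PG by blast
    then show "over n A B \<inter> over n A B' = {}" by (auto simp: over_def)
  qed (use PP(1) QQ(1) 1 2 in auto)
  moreover have "(\<Union>B\<in>P \<union> Q. over n A B) = over n A C"
  proof -
    have "\<Union>(P \<union> Q) = C" using PG by (auto simp: G_def)
    then show ?thesis unfolding over_def by blast
  qed
  ultimately show ?case by simp
qed

theorem cell_decomposition_exists: "A \<in> D n \<Longrightarrow> decomposable n A"
proof (induction n arbitrary: A)
  case 0
  have "x = (\<lambda>_. 0)" if "x \<in> A" for x
    using that definable_subset[OF 0] by (auto simp: Rn_iff fun_eq_iff subset_iff)
  then have "A \<subseteq> {\<lambda>_. 0}" by blast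
  then consider "A = {}" | "A = {\<lambda>_. 0}" by blast
  then show ?case
    using decomposable_cell[OF cell.point] decomposable_empty by cases auto
next
  case (Suc n)
  obtain P where P: "cell_decomposition D n (Rn n) P" using Suc.IH[OF definable_Rn] decomposable_def by blast
  note PP = cell_decomposition_cells[OF P]
  have "decomposable (Suc n) (\<Union>B\<in>P. over n A B)"
  proof (rule decomposable_UN)
    fix B assume "B \<in> P"
    then show "decomposable (Suc n) (over n A B)"
      using PP(4) decomposable_over_cell[OF Suc.IH Suc.prems] by blast
  next
    fix B B' assume "B \<in> P" "B' \<in> P" "B \<noteq> B'"
    then have "B \<inter> B' = {}" using PP by blast
    then show "over n A B \<inter> over n A B' = {}" by (auto simp: over_def)
  qed (use PP in auto)
  moreover have "(\<Union>B\<in>P. over n A B) = A"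
  proof -
    have "restr n z \<in> \<Union>P" for z using PP(2) by simp
    then show ?thesis unfolding over_def by blast
  qed
  ultimately show ?case by simp
qed

end

section \<open>The Euler integral\<close>

text \<open>The simplifier would unfold \<open>x(n := t)\<close> wherever it occurs eta-expanded.\<close>

declare fun_upd_apply [simp del]

text \<open>
  The Euler integral of \<open>f\<close> on the line: every jump from \<open>f t\<close> to the value just above \<open>t\<close> counts,
  and the value at \<open>-\<infinity>\<close> is subtracted, so that points contribute \<open>1\<close> and open intervals \<open>-1\<close>.
\<close>

definition right_lim :: "(real \<Rightarrow> int) \<Rightarrow> real \<Rightarrow> int"
  where "right_lim f t = (THE v. eventually (\<lambda>s. f s = v) (at_right t))"

definition bot_lim :: "(real \<Rightarrow> int) \<Rightarrow> int"
  where "bot_lim f = (THE v. eventually (\<lambda>s. f s = v) at_bot)"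

text \<open>The limits in \<open>line_int\<close> exist and its sum is finite.\<close>

definition tame :: "(real \<Rightarrow> int) \<Rightarrow> bool"
  where "tame f \<longleftrightarrow> (\<forall>t. \<exists>v. eventually (\<lambda>s. f s = v) (at_right t)) \<and>
    (\<exists>v. eventually (\<lambda>s. f s = v) at_bot) \<and> finite {t. f t \<noteq> right_lim f t}"

definition line_int :: "(real \<Rightarrow> int) \<Rightarrow> int"
  where "line_int f = (\<Sum>t | f t \<noteq> right_lim f t. f t - right_lim f t) - bot_lim f"

section \<open>Linearity of the integral on the line, and its values on points and open
  intervals\<close>

lemma eventually_unique:
  assumes "F \<noteq> bot" "eventually (\<lambda>s. f s = v) F" "eventually (\<lambda>s. f s = w) F"
  shows "v = w"
proof -
  have "eventually (\<lambda>s. v = w) F" using assms(2,3) by eventually_elim auto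
  then show ?thesis using assms(1) by (simp add: eventually_const)
qed

lemma right_lim_eq: "eventually (\<lambda>s. f s = v) (at_right t) \<Longrightarrow> right_lim f t = v"
  unfolding right_lim_def by (rule the_equality) (auto intro: eventually_unique[OF trivial_limit_at_right_real])

lemma bot_lim_eq: "eventually (\<lambda>s. f s = v) at_bot \<Longrightarrow> bot_lim f = v"
  unfolding bot_lim_def by (rule the_equality) (auto intro: eventually_unique[OF trivial_limit_at_bot_linorder])

lemma tame_right_lim: "tame f \<Longrightarrow> eventually (\<lambda>s. f s = right_lim f t) (at_right t)"
  using right_lim_eq by (metis tame_def)

lemma tame_bot_lim: "tame f \<Longrightarrow> eventually (\<lambda>s. f s = bot_lim f) at_bot"
  using bot_lim_eq by (metis tame_def)

lemma line_int_superset: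
  assumes "finite S" "{t. f t \<noteq> right_lim f t} \<subseteq> S"
  shows "line_int f = (\<Sum>t\<in>S. f t - right_lim f t) - bot_lim f"
proof -
  have "(\<Sum>t | f t \<noteq> right_lim f t. f t - right_lim f t) = (\<Sum>t\<in>S. f t - right_lim f t)"
    using assms by (intro sum.mono_neutral_left) auto
  then show ?thesis by (simp add: line_int_def)
qed

lemma tame_add:
  assumes "tame f" "tame g"
  shows "tame (\<lambda>t. f t + g t)" "line_int (\<lambda>t. f t + g t) = line_int f + line_int g"
proof -
  have r: "eventually (\<lambda>s. f s + g s = right_lim f t + right_lim g t) (at_right t)" for t
    using tame_right_lim[OF assms(1), of t] tame_right_lim[OF assms(2), of t] by eventually_elim auto
  have b: "eventually (\<lambda>s. f s + g s = bot_lim f + bot_lim g) at_bot"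
    using tame_bot_lim[OF assms(1)] tame_bot_lim[OF assms(2)] by eventually_elim auto
  define S where "S = {t. f t \<noteq> right_lim f t} \<union> {t. g t \<noteq> right_lim g t}"
  have S: "finite S" using assms by (auto simp: S_def tame_def)
  have rl: "right_lim (\<lambda>t. f t + g t) t = right_lim f t + right_lim g t" for t
    using right_lim_eq[OF r] .
  have sub: "{t. f t + g t \<noteq> right_lim (\<lambda>t. f t + g t) t} \<subseteq> S"
    by (auto simp: S_def rl)
  then show "tame (\<lambda>t. f t + g t)" unfolding tame_def using r b S finite_subset by blast
  have "line_int (\<lambda>t. f t + g t) = (\<Sum>t\<in>S. f t + g t - (right_lim f t + right_lim g t)) - (bot_lim f + bot_lim g)"
    using line_int_superset[OF S sub] bot_lim_eq[OF b] by (simp add: rl)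
  moreover have "line_int f = (\<Sum>t\<in>S. f t - right_lim f t) - bot_lim f"
    by (rule line_int_superset[OF S]) (auto simp: S_def)
  moreover have "line_int g = (\<Sum>t\<in>S. g t - right_lim g t) - bot_lim g"
    by (rule line_int_superset[OF S]) (auto simp: S_def)
  ultimately show "line_int (\<lambda>t. f t + g t) = line_int f + line_int g"
    by (simp add: sum.distrib sum_subtractf)
qed

lemma tame_cmult:
  assumes "tame f"
  shows "tame (\<lambda>t. c * f t)" "line_int (\<lambda>t. c * f t) = c * line_int f"
proof -
  have r: "eventually (\<lambda>s. c * f s = c * right_lim f t) (at_right t)" for t
    using tame_right_lim[OF assms(1), of t] by eventually_elim auto
  have b: "eventually (\<lambda>s. c * f s = c * bot_lim f) at_bot"
    using tame_bot_lim[OF assms(1)] by eventually_elim auto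
  define S where "S = {t. f t \<noteq> right_lim f t}"
  have S: "finite S" using assms by (auto simp: S_def tame_def)
  have rl: "right_lim (\<lambda>t. c * f t) t = c * right_lim f t" for t
    using right_lim_eq[OF r] .
  have sub: "{t. c * f t \<noteq> right_lim (\<lambda>t. c * f t) t} \<subseteq> S"
    by (auto simp: S_def rl)
  then show "tame (\<lambda>t. c * f t)" unfolding tame_def using r b S finite_subset by blast
  have "line_int (\<lambda>t. c * f t) = (\<Sum>t\<in>S. c * f t - c * right_lim f t) - c * bot_lim f"
    using line_int_superset[OF S sub] bot_lim_eq[OF b] by (simp add: rl)
  then show "line_int (\<lambda>t. c * f t) = c * line_int f"
    by (simp add: line_int_def S_def sum_distrib_left right_diff_distrib)
qed

lemma tame_point: "tame (\<lambda>t. of_bool (t = a))" "line_int (\<lambda>t. of_bool (t = a)) = 1"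
proof -
  let ?f = "\<lambda>t. of_bool (t = a) :: int"
  have r: "eventually (\<lambda>s. ?f s = 0) (at_right t)" for t
  proof (cases "a > t")
    case True
    then show ?thesis by (auto simp: eventually_at_right_field intro!: exI[of _ a])
  next
    case False
    then show ?thesis by (auto simp: eventually_at_right_field intro!: exI[of _ "t + 1"])
  qed
  have b: "eventually (\<lambda>s. ?f s = 0) at_bot"
    by (auto simp: eventually_at_bot_linorder intro!: exI[of _ "a - 1"])
  have rl: "right_lim ?f t = 0" for t using right_lim_eq[OF r] .
  have S: "{t. ?f t \<noteq> right_lim ?f t} = {a}" by (auto simp: rl)
  show "tame ?f" unfolding tame_def S using r b by blast
  show "line_int ?f = 1" unfolding line_int_def S bot_lim_eq[OF b] by (simp add: rl)
qed

lemma tame_zero: "tame (\<lambda>t. 0)" "line_int (\<lambda>t. 0) = 0"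
  using tame_cmult[OF tame_point(1), of 0] by simp_all

text \<open>The one contribution comes from the left end: there the function is 0 and jumps to 1,
  or, if \<open>J\<close> is unbounded below, its value at minus infinity is 1. At a finite right
  end the value is already 0, as \<open>J\<close> is open.\<close>

lemma tame_open_interval:
  assumes "open J" "is_interval J" "J \<noteq> {}"
  shows "tame (\<lambda>t. of_bool (t \<in> J))" "line_int (\<lambda>t. of_bool (t \<in> J)) = -1"
proof -
  let ?f = "\<lambda>t. of_bool (t \<in> J) :: int"
  have conv: "c \<in> J" if "a \<in> J" "b \<in> J" "a \<le> c" "c \<le> b" for a b c
    using mem_is_interval_1_I[OF assms(2)] that by blast
  \<comment> \<open>\<open>J\<close> begins at \<open>t\<close> or continues to the right of
    it.\<close>
  define right where "right t \<longleftrightarrow> (\<exists>s>t. {t<..<s} \<subseteq> J)" for t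
  have r1: "eventually (\<lambda>s. ?f s = 1) (at_right t)" if "right t" for t
    using that by (auto simp: eventually_at_right_field right_def subset_iff)
  have r0: "eventually (\<lambda>s. ?f s = 0) (at_right t)" if "\<not> right t" for t
  proof (cases "\<exists>s\<in>J. t < s")
    case True
    then obtain s where s: "s \<in> J" "t < s" by blast
    then have "\<not> {t<..<s} \<subseteq> J" using that by (auto simp: right_def)
    then obtain u where "u \<in> {t<..<s}" "u \<notin> J" by blast
    then have u: "t < u" "u < s" "u \<notin> J" by auto
    have "v \<notin> J" if "t < v" "v < u" for v
      using conv[of v s u] s u that by auto
    then show ?thesis using u(1) by (auto simp: eventually_at_right_field)
  next
    case False
    then show ?thesis by (auto simp: eventually_at_right_field intro!: exI[of _ "t + 1"])
  qed
  have rl: "right_lim ?f t = of_bool (right t)" for t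
    using right_lim_eq[OF r0] right_lim_eq[OF r1] by auto
  have J: "right t" if t: "t \<in> J" for t
  proof -
    obtain e where e: "e > 0" "ball t e \<subseteq> J" using assms(1) t openE by blast
    then show ?thesis unfolding right_def
      by (intro exI[of _ "t + e"]) (auto simp: dist_real_def subset_iff)
  qed
  have lower: "t < v" if "right t" "t \<notin> J" "v \<in> J" for t v
  proof (rule ccontr)
    assume "\<not> t < v"
    from that(1) obtain s where s: "s > t" "{t<..<s} \<subseteq> J" unfolding right_def by auto
    then have "(t + s) / 2 \<in> J" by (auto simp: subset_iff)
    then show False using conv[of v "(t + s) / 2" t] that \<open>\<not> t < v\<close> s by auto
  qed
  \<comment> \<open>The left end point, if there is one: the only place where the function differs
    from its right limit.\<close>
  define E where "E = {t. right t \<and> t \<notin> J}"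
  have S: "{t. ?f t \<noteq> right_lim ?f t} = E" using J by (auto simp: rl E_def)
  have uniq: "t = u" if "t \<in> E" "u \<in> E" for t u
  proof -
    have False if tu: "t \<in> E" "u \<in> E" "t < u" for t u
    proof -
      obtain s where s: "s > t" "{t<..<s} \<subseteq> J" using tu by (auto simp: right_def E_def)
      let ?v = "(t + min s u) / 2"
      have "t < ?v" "?v < s" "?v < u" using s tu by (auto simp: min_def)
      then have "?v \<in> J" "?v < u" using s by auto
      then show False using lower[of u ?v] tu by (auto simp: E_def)
    qed
    then show ?thesis using that by (meson linorder_neqE)
  qed
  obtain v0 where v0: "v0 \<in> J" using assms(3) by blast
  have "(\<exists>a. E = {a}) \<and> eventually (\<lambda>s. ?f s = 0) at_bot \<or> E = {} \<and> eventually (\<lambda>s. ?f s = 1) at_bot"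
  proof (cases "bdd_below J")
    case True
    define a where "a = Inf J"
    have le: "a \<le> v" if "v \<in> J" for v unfolding a_def using True that by (simp add: cInf_lower)
    have aJ: "a \<notin> J"
    proof
      assume "a \<in> J"
      then obtain e where e: "e > 0" "ball a e \<subseteq> J" using assms(1) openE by blast
      then have "a - e / 2 \<in> J" by (auto simp: dist_real_def subset_iff)
      then show False using le e by force
    qed
    then have av: "a < v0" using le[OF v0] v0 by (auto simp: less_le)
    have "{a<..<v0} \<subseteq> J"
    proof
      fix t assume t: "t \<in> {a<..<v0}"
      then obtain v where "v \<in> J" "v < t" using cInf_less_iff[OF assms(3) True, of t] by (auto simp: a_def)
      then show "t \<in> J" using conv[of v v0 t] v0 t by auto
    qed
    then have "a \<in> E" using av aJ by (auto simp: E_def right_def)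
    then have "E = {a}" using uniq by blast
    moreover have "eventually (\<lambda>s. ?f s = 0) at_bot"
      unfolding eventually_at_bot_linorder using le by (intro exI[of _ "a - 1"]) force
    ultimately show ?thesis by blast
  next
    case False
    then have lb: "\<exists>v\<in>J. v < t" for t by (meson bdd_below.I not_le)
    have "t \<notin> E" for t
      using lb[of t] lower[of t] by (fastforce simp: E_def)
    then have "E = {}" by blast
    moreover have "t \<in> J" if "t \<le> v0" for t using lb[of t] conv[of _ v0 t] v0 that by auto
    then have "eventually (\<lambda>s. ?f s = 1) at_bot"
      unfolding eventually_at_bot_linorder by (intro exI[of _ v0]) auto
    ultimately show ?thesis by blast
  qed
  then consider a where "E = {a}" "eventually (\<lambda>s. ?f s = 0) at_bot" | "E = {}" "eventually (\<lambda>s. ?f s = 1) at_bot"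
    by blast
  moreover have rr: "\<forall>t. \<exists>v. eventually (\<lambda>s. ?f s = v) (at_right t)" using r0 r1 by blast
  ultimately have "tame ?f \<and> line_int ?f = -1"
  proof cases
    case 1
    then have "a \<in> E" by simp
    then have "?f a = 0" "right_lim ?f a = 1" by (auto simp: E_def rl)
    moreover have "tame ?f" unfolding tame_def S using rr 1 by blast
    ultimately show ?thesis unfolding line_int_def S bot_lim_eq[OF 1(2)] 1(1) by simp
  next
    case 2
    have "tame ?f" unfolding tame_def S using rr 2 by blast
    then show ?thesis unfolding line_int_def S bot_lim_eq[OF 2(2)] 2(1) by simp
  qed
  then show "tame ?f" "line_int ?f = -1" by auto
qed

section \<open>The iterated integral of constructible functions\<close>

primrec euler_int :: "nat \<Rightarrow> ((nat \<Rightarrow> real) \<Rightarrow> int) \<Rightarrow> int"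
  where
    "euler_int 0 f = f (\<lambda>_. 0)"
  | "euler_int (Suc n) f = euler_int n (\<lambda>x. line_int (\<lambda>t. f (x(n := t))))"

lemma euler_int_cong: "(\<And>x. x \<in> Rn n \<Longrightarrow> f x = g x) \<Longrightarrow> euler_int n f = euler_int n g"
proof (induction n arbitrary: f g)
  case 0
  have "(\<lambda>_. 0) \<in> Rn 0" by (simp add: Rn_iff)
  then show ?case using 0 by simp
next
  case (Suc n)
  have "euler_int n (\<lambda>x. line_int (\<lambda>t. f (x(n := t)))) = euler_int n (\<lambda>x. line_int (\<lambda>t. g (x(n := t))))"
    by (rule Suc.IH) (simp add: Suc.prems upd_in_Rn)
  then show ?case by simp
qed

lemma band_fibre_interval:
  fixes F G :: ereal
  assumes "F < G"
  shows "open {t. F < ereal t \<and> ereal t < G}" "is_interval {t. F < ereal t \<and> ereal t < G}"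
    "{t. F < ereal t \<and> ereal t < G} \<noteq> {}"
proof -
  have "{t. F < ereal t \<and> ereal t < G} = ereal -` {F<..<G}" by auto
  also have "open \<dots>" by (intro open_vimage continuous_on_ereal continuous_on_id) auto
  finally show "open {t. F < ereal t \<and> ereal t < G}" .
  show "is_interval {t. F < ereal t \<and> ereal t < G}"
    unfolding is_interval_1 by (auto intro: le_less_trans less_le_trans)
      (meson ereal_less_eq(3) le_less_trans less_le_trans)+
  show "{t. F < ereal t \<and> ereal t < G} \<noteq> {}" using ereal_dense2[OF assms] by auto
qed

context o_minimal_structure
begin

text \<open>The rule \<open>agree\<close> makes membership depend on the values on n-space only,
  which are the ones that \<open>euler_int\<close> sees.\<close>

inductive constructible :: "nat \<Rightarrow> ((nat \<Rightarrow> real) \<Rightarrow> int) \<Rightarrow> bool" for n :: nat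
  where
    indicat: "A \<in> D n \<Longrightarrow> constructible n (\<lambda>x. of_bool (x \<in> A))"
  | add: "constructible n f \<Longrightarrow> constructible n g \<Longrightarrow> constructible n (\<lambda>x. f x + g x)"
  | cmult: "constructible n f \<Longrightarrow> constructible n (\<lambda>x. c * f x)"
  | agree: "constructible n f \<Longrightarrow> (\<And>x. x \<in> Rn n \<Longrightarrow> f x = g x) \<Longrightarrow> constructible n g"

lemma of_bool_decomposition:
  assumes "cell_decomposition D n A P"
  shows "(of_bool (x \<in> A) :: int) = (\<Sum>C\<in>P. of_bool (x \<in> C))"
proof -
  note P = cell_decomposition_cells[OF assms]
  show ?thesis
  proof (cases "x \<in> A")
    case True
    then obtain C where C: "C \<in> P" "x \<in> C" using P(2) by blast
    have "(\<Sum>B\<in>P. of_bool (x \<in> B) :: int) = (\<Sum>B\<in>P. if B = C then 1 else 0)"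
      using C P(3) by (intro sum.cong) auto
    then show ?thesis using True C P(1) by simp
  next
    case False
    then have "(\<Sum>B\<in>P. of_bool (x \<in> B) :: int) = 0" using P(2) by (intro sum.neutral) auto
    then show ?thesis using False by simp
  qed
qed

lemma constructible_zero: "constructible n (\<lambda>x. 0)"
  using constructible.indicat[OF definable_empty] by simp

lemma constructible_sum:
  "finite I \<Longrightarrow> (\<And>i. i \<in> I \<Longrightarrow> constructible n (f i)) \<Longrightarrow> constructible n (\<lambda>x. \<Sum>i\<in>I. f i x)"
  by (induction I rule: finite_induct) (auto intro: constructible_zero constructible.add)

text \<open>The indicator function of a definable set is a finite sum of those of cells, so a
  statement that respects linear combinations need only be checked on cells.\<close>

lemma constructible_cell_induct [consumes 1, case_names zero cell add cmult cong]:
  assumes "constructible n f"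
    and zero: "P (\<lambda>x. 0)"
    and cell: "\<And>C d. cell D n d C \<Longrightarrow> P (\<lambda>x. of_bool (x \<in> C))"
    and add: "\<And>f g. constructible n f \<Longrightarrow> constructible n g \<Longrightarrow> P f \<Longrightarrow> P g \<Longrightarrow> P (\<lambda>x. f x + g x)"
    and cmult: "\<And>f c. constructible n f \<Longrightarrow> P f \<Longrightarrow> P (\<lambda>x. c * f x)"
    and cong: "\<And>f g. constructible n f \<Longrightarrow> P f \<Longrightarrow> (\<And>x. x \<in> Rn n \<Longrightarrow> f x = g x) \<Longrightarrow> P g"
  shows "P f"
  using assms(1)
proof (induction rule: constructible.induct)
  case (indicat A)
  obtain Q where Q: "cell_decomposition D n A Q"
    using cell_decomposition_exists[OF indicat] decomposable_def by blast
  note QQ = cell_decomposition_cells[OF Q]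
  have "R \<subseteq> Q \<Longrightarrow> P (\<lambda>x. \<Sum>C\<in>R. of_bool (x \<in> C))" if "finite R" for R
    using that
  proof (induction R rule: finite_induct)
    case empty
    then show ?case using zero by simp
  next
    case (insert C R)
    then obtain d where d: "cell D n d C" using QQ(4) by blast
    have cR: "constructible n (\<lambda>x. \<Sum>C\<in>R. of_bool (x \<in> C))"
    proof (rule constructible_sum[OF insert.hyps(1)])
      fix B assume "B \<in> R"
      then obtain d where "cell D n d B" using QQ(4) insert.prems by blast
      then show "constructible n (\<lambda>x. of_bool (x \<in> B))" using constructible.indicat definable_cell by blast
    qed
    have "P (\<lambda>x. of_bool (x \<in> C) + (\<Sum>C\<in>R. of_bool (x \<in> C)))"
      using insert constructible.indicat[OF definable_cell[OF d]] by (intro add cR cell[OF d]) auto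
    then show ?case using insert by (simp del: sum_of_bool_eq)
  qed
  from this[OF QQ(1)] show ?case by (simp add: of_bool_decomposition[OF Q] del: sum_of_bool_eq)
qed (use add cmult cong in blast)+

text \<open>The fibre of a cell over a point of its base is one point or one open interval; the
  exponent \<open>d - d'\<close> is 0 for a graph and 1 for a band.\<close>

lemma cell_line_int:
  assumes "cell D (Suc n) d C"
  obtains B d' where "cell D n d' B"
    "\<And>x. x \<in> Rn n \<Longrightarrow> tame (\<lambda>t. of_bool (x(n := t) \<in> C))"
    "\<And>x. x \<in> Rn n \<Longrightarrow> line_int (\<lambda>t. of_bool (x(n := t) \<in> C)) = (-1) ^ (d - d') * of_bool (x \<in> B)"
    "d' \<le> d"
  using assms
proof (cases rule: cell_Suc_cases)
  case (graph B f)
  have sub: "B \<subseteq> Rn n" using graph cell_sub by blast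
  have *: "(\<lambda>t. of_bool (x(n := t) \<in> C) :: int) = (if x \<in> B then (\<lambda>t. of_bool (t = f x)) else (\<lambda>t. 0))"
    if "x \<in> Rn n" for x
    by (cases "x \<in> B") (use that sub graph(3) in \<open>auto simp: upd_eq_iff subset_iff intro!: ext\<close>)
  show ?thesis
  proof (rule that[of d B])
    fix x assume x: "x \<in> Rn n"
    show "tame (\<lambda>t. of_bool (x(n := t) \<in> C))" unfolding *[OF x] using tame_point tame_zero by simp
    show "line_int (\<lambda>t. of_bool (x(n := t) \<in> C)) = (-1) ^ (d - d) * of_bool (x \<in> B)"
      unfolding *[OF x] using tame_point tame_zero by simp
  qed (use graph in auto)
next
  case (band d' B f g)
  have sub: "B \<subseteq> Rn n" using band cell_sub by blast
  have *: "(\<lambda>t. of_bool (x(n := t) \<in> C) :: int) =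
    (if x \<in> B then (\<lambda>t. of_bool (t \<in> {t. f x < ereal t \<and> ereal t < g x})) else (\<lambda>t. 0))"
    if "x \<in> Rn n" for x
  proof -
    have "x(n := t) \<in> C \<longleftrightarrow> x \<in> B \<and> f x < ereal t \<and> ereal t < g x" for t
    proof
      assume "x(n := t) \<in> C"
      then obtain y s where y: "x(n := t) = y(n := s)" "y \<in> B" "f y < ereal s" "ereal s < g y"
        unfolding band(6) by blast
      then have "x = y" "t = s" using upd_eq_iff that sub by blast+
      then show "x \<in> B \<and> f x < ereal t \<and> ereal t < g x" using y by simp
    qed (use band(6) in blast)
    then show ?thesis by (cases "x \<in> B") (auto intro!: ext)
  qed
  have **: "tame (\<lambda>t. of_bool (t \<in> {t. f x < ereal t \<and> ereal t < g x}))"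
    "line_int (\<lambda>t. of_bool (t \<in> {t. f x < ereal t \<and> ereal t < g x})) = -1" if "x \<in> B" for x
    using tame_open_interval[OF band_fibre_interval, of "f x" "g x"] band(5) that by auto
  show ?thesis
  proof (rule that[of d' B])
    fix x assume x: "x \<in> Rn n"
    show "tame (\<lambda>t. of_bool (x(n := t) \<in> C))" unfolding *[OF x] using ** tame_zero by simp
    show "line_int (\<lambda>t. of_bool (x(n := t) \<in> C)) = (-1) ^ (d - d') * of_bool (x \<in> B)"
      unfolding *[OF x] using ** tame_zero band(1) by simp
  qed (use band in auto)
qed

lemma constructible_line_int:
  assumes "constructible (Suc n) f"
  shows "\<forall>x\<in>Rn n. tame (\<lambda>t. f (x(n := t)))" "constructible n (\<lambda>x. line_int (\<lambda>t. f (x(n := t))))"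
proof -
  have "(\<forall>x\<in>Rn n. tame (\<lambda>t. f (x(n := t)))) \<and> constructible n (\<lambda>x. line_int (\<lambda>t. f (x(n := t))))"
    using assms
  proof (induction rule: constructible_cell_induct)
    case zero
    then show ?case by (simp add: tame_zero constructible_zero)
  next
    case (cell C d)
    from cell_line_int[OF cell] obtain B d' where B: "cell D n d' B"
      "\<And>x. x \<in> Rn n \<Longrightarrow> tame (\<lambda>t. of_bool (x(n := t) \<in> C))"
      "\<And>x. x \<in> Rn n \<Longrightarrow> line_int (\<lambda>t. of_bool (x(n := t) \<in> C)) = (-1) ^ (d - d') * of_bool (x \<in> B)"
      by metis
    have "constructible n (\<lambda>x. (-1) ^ (d - d') * of_bool (x \<in> B))"
      using B(1) definable_cell by (intro constructible.intros)
    then have "constructible n (\<lambda>x. line_int (\<lambda>t. of_bool (x(n := t) \<in> C)))"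
      by (rule constructible.agree) (use B in auto)
    then show ?case using B(2) by blast
  next
    case (add f g)
    have "constructible n (\<lambda>x. line_int (\<lambda>t. f (x(n := t))) + line_int (\<lambda>t. g (x(n := t))))"
      using add by (intro constructible.add) auto
    then have "constructible n (\<lambda>x. line_int (\<lambda>t. f (x(n := t)) + g (x(n := t))))"
      by (rule constructible.agree) (use add in \<open>simp add: tame_add\<close>)
    then show ?case using add tame_add by auto
  next
    case (cmult f c)
    have "constructible n (\<lambda>x. c * line_int (\<lambda>t. f (x(n := t))))"
      using cmult by (intro constructible.cmult) auto
    then have "constructible n (\<lambda>x. line_int (\<lambda>t. c * f (x(n := t))))"
      by (rule constructible.agree) (use cmult in \<open>simp add: tame_cmult\<close>)
    then show ?case using cmult tame_cmult by auto
  next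
    case (cong f g)
    have eq: "(\<lambda>t. g (x(n := t))) = (\<lambda>t. f (x(n := t)))" if "x \<in> Rn n" for x
      by (rule ext) (simp add: cong.hyps(2)[OF upd_in_Rn[OF that]])
    have "constructible n (\<lambda>x. line_int (\<lambda>t. g (x(n := t))))"
      using conjunct2[OF cong.IH] by (rule constructible.agree) (simp add: eq)
    then show ?case using cong.IH eq by simp
  qed
  then show "\<forall>x\<in>Rn n. tame (\<lambda>t. f (x(n := t)))" "constructible n (\<lambda>x. line_int (\<lambda>t. f (x(n := t))))"
    by auto
qed

lemma euler_int_add:
  "constructible n f \<Longrightarrow> constructible n g \<Longrightarrow> euler_int n (\<lambda>x. f x + g x) = euler_int n f + euler_int n g"
proof (induction n arbitrary: f g)
  case (Suc n)
  note f = constructible_line_int[OF Suc.prems(1)] and g = constructible_line_int[OF Suc.prems(2)]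
  have "euler_int (Suc n) (\<lambda>x. f x + g x) =
      euler_int n (\<lambda>x. line_int (\<lambda>t. f (x(n := t))) + line_int (\<lambda>t. g (x(n := t))))"
    unfolding euler_int.simps by (rule euler_int_cong) (use f(1) g(1) in \<open>simp add: tame_add\<close>)
  then show ?case using Suc.IH[OF f(2) g(2)] by simp
qed simp

lemma euler_int_cmult:
  "constructible n f \<Longrightarrow> euler_int n (\<lambda>x. c * f x) = c * euler_int n f"
proof (induction n arbitrary: f)
  case (Suc n)
  note f = constructible_line_int[OF Suc.prems(1)]
  have "euler_int (Suc n) (\<lambda>x. c * f x) = euler_int n (\<lambda>x. c * line_int (\<lambda>t. f (x(n := t))))"
    unfolding euler_int.simps by (rule euler_int_cong) (use f(1) in \<open>simp add: tame_cmult\<close>)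
  then show ?case using Suc.IH[OF f(2)] by simp
qed simp

lemma euler_int_zero: "euler_int n (\<lambda>x. 0) = 0"
  using euler_int_cmult[OF constructible_zero, of n 0] by simp

lemma euler_int_sum:
  "finite I \<Longrightarrow> (\<And>i. i \<in> I \<Longrightarrow> constructible n (f i)) \<Longrightarrow>
    euler_int n (\<lambda>x. \<Sum>i\<in>I. f i x) = (\<Sum>i\<in>I. euler_int n (f i))"
proof (induction I rule: finite_induct)
  case (insert j I)
  have "euler_int n (\<lambda>x. f j x + (\<Sum>i\<in>I. f i x)) = euler_int n (f j) + euler_int n (\<lambda>x. \<Sum>i\<in>I. f i x)"
    using insert by (intro euler_int_add constructible_sum) auto
  then show ?case using insert by simp
qed (simp add: euler_int_zero)

lemma euler_int_cell: "cell D n d C \<Longrightarrow> euler_int n (\<lambda>x. of_bool (x \<in> C)) = (-1) ^ d"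
proof (induction n arbitrary: d C)
  case 0
  then have "d = 0" "C = {\<lambda>_. 0}" by (auto elim: cell.cases)
  then show ?case by simp
next
  case (Suc n)
  from cell_line_int[OF Suc.prems] obtain B d' where B: "cell D n d' B"
    "\<And>x. x \<in> Rn n \<Longrightarrow> line_int (\<lambda>t. of_bool (x(n := t) \<in> C)) = (-1) ^ (d - d') * of_bool (x \<in> B)" "d' \<le> d"
    by metis
  have "euler_int (Suc n) (\<lambda>x. of_bool (x \<in> C)) = euler_int n (\<lambda>x. (-1) ^ (d - d') * of_bool (x \<in> B))"
    unfolding euler_int.simps by (rule euler_int_cong) (simp add: B(2))
  also have "\<dots> = (-1) ^ (d - d') * (-1) ^ d'"
    using euler_int_cmult[OF constructible.indicat[OF definable_cell[OF B(1)]]] Suc.IH[OF B(1)] by simp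
  also have "\<dots> = (-1) ^ d" using B(3) by (simp flip: power_add)
  finally show ?case .
qed

text \<open>By additivity, each cell contributing according to its dimension; so the decomposition
  chosen in \<open>euler_char\<close> does not affect the value.\<close>

lemma euler_char_eq:
  assumes "A \<in> D n" shows "euler_char D n A = euler_int n (\<lambda>x. of_bool (x \<in> A))"
proof -
  define P where "P = (SOME P. cell_decomposition D n A P)"
  have P: "cell_decomposition D n A P"
    using someI_ex[OF cell_decomposition_exists[OF assms, unfolded decomposable_def]] P_def by simp
  note PP = cell_decomposition_cells[OF P]
  have "euler_int n (\<lambda>x. of_bool (x \<in> A)) = euler_int n (\<lambda>x. \<Sum>C\<in>P. of_bool (x \<in> C))"
    by (simp add: of_bool_decomposition[OF P] del: sum_of_bool_eq)
  also have "\<dots> = (\<Sum>C\<in>P. euler_int n (\<lambda>x. of_bool (x \<in> C)))"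
    using PP definable_cell by (intro euler_int_sum constructible.indicat) blast+
  also have "\<dots> = (\<Sum>C\<in>P. (-1) ^ cell_dim D n C)"
  proof (rule sum.cong)
    fix C assume "C \<in> P"
    then obtain d where "cell D n d C" using PP by blast
    then show "euler_int n (\<lambda>x. of_bool (x \<in> C)) = (-1) ^ cell_dim D n C"
      using euler_int_cell cell_dim_eq by simp
  qed simp
  finally show ?thesis by (simp add: euler_char_def P_def)
qed

end

section \<open>Fubini's theorem for the Euler integral\<close>

abbreviation pt2 :: "real \<Rightarrow> real \<Rightarrow> nat \<Rightarrow> real"
  where "pt2 s t \<equiv> (\<lambda>_. 0)(0 := s, Suc 0 := t)"

definition swap_int :: "(nat \<Rightarrow> real) set \<Rightarrow> int"
  where "swap_int S = line_int (\<lambda>t. line_int (\<lambda>s. of_bool (pt2 s t \<in> S)))"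

lemma pt2_nth [simp]: "pt2 s t 0 = s" "pt2 s t (Suc 0) = t"
  by (simp_all add: fun_upd_apply)

lemma zero_in_Rn [simp]: "(\<lambda>_. 0) \<in> Rn n"
  by (simp add: Rn_iff)

lemma pt2_in: "pt2 s t \<in> Rn (Suc (Suc 0))"
  by (intro upd_in_Rn) simp

lemma swap_int_prod_point:
  "(\<And>s t. pt2 s t \<in> S \<longleftrightarrow> s = a \<and> t \<in> T) \<Longrightarrow> swap_int S = line_int (\<lambda>t. of_bool (t \<in> T))"
proof -
  assume S: "\<And>s t. pt2 s t \<in> S \<longleftrightarrow> s = a \<and> t \<in> T"
  have "line_int (\<lambda>s. of_bool (pt2 s t \<in> S)) = of_bool (t \<in> T)" for t
    by (cases "t \<in> T") (simp_all add: S tame_point tame_zero)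
  then show ?thesis by (simp add: swap_int_def)
qed

lemma swap_int_point:
  "(\<And>s t. pt2 s t \<in> S \<longleftrightarrow> s = a \<and> t = b) \<Longrightarrow> swap_int S = 1"
  using swap_int_prod_point[of S a "{b}"] tame_point by simp

text \<open>A horizontal graph meets a single horizontal line, in an open interval. An injective one
  meets each horizontal line at most once, and the lines that it meets form an open interval. Either
  way one factor is that of a point and the other that of an open interval.\<close>

lemma swap_int_graph:
  assumes J: "open J" "is_interval J" "J \<noteq> {}" and h: "continuous_on J h"
    and "(\<exists>v. \<forall>s\<in>J. h s = v) \<or> inj_on h J"
    and S: "\<And>s t. pt2 s t \<in> S \<longleftrightarrow> s \<in> J \<and> t = h s"
  shows "swap_int S = -1"
  using assms(5)
proof
  assume "\<exists>v. \<forall>s\<in>J. h s = v"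
  then obtain v where v: "\<forall>s\<in>J. h s = v" by blast
  have "line_int (\<lambda>s. of_bool (pt2 s t \<in> S)) = -1 * of_bool (t = v)" for t
  proof (cases "t = v")
    case True
    then have "(\<lambda>s. of_bool (pt2 s t \<in> S)) = (\<lambda>s. of_bool (s \<in> J) :: int)" using v S by auto
    then show ?thesis using True tame_open_interval[OF J] by simp
  next
    case False
    then have "(\<lambda>s. of_bool (pt2 s t \<in> S)) = (\<lambda>s. 0 :: int)" using v S by auto
    then show ?thesis using False tame_zero by simp
  qed
  then show ?thesis unfolding swap_int_def using tame_cmult(2)[OF tame_point(1), of "-1" v] tame_point(2) by simp
next
  assume inj: "inj_on h J"
  have "line_int (\<lambda>s. of_bool (pt2 s t \<in> S)) = of_bool (t \<in> h ` J)" for t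
  proof (cases "t \<in> h ` J")
    case True
    then obtain a where a: "a \<in> J" "t = h a" by blast
    then have "(\<lambda>s. of_bool (pt2 s t \<in> S)) = (\<lambda>s. of_bool (s = a) :: int)"
      using S inj by (auto simp: inj_on_def fun_eq_iff simp del: pt2_nth)
    then show ?thesis using True tame_point by simp
  next
    case False
    then have "(\<lambda>s. of_bool (pt2 s t \<in> S)) = (\<lambda>s. 0 :: int)" using S by (auto intro!: ext)
    then show ?thesis using False tame_zero by simp
  qed
  moreover have "open (h ` J)" using injective_eq_1d_open_map_UNIV[OF h J(2)] inj J(1) by blast
  moreover have "is_interval (h ` J)"
    using connected_continuous_image[OF h] J(2) by (simp add: is_interval_connected_1)
  ultimately show ?thesis unfolding swap_int_def using tame_open_interval[of "h ` J"] J(3) by simp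
qed

text \<open>What constancy or monotonicity of a boundary function is used for: it is below or above
  a given height on an open interval, possibly empty.\<close>

definition well_placed :: "real set \<Rightarrow> (real \<Rightarrow> ereal) \<Rightarrow> bool"
  where "well_placed J F \<longleftrightarrow>
    (\<forall>t. open {s\<in>J. F s < ereal t} \<and> is_interval {s\<in>J. F s < ereal t} \<and>
      open {s\<in>J. ereal t < F s} \<and> is_interval {s\<in>J. ereal t < F s})"

lemma well_placed_const: "open J \<Longrightarrow> is_interval J \<Longrightarrow> well_placed J (\<lambda>s. c)"
proof -
  have *: "{s \<in> J. P} = (if P then J else {})" for P by auto
  assume "open J" "is_interval J"
  then show ?thesis unfolding well_placed_def * by (simp add: is_interval_empty)
qed

text \<open>A continuous injective function on an interval is strictly monotone; the fact
  \<open>between\<close> treats increasing and decreasing functions alike.\<close>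

lemma well_placed_inj:
  assumes J: "open J" "is_interval J" and h: "continuous_on J h" and inj: "inj_on h J"
  shows "well_placed J (\<lambda>s. ereal (h s))"
proof -
  have between: "h a < h x \<and> h x < h b \<or> h b < h x \<and> h x < h a" if "a \<in> J" "b \<in> J" "a < x" "x < b" for a b x
  proof (rule continuous_inj_imp_mono[OF that(3,4)])
    have sub: "{a..b} \<subseteq> J" using mem_is_interval_1_I[OF J(2) that(1,2)] by auto
    show "continuous_on {a..b} h" using continuous_on_subset[OF h sub] .
    show "inj_on h {a..b}" using inj_on_subset[OF inj sub] .
  qed
  have 1: "{s\<in>J. h s < t} = J \<inter> h -` {..<t}" "{s\<in>J. t < h s} = J \<inter> h -` {t<..}" for t by auto
  have "open {s\<in>J. h s < t}" "open {s\<in>J. t < h s}" for t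
    unfolding 1 by (auto intro: continuous_open_preimage[OF h J(1)])
  moreover have "is_interval {s\<in>J. h s < t}" for t
    unfolding is_interval_1
  proof (intro ballI allI impI)
    fix a b x assume *: "a \<in> {s\<in>J. h s < t}" "b \<in> {s\<in>J. h s < t}" "a \<le> x \<and> x \<le> b"
    then have "x \<in> J" using mem_is_interval_1_I[OF J(2), of a b x] by auto
    moreover have "x = a \<or> x = b \<or> a < x \<and> x < b" using * by auto
    ultimately show "x \<in> {s\<in>J. h s < t}" using between[of a b x] * by auto
  qed
  moreover have "is_interval {s\<in>J. t < h s}" for t
    unfolding is_interval_1
  proof (intro ballI allI impI)
    fix a b x assume *: "a \<in> {s\<in>J. t < h s}" "b \<in> {s\<in>J. t < h s}" "a \<le> x \<and> x \<le> b"
    then have "x \<in> J" using mem_is_interval_1_I[OF J(2), of a b x] by auto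
    moreover have "x = a \<or> x = b \<or> a < x \<and> x < b" using * by auto
    ultimately show "x \<in> {s\<in>J. t < h s}" using between[of a b x] * by auto
  qed
  ultimately show ?thesis by (simp add: well_placed_def)
qed

text \<open>Every horizontal line that meets the band meets it in an open interval, and the heights
  of these lines form an open interval \<open>T\<close>, so both integrations give a factor
  \<open>-1\<close>.\<close>

lemma swap_int_band:
  assumes J: "open J" "is_interval J" "J \<noteq> {}" and F: "well_placed J F" and G: "well_placed J G"
    and less: "\<And>s. s \<in> J \<Longrightarrow> F s < G s"
    and S: "\<And>s t. pt2 s t \<in> S \<longleftrightarrow> s \<in> J \<and> F s < ereal t \<and> ereal t < G s"
  shows "swap_int S = 1"
proof -
  define T where "T = (\<Union>s\<in>J. {t. F s < ereal t \<and> ereal t < G s})"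
  have inner: "line_int (\<lambda>s. of_bool (pt2 s t \<in> S)) = -1 * of_bool (t \<in> T)" for t
  proof (cases "t \<in> T")
    case True
    let ?U = "{s\<in>J. F s < ereal t} \<inter> {s\<in>J. ereal t < G s}"
    have "open ?U" "is_interval ?U"
      using F G by (auto simp: well_placed_def intro!: open_Int is_interval_Int)
    moreover have "?U \<noteq> {}" using True by (auto simp: T_def)
    moreover have "(\<lambda>s. of_bool (pt2 s t \<in> S)) = (\<lambda>s. of_bool (s \<in> ?U) :: int)" using S by auto
    ultimately show ?thesis using tame_open_interval[of ?U] True by simp
  next
    case False
    then have "(\<lambda>s. of_bool (pt2 s t \<in> S)) = (\<lambda>s. 0 :: int)" using S by (auto simp: T_def)
    then show ?thesis using False tame_zero by simp
  qed
  have "open T" unfolding T_def using band_fibre_interval(1) less by (intro open_UN) blast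
  moreover have "T \<noteq> {}" using J(3) band_fibre_interval(3)[OF less] by (auto simp: T_def)
  moreover have "is_interval T"
    unfolding is_interval_1
  proof (intro ballI allI impI, rule ccontr)
    fix a b x assume ab: "a \<in> T" "b \<in> T" and x: "a \<le> x \<and> x \<le> b" and nT: "x \<notin> T"
    \<comment> \<open>If height \<open>x\<close> were missed, the part of \<open>J\<close> where the
      lower bound is below \<open>x\<close> and the part where the upper bound is above
      \<open>x\<close> would be disjoint nonempty open sets covering the connected set
      \<open>J\<close>.\<close>
    let ?A = "{s\<in>J. F s < ereal x}" and ?B = "{s\<in>J. ereal x < G s}"
    obtain s where "s \<in> J" "F s < ereal a" using ab(1) by (auto simp: T_def)
    then have "s \<in> ?A" using x less_le_trans[of "F s" "ereal a" "ereal x"] by auto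
    obtain s' where "s' \<in> J" "ereal b < G s'" using ab(2) by (auto simp: T_def)
    then have "s' \<in> ?B" using x le_less_trans[of "ereal x" "ereal b" "G s'"] by auto
    have "connected J" using J(2) by (simp add: is_interval_connected_1)
    moreover have "open ?A" "open ?B" using F G by (auto simp: well_placed_def)
    moreover have "?A \<inter> ?B \<inter> J = {}" using nT by (auto simp: T_def)
    moreover have "J \<subseteq> ?A \<union> ?B" using less by (auto simp: not_less) (metis le_less_trans not_le)
    moreover have "?A \<inter> J \<noteq> {}" "?B \<inter> J \<noteq> {}" using \<open>s \<in> ?A\<close> \<open>s' \<in> ?B\<close> by auto
    ultimately show False unfolding connected_def by blast
  qed
  ultimately have T: "tame (\<lambda>t. of_bool (t \<in> T))" "line_int (\<lambda>t. of_bool (t \<in> T)) = -1"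
    using tame_open_interval by auto
  show ?thesis unfolding swap_int_def inner tame_cmult(2)[OF T(1)] T(2) by simp
qed

section \<open>Piecewise monotonicity and the swapped integral of cells\<close>

context o_minimal_structure
begin

lemma definable_Collect_Def: "Def P \<Longrightarrow> {x \<in> Rn n. P x} \<in> D n"
  by (rule definable_Collect, erule Def_subst) (auto simp: restr_def intro!: def_intros)

lemma constructible_subst:
  assumes "constructible m f" "poly_vec m v" shows "constructible n (\<lambda>x. f (v x))"
  using assms(1)
proof (induction rule: constructible.induct)
  case (indicat A)
  have "{x \<in> Rn n. v x \<in> A} \<in> D n" using Def_in[OF indicat assms(2)] by (rule definable_Collect_Def)
  from constructible.indicat[OF this] show ?case by (rule constructible.agree) auto
next
  case (agree f g)
  show ?case
    by (rule constructible.agree[OF agree.IH]) (use agree.hyps assms(2) in \<open>auto simp: poly_vec_def\<close>)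
qed (auto intro: constructible.intros)

lemma poly_vec_pt2: "poly_fun s \<Longrightarrow> poly_fun t \<Longrightarrow> poly_vec (Suc (Suc 0)) (\<lambda>e. pt2 (s e) (t e))"
  by (intro def_intros) auto

lemma swap_int_eq: "swap_int S = euler_int (Suc (Suc 0)) (\<lambda>z. of_bool (pt2 (z (Suc 0)) (z 0) \<in> S))"
  by (simp add: swap_int_def)

lemma constructible_swap: "constructible (Suc (Suc 0)) f \<Longrightarrow> constructible (Suc (Suc 0)) (\<lambda>z. f (pt2 (z (Suc 0)) (z 0)))"
  by (erule constructible_subst) (intro poly_vec_pt2 def_intros)

lemma swap_int_Un:
  assumes "S \<in> D (Suc (Suc 0))" "T \<in> D (Suc (Suc 0))" "S \<inter> T = {}"
  shows "swap_int (S \<union> T) = swap_int S + swap_int T"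
proof -
  have "(of_bool (z \<in> S \<union> T) :: int) = of_bool (z \<in> S) + of_bool (z \<in> T)" for z
    using assms(3) by auto
  then show ?thesis unfolding swap_int_eq
    using euler_int_add[OF constructible_swap[OF constructible.indicat[OF assms(1)]]
        constructible_swap[OF constructible.indicat[OF assms(2)]]]
    by (simp only:)
qed

text \<open>The line is regarded as the single fibre over the point of 0-space; \<open>E\<close> is
  the frontier of the set defined by \<open>P\<close>.\<close>

lemma definable_switch:
  assumes "Def (\<lambda>e. P (e 0))"
  obtains E where "finite E"
    "\<And>J. is_interval J \<Longrightarrow> J \<inter> E = {} \<Longrightarrow> (\<forall>s\<in>J. P s) \<or> (\<forall>s\<in>J. \<not> P s)"
proof -
  define A where "A = {z \<in> Rn (Suc 0). P (z 0)}"
  have A: "A \<in> D (Suc 0)" unfolding A_def using assms by (rule definable_Collect_Def)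
  have mem: "(\<lambda>_. 0)(0 := s) \<in> A \<longleftrightarrow> P s" for s
    unfolding A_def by (simp add: upd_in_Rn fun_upd_apply)
  have z: "(\<lambda>_. 0) \<in> Rn 0" by simp
  show ?thesis
  proof (rule that)
    show "finite (fibre 0 (fibre_frontier 0 A) (\<lambda>_. 0))" by (rule finite_fibre_frontier[OF A z])
    fix J assume J: "is_interval J" "J \<inter> fibre 0 (fibre_frontier 0 A) (\<lambda>_. 0) = {}"
    show "(\<forall>s\<in>J. P s) \<or> (\<forall>s\<in>J. \<not> P s)"
      using constant_off_fibre_frontier[OF z J] unfolding mem by blast
  qed
qed

text \<open>A form of the monotonicity theorem. \<open>K\<close>, \<open>U\<close> and
  \<open>L\<close> say that at \<open>s\<close> the function is locally constant, has a local
  maximum, has a local minimum; off finitely many points none of them changes its truth value. If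
  \<open>h\<close> is nowhere locally constant on \<open>J\<close>, it has no local extrema there,
  whereas between two equal values it would have an interior extremum or be constant.\<close>

lemma piecewise_injective:
  assumes I: "open I" "is_interval I" and cont: "continuous_on I h"
    and Gr: "Def (\<lambda>e. e 0 \<in> I \<and> e 1 = h (e 0))"
  obtains E where "finite E"
    "\<And>J. open J \<Longrightarrow> is_interval J \<Longrightarrow> J \<subseteq> I \<Longrightarrow> J \<inter> E = {} \<Longrightarrow> (\<exists>v. \<forall>s\<in>J. h s = v) \<or> inj_on h J"
proof -
  \<comment> \<open>Formulas can mention \<open>h\<close> only through its graph, and an absolute
    value only through two inequalities; hence the shape of \<open>K\<close>, \<open>U\<close> and
    \<open>L\<close>.\<close>
  define g where "g s t \<longleftrightarrow> s \<in> I \<and> t = h s" for s t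
  have "Def (\<lambda>e. g (e 0) (e 1))" using Gr by (simp add: g_def)
  then have g: "Def (\<lambda>e. g (s e) (t e))" if "poly_fun s" "poly_fun t" for s t
    using Def_subst[of "\<lambda>e. g (e 0) (e 1)" "\<lambda>e i. if i = 0 then s e else t e"] that
    by (simp add: poly_fun_if)
  define K where "K s \<longleftrightarrow> (\<exists>v. g s v \<and> (\<exists>d>0. \<forall>s'. s' - s < d \<and> s - s' < d \<longrightarrow> g s' v))" for s
  define U where "U s \<longleftrightarrow> (\<exists>v. g s v \<and> (\<exists>d>0. \<forall>s'. s' - s < d \<and> s - s' < d \<longrightarrow> (\<exists>w. g s' w \<and> w \<le> v)))" for s
  define L where "L s \<longleftrightarrow> (\<exists>v. g s v \<and> (\<exists>d>0. \<forall>s'. s' - s < d \<and> s - s' < d \<longrightarrow> (\<exists>w. g s' w \<and> v \<le> w)))" for s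
  have "Def (\<lambda>e. K (e 0))" unfolding K_def by (intro def_intros g)
  then obtain E1 where E1: "finite E1"
    "\<And>J. is_interval J \<Longrightarrow> J \<inter> E1 = {} \<Longrightarrow> (\<forall>s\<in>J. K s) \<or> (\<forall>s\<in>J. \<not> K s)"
    using definable_switch by blast
  have "Def (\<lambda>e. U (e 0))" unfolding U_def by (intro def_intros g)
  then obtain E2 where E2: "finite E2"
    "\<And>J. is_interval J \<Longrightarrow> J \<inter> E2 = {} \<Longrightarrow> (\<forall>s\<in>J. U s) \<or> (\<forall>s\<in>J. \<not> U s)"
    using definable_switch by blast
  have "Def (\<lambda>e. L (e 0))" unfolding L_def by (intro def_intros g)
  then obtain E3 where E3: "finite E3"
    "\<And>J. is_interval J \<Longrightarrow> J \<inter> E3 = {} \<Longrightarrow> (\<forall>s\<in>J. L s) \<or> (\<forall>s\<in>J. \<not> L s)"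
    using definable_switch by blast
  show ?thesis
  proof (rule that[of "E1 \<union> E2 \<union> E3"])
    fix J assume J: "open J" "is_interval J" "J \<subseteq> I" "J \<inter> (E1 \<union> E2 \<union> E3) = {}"
    have ball: "\<exists>d>0. \<forall>s'. s' - s < d \<and> s - s' < d \<longrightarrow> s' \<in> W" if "open W" "s \<in> W" for s :: real and W
    proof -
      from that obtain d where "d > 0" "ball s d \<subseteq> W" by (rule openE)
      then show ?thesis by (intro exI[of _ d]) (auto simp: subset_iff dist_real_def abs_less_iff)
    qed
    have Kint: "K s" if "{p<..<q} \<subseteq> I" "p < s" "s < q" "\<forall>s'\<in>{p<..<q}. h s' = h s" for p q s
    proof -
      have "s \<in> I" using that by auto
      have "s \<in> {p<..<q}" using that by simp
      from ball[OF open_greaterThanLessThan this]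
      obtain d where "d > 0" "\<forall>s'. s' - s < d \<and> s - s' < d \<longrightarrow> s' \<in> {p<..<q}" by blast
      then have "\<forall>s'. s' - s < d \<and> s - s' < d \<longrightarrow> s' \<in> I \<and> h s = h s'" using that by (metis subsetD)
      then show ?thesis unfolding K_def g_def using \<open>s \<in> I\<close> \<open>d > 0\<close> by blast
    qed
    consider "\<forall>s\<in>J. K s" | "\<forall>s\<in>J. \<not> K s" using E1(2)[OF J(2)] J(4) by blast
    then show "(\<exists>v. \<forall>s\<in>J. h s = v) \<or> inj_on h J"
    proof cases
      case 1
      have "h s = h t" if "s \<in> J" "t \<in> J" for s t
      proof (rule loc_const_interval[OF J(2) _ that])
        fix t assume "t \<in> J"
        then have "K t" using 1 by blast
        then obtain v d where "g t v" "d > 0" "\<forall>s'. s' - t < d \<and> t - s' < d \<longrightarrow> g s' v"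
          unfolding K_def by blast
        then have "d > 0" "\<forall>s'. s' - t < d \<and> t - s' < d \<longrightarrow> h s' = h t"
          unfolding g_def by metis+
        then show "\<exists>d>0. \<forall>s\<in>J. \<bar>s - t\<bar> < d \<longrightarrow> h s = h t"
          unfolding abs_less_iff minus_diff_eq by blast
      qed
      then show ?thesis by blast
    next
      case 2
      \<comment> \<open>Extrema at all points of \<open>J\<close> are impossible: by
        \<open>interval_countable_cover\<close> one rational interval witnesses the extremum at
        every point of a subinterval, so any two values there are comparable both ways and
        \<open>h\<close> is constant on it. The relation \<open>R\<close> covers maxima and minima
        at once.\<close>
      have ext: False if "J \<noteq> {}" and le: "\<And>v w. R v w \<Longrightarrow> R w v \<Longrightarrow> v = w"
        and RD: "\<And>s t. poly_fun s \<Longrightarrow> poly_fun t \<Longrightarrow> Def (\<lambda>e. R (s e) (t e))"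
        and all: "\<forall>s\<in>J. \<exists>v. g s v \<and> (\<exists>d>0. \<forall>s'. s' - s < d \<and> s - s' < d \<longrightarrow> (\<exists>w. g s' w \<and> R w v))" for R
      proof -
        from that(1) obtain s0 where s0: "s0 \<in> J" by blast
        obtain d where d: "d > 0" "\<forall>s'. s' - s0 < d \<and> s0 - s' < d \<longrightarrow> s' \<in> J" using ball[OF J(1) s0] by blast
        have sub: "{s0 - d<..<s0 + d} \<subseteq> J" using d(2) by auto
        define Q where "Q k s \<longleftrightarrow> (case from_nat k of (p :: rat, q :: rat) \<Rightarrow>
          of_rat p < s \<and> s < of_rat q \<and> (\<exists>v. g s v \<and> (\<forall>s'. of_rat p < s' \<and> s' < of_rat q \<longrightarrow> (\<exists>w. g s' w \<and> R w v))))"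
          for k s
        have "Def (\<lambda>e. Q k (e 0))" for k
        proof (cases "from_nat k :: rat \<times> rat")
          case (Pair p q)
          show ?thesis unfolding Q_def Pair prod.case by (intro def_intros g RD)
        qed
        moreover have "{s0 - d<..<s0 + d} \<subseteq> (\<Union>k. {s. Q k s})"
        proof
          fix s assume "s \<in> {s0 - d<..<s0 + d}"
          then have "s \<in> J" using sub by blast
          then obtain v r where r: "g s v" "r > 0" "\<forall>s'. s' - s < r \<and> s - s' < r \<longrightarrow> (\<exists>w. g s' w \<and> R w v)"
            using all by blast
          obtain p where p: "s - r < of_rat p" "of_rat p < s" using of_rat_dense[of "s - r" s] r(2) by auto
          obtain q where q: "s < of_rat q" "of_rat q < s + r" using of_rat_dense[of s "s + r"] r(2) by auto
          have "Q (to_nat (p, q)) s" unfolding Q_def using p q r by auto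
          then show "s \<in> (\<Union>k. {s. Q k s})" by blast
        qed
        ultimately obtain k p' q' where k: "s0 - d \<le> p'" "p' < q'" "q' \<le> s0 + d" "{p'<..<q'} \<subseteq> {s. Q k s}"
          using interval_countable_cover[of Q "s0 - d" "s0 + d"] d(1) by auto
        obtain p q where pq: "from_nat k = (p :: rat, q :: rat)" by (cases "from_nat k :: rat \<times> rat")
        have Q: "of_rat p < s \<and> s < of_rat q \<and> (\<forall>s'. of_rat p < s' \<and> s' < of_rat q \<longrightarrow> R (h s') (h s))"
          if "s \<in> {p'<..<q'}" for s
        proof -
          have "Q k s" using k(4) that by blast
          then show ?thesis unfolding Q_def pq prod.case g_def by auto
        qed
        have const: "h s = h t" if "s \<in> {p'<..<q'}" "t \<in> {p'<..<q'}" for s t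
          using Q[OF that(1)] Q[OF that(2)] le by blast
        have IJ: "{p'<..<q'} \<subseteq> J"
        proof
          fix s assume "s \<in> {p'<..<q'}"
          then have "s \<in> {s0 - d<..<s0 + d}" using k by auto
          then show "s \<in> J" using sub by blast
        qed
        obtain s where s: "p' < s" "s < q'" using dense[OF k(2)] by blast
        have sm: "s \<in> {p'<..<q'}" using s by auto
        have "K s"
        proof (rule Kint[of p' q'])
          show "\<forall>s'\<in>{p'<..<q'}. h s' = h s" using const sm by blast
        qed (use IJ J(3) s in auto)
        then show False using 2 IJ sm by blast
      qed
      have noU: "\<not> U s" if "s \<in> J" for s
      proof
        assume "U s"
        then have "\<forall>s\<in>J. U s" using E2(2)[OF J(2)] J(4) that by blast
        then have "\<forall>s\<in>J. \<exists>v. g s v \<and> (\<exists>d>0. \<forall>s'. s' - s < d \<and> s - s' < d \<longrightarrow> (\<exists>w. g s' w \<and> w \<le> v))"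
          by (simp add: U_def)
        from ext[where R = "\<lambda>w v. w \<le> v", OF _ _ _ this] show False using that by (auto intro: Def_le)
      qed
      have noL: "\<not> L s" if "s \<in> J" for s
      proof
        assume "L s"
        then have "\<forall>s\<in>J. L s" using E3(2)[OF J(2)] J(4) that by blast
        then have "\<forall>s\<in>J. \<exists>v. g s v \<and> (\<exists>d>0. \<forall>s'. s' - s < d \<and> s - s' < d \<longrightarrow> (\<exists>w. g s' w \<and> v \<le> w))"
          by (simp add: L_def)
        from ext[where R = "\<lambda>w v. v \<le> w", OF _ _ _ this] show False using that by (auto intro: Def_le)
      qed
      have "inj_on h J"
      proof (rule linorder_inj_onI)
        fix x y assume xy: "x < y" "x \<in> J" "y \<in> J"
        have sub: "{x..y} \<subseteq> J" using mem_is_interval_1_I[OF J(2) xy(2,3)] by auto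
        have c: "continuous_on {x..y} h" using continuous_on_subset[OF cont] sub J(3) by blast
        show "h x \<noteq> h y"
        proof
          assume eq: "h x = h y"
          obtain m where m: "m \<in> {x..y}" "\<forall>s\<in>{x..y}. h s \<le> h m"
            using continuous_attains_sup[OF _ _ c] xy by auto
          obtain l where l: "l \<in> {x..y}" "\<forall>s\<in>{x..y}. h l \<le> h s"
            using continuous_attains_inf[OF _ _ c] xy by auto
          have near: "\<exists>d>0. \<forall>s'. s' - s < d \<and> s - s' < d \<longrightarrow> s' \<in> {x..y}" if "x < s" "s < y" for s
            using ball[of "{x<..<y}" s] that by fastforce
          have sI: "s \<in> I" if "s \<in> {x..y}" for s using sub J(3) that by blast
          show False
          proof (cases "x < m \<and> m < y")
            case True
            then obtain d where "d > 0" "\<forall>s'. s' - m < d \<and> m - s' < d \<longrightarrow> s' \<in> {x..y}" using near by blast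
            then have "U m" unfolding U_def g_def using m sI by blast
            then show False using noU m sub by blast
          next
            case False
            \<comment> \<open>The maximum is attained at an end, so it equals \<open>h x\<close>. If
              the minimum is too, \<open>h\<close> is constant on the segment and
              \<open>Kint\<close> gives the contradiction.\<close>
            then have hm: "h m = h x" using m(1) eq by (auto simp: less_le)
            show False
            proof (cases "x < l \<and> l < y")
              case True
              then obtain d where "d > 0" "\<forall>s'. s' - l < d \<and> l - s' < d \<longrightarrow> s' \<in> {x..y}" using near by blast
              then have "L l" unfolding L_def g_def using l sI by blast
              then show False using noL l sub by blast
            next
              case False
              then have hl: "h l = h x" using l(1) eq by (auto simp: less_le)
              have const: "h s = h x" if "s \<in> {x..y}" for s
              proof -
                have "h s \<le> h m" "h l \<le> h s" using m(2) l(2) that by blast+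
                then show ?thesis unfolding hm hl by (rule order_antisym)
              qed
              obtain s where s: "x < s" "s < y" using dense[OF xy(1)] by blast
              have "K s"
              proof (rule Kint[of x y])
                show "{x<..<y} \<subseteq> I" using sI by auto
                show "\<forall>s'\<in>{x<..<y}. h s' = h s"
                proof
                  fix s' assume "s' \<in> {x<..<y}"
                  then have "s' \<in> {x..y}" "s \<in> {x..y}" using s by auto
                  from const[OF this(1)] const[OF this(2)] show "h s' = h s" by (rule trans[OF _ sym])
                qed
              qed (use s in auto)
              moreover have "s \<in> J" using sub s by auto
              ultimately show False using 2 by blast
            qed
          qed
        qed
      qed auto
      then show ?thesis by blast
    qed
  qed (use E1 E2 E3 in auto)
qed

text \<open>Cutting \<open>J\<close> at an exceptional point gives \<open>c + (- c) + c\<close>, so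
  finitely many such points leave the value unchanged. For graphs \<open>c\<close> is
  \<open>-1\<close> and the points cut out contribute \<open>1\<close>; for bands \<open>c\<close>
  is \<open>1\<close> and the vertical segments cut out contribute \<open>-1\<close>.\<close>

lemma swap_int_split:
  assumes S: "S \<in> D (Suc (Suc 0))" and E: "finite E"
    and pt: "\<And>e. e \<in> I \<Longrightarrow> swap_int {z \<in> S. z 0 = e} = - c"
    and good: "\<And>J. open J \<Longrightarrow> is_interval J \<Longrightarrow> J \<noteq> {} \<Longrightarrow> J \<subseteq> I \<Longrightarrow> J \<inter> E = {} \<Longrightarrow>
      swap_int {z \<in> S. z 0 \<in> J} = c"
  shows "open J \<Longrightarrow> is_interval J \<Longrightarrow> J \<noteq> {} \<Longrightarrow> J \<subseteq> I \<Longrightarrow> Def (\<lambda>e. e 0 \<in> J) \<Longrightarrow>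
    swap_int {z \<in> S. z 0 \<in> J} = c"
proof (induction "card (E \<inter> J)" arbitrary: J rule: less_induct)
  case (less J)
  show ?case
  proof (cases "J \<inter> E = {}")
    case True
    then show ?thesis using good less.prems by blast
  next
    case False
    then obtain e where e: "e \<in> E" "e \<in> J" by blast
    define A where "A = J \<inter> {..<e}"
    define B where "B = J \<inter> {e<..}"
    obtain r where r: "r > 0" "ball e r \<subseteq> J" using less.prems(1) e openE by blast
    have "e - r / 2 \<in> A" "e + r / 2 \<in> B" using r by (auto simp: A_def B_def subset_iff dist_real_def)
    then have ne: "A \<noteq> {}" "B \<noteq> {}" by auto
    have op: "open A" "open B" using less.prems(1) by (auto simp: A_def B_def)
    have iv: "is_interval A" "is_interval B" using less.prems(2) by (auto simp: A_def B_def intro!: is_interval_Int is_interval_io is_interval_oi)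
    have sub: "A \<subseteq> I" "B \<subseteq> I" using less.prems(4) by (auto simp: A_def B_def)
    have dA: "Def (\<lambda>x. x 0 \<in> A)" unfolding A_def Int_iff lessThan_iff by (intro def_intros less.prems(5))
    have dB: "Def (\<lambda>x. x 0 \<in> B)" unfolding B_def Int_iff greaterThan_iff by (intro def_intros less.prems(5))
    have "card (E \<inter> A) < card (E \<inter> J)" "card (E \<inter> B) < card (E \<inter> J)"
      using E e by (auto intro!: psubset_card_mono simp: A_def B_def)
    then have v: "swap_int {z \<in> S. z 0 \<in> A} = c" "swap_int {z \<in> S. z 0 \<in> B} = c"
      using less.hyps[OF _ op(1) iv(1) ne(1) sub(1) dA] less.hyps[OF _ op(2) iv(2) ne(2) sub(2) dB] by auto
    have SR: "{z \<in> S. P (z 0)} \<in> D (Suc (Suc 0))" if "Def (\<lambda>x. P (x 0))" for P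
    proof -
      have "{z \<in> S. P (z 0)} = S \<inter> {z \<in> Rn (Suc (Suc 0)). P (z 0)}" using definable_subset[OF S] by auto
      then show ?thesis using S definable_Collect_Def[OF that] by (simp add: definable_Int)
    qed
    have dS: "{z \<in> S. z 0 \<in> A} \<in> D (Suc (Suc 0))" "{z \<in> S. z 0 \<in> B} \<in> D (Suc (Suc 0))"
      "{z \<in> S. z 0 = e} \<in> D (Suc (Suc 0))"
      using SR[OF dA] SR[OF dB] SR[of "\<lambda>t. t = e", OF Def_eq[OF poly_fun_coord poly_fun_const]] by auto
    have "{z \<in> S. z 0 \<in> J} = ({z \<in> S. z 0 \<in> A} \<union> {z \<in> S. z 0 = e}) \<union> {z \<in> S. z 0 \<in> B}"
      using e by (auto simp: A_def B_def)
    also have "swap_int \<dots> = swap_int ({z \<in> S. z 0 \<in> A} \<union> {z \<in> S. z 0 = e}) + swap_int {z \<in> S. z 0 \<in> B}"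
      using dS by (intro swap_int_Un definable_Un) (auto simp: A_def B_def)
    also have "\<dots> = swap_int {z \<in> S. z 0 \<in> A} + swap_int {z \<in> S. z 0 = e} + swap_int {z \<in> S. z 0 \<in> B}"
      using dS swap_int_Un[of "{z \<in> S. z 0 \<in> A}" "{z \<in> S. z 0 = e}"] by (auto simp: A_def)
    also have "\<dots> = c" using v pt[of e] e less.prems(4) by auto
    finally show ?thesis .
  qed
qed

abbreviation pt1 :: "real \<Rightarrow> nat \<Rightarrow> real"
  where "pt1 s \<equiv> (\<lambda>_. 0)(0 := s)"

lemma pt1_in: "pt1 s \<in> Rn (Suc 0)"
  by (intro upd_in_Rn) simp

lemma pt1_eq_iff: "pt1 s = pt1 t \<longleftrightarrow> s = t"
  by (simp add: upd_eq_iff[of _ 0])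

lemma cell1_cases:
  assumes "cell D (Suc 0) d B"
  obtains (point) a where "d = 0" "\<And>s. pt1 s \<in> B \<longleftrightarrow> s = a"
  | (interval) I where "d = 1" "open I" "is_interval I" "I \<noteq> {}" "\<And>s. pt1 s \<in> B \<longleftrightarrow> s \<in> I"
  using assms
proof (cases rule: cell_Suc_cases)
  case (graph B0 f)
  then have B0: "B0 = {\<lambda>_. 0}" "d = 0" by (auto elim: cell.cases)
  show ?thesis
    by (rule that(1)[of "f (\<lambda>_. 0)"]) (auto simp: B0 graph pt1_eq_iff)
next
  case (band d' B0 f g)
  then have B0: "B0 = {\<lambda>_. 0}" "d' = 0" by (auto elim: cell.cases)
  have "f (\<lambda>_. 0) < g (\<lambda>_. 0)" using band B0 by simp
  note I = band_fibre_interval[OF this]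
  show ?thesis
    by (rule that(2)[OF _ I]) (auto simp: B0 band pt1_eq_iff)
qed

lemma Def_pt1: "B \<in> D (Suc 0) \<Longrightarrow> Def (\<lambda>e. pt1 (e 0) \<in> B)"
  by (rule Def_in, assumption, intro def_intros) simp

lemma cell_fun1:
  assumes B: "B \<in> D (Suc 0)" "\<And>s. pt1 s \<in> B \<longleftrightarrow> s \<in> I" and h: "cell_fun D (Suc 0) B h"
  shows "continuous_on I (\<lambda>s. h (pt1 s))" "Def (\<lambda>e. e 0 \<in> I \<and> e 1 = h (pt1 (e 0)))"
proof -
  have sub: "B \<subseteq> Rn (Suc 0)" using B definable_subset by blast
  show "continuous_on I (\<lambda>s. h (pt1 s))"
    unfolding continuous_on_iff
  proof (intro ballI allI impI)
    fix s e assume s: "s \<in> I" "(0::real) < e"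
    then have "pt1 s \<in> B" using B by blast
    from cell_fun_cont[OF h sub this s(2)] obtain d where
      d: "d > 0" "\<forall>y\<in>cube (Suc 0) (pt1 s) d \<inter> B. \<bar>h y - h (pt1 s)\<bar> < e" by blast
    have "\<bar>h (pt1 t) - h (pt1 s)\<bar> < e" if "t \<in> I" "\<bar>t - s\<bar> < d" for t
    proof -
      have "pt1 t \<in> cube (Suc 0) (pt1 s) d"
        using that(2) d(1) by (subst upd_in_cube) (auto intro: cube_self)
      then show ?thesis using d(2) B(2) that(1) by blast
    qed
    then show "\<exists>d>0. \<forall>t\<in>I. dist t s < d \<longrightarrow> dist (h (pt1 t)) (h (pt1 s)) < e"
      using d(1) by (auto simp: dist_real_def)
  qed
  have G: "graph_on (Suc 0) h B \<in> D (Suc (Suc 0))" using h by (simp add: cell_fun_def)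
  have "pt2 s t \<in> graph_on (Suc 0) h B \<longleftrightarrow> s \<in> I \<and> t = h (pt1 s)" for s t
  proof
    assume "pt2 s t \<in> graph_on (Suc 0) h B"
    then obtain x where x: "x \<in> B" "pt2 s t = x(Suc 0 := h x)" by blast
    then have "pt1 s = x" "t = h x" using upd_eq_iff[OF pt1_in] sub by blast+
    then show "s \<in> I \<and> t = h (pt1 s)" using x B(2) by blast
  qed (use B(2) in blast)
  then show "Def (\<lambda>e. e 0 \<in> I \<and> e 1 = h (pt1 (e 0)))"
    using Def_in[OF G poly_vec_pt2[OF poly_fun_coord poly_fun_coord], of 0 1] by simp
qed

lemma cell_bound_well_placed:
  assumes B: "B \<in> D (Suc 0)" "\<And>s. pt1 s \<in> B \<longleftrightarrow> s \<in> I" and I: "open I" "is_interval I"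
    and F: "cell_bound D (Suc 0) B F"
  obtains E where "finite E" "\<And>J. open J \<Longrightarrow> is_interval J \<Longrightarrow> J \<subseteq> I \<Longrightarrow> J \<inter> E = {} \<Longrightarrow>
    well_placed J (\<lambda>s. F (pt1 s))"
proof -
  consider c where "F = (\<lambda>_. c)" | h where "cell_fun D (Suc 0) B h" "F = (\<lambda>x. ereal (h x))"
    using F unfolding cell_bound_def by blast
  then show ?thesis
  proof cases
    case 1
    then show ?thesis using well_placed_const by (intro that[of "{}"]) auto
  next
    case (2 h)
    note h = cell_fun1[OF B 2(1)]
    obtain E where E: "finite E"
      "\<And>J. open J \<Longrightarrow> is_interval J \<Longrightarrow> J \<subseteq> I \<Longrightarrow> J \<inter> E = {} \<Longrightarrow>
        (\<exists>v. \<forall>s\<in>J. h (pt1 s) = v) \<or> inj_on (\<lambda>s. h (pt1 s)) J"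
      using piecewise_injective[OF I h] by blast
    show ?thesis
    proof (rule that[OF E(1)])
      fix J assume J: "open J" "is_interval J" "J \<subseteq> I" "J \<inter> E = {}"
      from E(2)[OF J] show "well_placed J (\<lambda>s. F (pt1 s))"
      proof
        assume "\<exists>v. \<forall>s\<in>J. h (pt1 s) = v"
        then obtain v where "\<forall>s\<in>J. F (pt1 s) = ereal v" using 2(2) by auto
        then have "well_placed J (\<lambda>s. F (pt1 s)) = well_placed J (\<lambda>s. ereal v)"
          unfolding well_placed_def by (simp cong: conj_cong)
        then show ?thesis using well_placed_const[OF J(1,2)] by simp
      next
        assume "inj_on (\<lambda>s. h (pt1 s)) J"
        from well_placed_inj[OF J(1,2) continuous_on_subset[OF h(1) J(3)] this]
        show ?thesis using 2(2) by simp
      qed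
    qed
  qed
qed

text \<open>Over an interval, \<open>swap_int_split\<close> reduces the cell to pieces whose
  boundary functions are constant or injective; over a point the cell is a point or a vertical
  segment.\<close>

lemma swap_int_cell:
  assumes C: "cell D (Suc (Suc 0)) d C"
  shows "swap_int C = (-1) ^ d"
proof -
  have CD: "C \<in> D (Suc (Suc 0))" using C definable_cell by blast
  from C show ?thesis
  proof (cases rule: cell_Suc_cases)
    case (graph B f)
    have sub: "B \<subseteq> Rn (Suc 0)" using graph cell_sub by blast
    have mem: "pt2 s t \<in> C \<longleftrightarrow> pt1 s \<in> B \<and> t = f (pt1 s)" for s t
    proof
      assume "pt2 s t \<in> C"
      then obtain x where x: "x \<in> B" "pt2 s t = x(Suc 0 := f x)" using graph by blast
      then have "pt1 s = x" "t = f x" using upd_eq_iff[OF pt1_in] sub by blast+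
      then show "pt1 s \<in> B \<and> t = f (pt1 s)" using x by blast
    qed (use graph in blast)
    from graph(1) show ?thesis
    proof (cases rule: cell1_cases)
      case (point a)
      then show ?thesis using swap_int_point[of C a "f (pt1 a)"] mem by auto
    next
      case (interval I)
      note h = cell_fun1[OF definable_cell[OF graph(1)] interval(5) graph(2)]
      obtain E where E: "finite E"
        "\<And>J. open J \<Longrightarrow> is_interval J \<Longrightarrow> J \<subseteq> I \<Longrightarrow> J \<inter> E = {} \<Longrightarrow>
          (\<exists>v. \<forall>s\<in>J. f (pt1 s) = v) \<or> inj_on (\<lambda>s. f (pt1 s)) J"
        using piecewise_injective[OF interval(2,3) h] by blast
      have "swap_int {z \<in> C. z 0 \<in> I} = -1"
      proof (rule swap_int_split[OF CD E(1)])
        fix e assume "e \<in> I"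
        then show "swap_int {z \<in> C. z 0 = e} = - (-1)"
          using swap_int_point[of "{z \<in> C. z 0 = e}" e "f (pt1 e)"] mem interval(5) by auto
      next
        fix J assume J: "open J" "is_interval J" "J \<noteq> {}" "J \<subseteq> I" "J \<inter> E = {}"
        show "swap_int {z \<in> C. z 0 \<in> J} = -1"
          by (rule swap_int_graph[OF J(1-3) continuous_on_subset[OF h(1) J(4)] E(2)[OF J(1,2,4,5)]])
            (use mem interval(5) J(4) in auto)
      next
        show "Def (\<lambda>e. e 0 \<in> I)"
          using Def_pt1[OF definable_cell[OF graph(1)]] interval(5) by simp
      qed (use interval in auto)
      moreover have "z 0 \<in> I" if "z \<in> C" for z
      proof -
        have "z \<in> Rn (Suc (Suc 0))" using that CD definable_subset by blast
        then have "z = pt2 (z 0) (z (Suc 0))"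
          by (auto simp: Rn_iff fun_eq_iff fun_upd_def numeral_2_eq_2[symmetric])
        then show ?thesis using mem interval(5) that by metis
      qed
      then have "{z \<in> C. z 0 \<in> I} = C" by blast
      ultimately show ?thesis using interval(1) by simp
    qed
  next
    case (band d' B f g)
    have sub: "B \<subseteq> Rn (Suc 0)" using band cell_sub by blast
    have mem: "pt2 s t \<in> C \<longleftrightarrow> pt1 s \<in> B \<and> f (pt1 s) < ereal t \<and> ereal t < g (pt1 s)" for s t
    proof
      assume "pt2 s t \<in> C"
      then obtain x u where x: "x \<in> B" "pt2 s t = x(Suc 0 := u)" "f x < ereal u" "ereal u < g x"
        using band by blast
      then have "pt1 s = x" "t = u" using upd_eq_iff[OF pt1_in] sub by blast+
      then show "pt1 s \<in> B \<and> f (pt1 s) < ereal t \<and> ereal t < g (pt1 s)" using x by blast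
    qed (use band in blast)
    have seg: "swap_int S = -1" if S: "\<And>s t. pt2 s t \<in> S \<longleftrightarrow> s = a \<and> pt2 s t \<in> C" and a: "pt1 a \<in> B" for S a
    proof -
      have "swap_int S = line_int (\<lambda>t. of_bool (t \<in> {t. f (pt1 a) < ereal t \<and> ereal t < g (pt1 a)}))"
        by (rule swap_int_prod_point) (use S mem a in auto)
      also have "\<dots> = -1"
        using tame_open_interval(2)[OF band_fibre_interval] band(5) a by blast
      finally show ?thesis .
    qed
    from band(2) show ?thesis
    proof (cases rule: cell1_cases)
      case (point a)
      then show ?thesis using seg[of C a] mem band(1) by auto
    next
      case (interval I)
      obtain E1 where E1: "finite E1" "\<And>J. open J \<Longrightarrow> is_interval J \<Longrightarrow> J \<subseteq> I \<Longrightarrow> J \<inter> E1 = {} \<Longrightarrow>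
          well_placed J (\<lambda>s. f (pt1 s))"
        using cell_bound_well_placed[OF definable_cell[OF band(2)] interval(5,2,3) band(3)] by blast
      obtain E2 where E2: "finite E2" "\<And>J. open J \<Longrightarrow> is_interval J \<Longrightarrow> J \<subseteq> I \<Longrightarrow> J \<inter> E2 = {} \<Longrightarrow>
          well_placed J (\<lambda>s. g (pt1 s))"
        using cell_bound_well_placed[OF definable_cell[OF band(2)] interval(5,2,3) band(4)] by blast
      have E: "finite (E1 \<union> E2)" using E1 E2 by blast
      have "swap_int {z \<in> C. z 0 \<in> I} = 1"
      proof (rule swap_int_split[OF CD E])
        fix e assume "e \<in> I"
        then show "swap_int {z \<in> C. z 0 = e} = - 1"
          using seg[of "{z \<in> C. z 0 = e}" e] interval(5) by auto
      next
        fix J assume J: "open J" "is_interval J" "J \<noteq> {}" "J \<subseteq> I" "J \<inter> (E1 \<union> E2) = {}"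
        have wp: "well_placed J (\<lambda>s. f (pt1 s))" "well_placed J (\<lambda>s. g (pt1 s))"
          using E1(2)[OF J(1,2,4)] E2(2)[OF J(1,2,4)] J(5) by auto
        show "swap_int {z \<in> C. z 0 \<in> J} = 1"
          by (rule swap_int_band[OF J(1-3) wp]) (use mem interval(5) J(4) band(5) in auto)
      next
        show "Def (\<lambda>e. e 0 \<in> I)"
          using Def_pt1[OF definable_cell[OF band(2)]] interval(5) by simp
      qed (use interval in auto)
      moreover have "z 0 \<in> I" if "z \<in> C" for z
      proof -
        have "z \<in> Rn (Suc (Suc 0))" using that CD definable_subset by blast
        then have "z = pt2 (z 0) (z (Suc 0))"
          by (auto simp: Rn_iff fun_eq_iff fun_upd_def numeral_2_eq_2[symmetric])
        then show ?thesis using mem interval(5) that by metis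
      qed
      then have "{z \<in> C. z 0 \<in> I} = C" by blast
      ultimately show ?thesis using interval(1) band(1) by simp
    qed
  qed
qed

text \<open>Both orders are linear and give \<open>(-1) ^ d\<close> on a cell of dimension
  \<open>d\<close>.\<close>

lemma fubini_plane:
  assumes "constructible (Suc (Suc 0)) f"
  shows "line_int (\<lambda>s. line_int (\<lambda>t. f (pt2 s t))) = line_int (\<lambda>t. line_int (\<lambda>s. f (pt2 s t)))"
proof -
  have "euler_int (Suc (Suc 0)) f = euler_int (Suc (Suc 0)) (\<lambda>z. f (pt2 (z (Suc 0)) (z 0)))"
    using assms
  proof (induction rule: constructible_cell_induct)
    case (cell C d)
    then show ?case using euler_int_cell[OF cell] swap_int_cell[OF cell] unfolding swap_int_eq by (simp only:)
  next
    case (add f g)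
    then show ?case
      using euler_int_add[OF add.hyps] euler_int_add[OF constructible_swap[OF add.hyps(1)] constructible_swap[OF add.hyps(2)]]
      by (simp only:)
  next
    case (cmult f c)
    then show ?case
      using euler_int_cmult[OF cmult.hyps] euler_int_cmult[OF constructible_swap[OF cmult.hyps]]
      by (simp only:)
  next
    case (cong f g)
    have "euler_int (Suc (Suc 0)) g = euler_int (Suc (Suc 0)) f"
      by (rule euler_int_cong) (simp add: cong.hyps(2))
    moreover have "euler_int (Suc (Suc 0)) (\<lambda>z. g (pt2 (z (Suc 0)) (z 0))) =
        euler_int (Suc (Suc 0)) (\<lambda>z. f (pt2 (z (Suc 0)) (z 0)))"
      by (rule euler_int_cong) (simp add: cong.hyps(2) pt2_in)
    ultimately show ?case using cong.IH by (simp only:)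
  qed (simp only:)
  then show ?thesis by simp
qed

text \<open>The last variable moves outwards, past its neighbour by \<open>fubini_plane\<close> and
  past the rest by the induction hypothesis.\<close>

lemma fubini_line:
  "constructible (Suc n) f \<Longrightarrow>
    euler_int n (\<lambda>x. line_int (\<lambda>t. f (x(n := t)))) = line_int (\<lambda>t. euler_int n (\<lambda>x. f (x(n := t))))"
proof (induction n arbitrary: f)
  case (Suc n)
  \<comment> \<open>\<open>f\<close> with its last two coordinates exchanged: once the neighbour is
    integrated out, the variable to be moved is again the last one.\<close>
  define f' where "f' w = f ((restr n w)(n := w (Suc n), Suc n := w n))" for w
  have f': "constructible (Suc (Suc n)) f'"
    unfolding f'_def by (rule constructible_subst[OF Suc.prems]) (intro def_intros)
  have f'_upd: "f' (x(n := t, Suc n := s)) = f (x(n := s, Suc n := t))" if "x \<in> Rn n" for x s t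
  proof -
    have "restr n (x(n := t, Suc n := s)) = x"
      using that by (auto simp: restr_def Rn_iff fun_upd_apply fun_eq_iff)
    then show ?thesis by (simp add: f'_def fun_upd_apply)
  qed
  have "euler_int (Suc n) (\<lambda>x. line_int (\<lambda>t. f (x(Suc n := t)))) =
      euler_int n (\<lambda>x. line_int (\<lambda>s. line_int (\<lambda>t. f (x(n := s, Suc n := t)))))"
    by simp
  also have "\<dots> = euler_int n (\<lambda>x. line_int (\<lambda>t. line_int (\<lambda>s. f' (x(n := t, Suc n := s)))))"
  proof (rule euler_int_cong)
    fix x assume x: "x \<in> Rn n"
    have "constructible (Suc (Suc 0)) (\<lambda>z. f (x(n := z 0, Suc n := z (Suc 0))))"
      by (rule constructible_subst[OF Suc.prems]) (intro def_intros x)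
    from fubini_plane[OF this]
    show "line_int (\<lambda>s. line_int (\<lambda>t. f (x(n := s, Suc n := t)))) =
      line_int (\<lambda>t. line_int (\<lambda>s. f' (x(n := t, Suc n := s))))"
      by (simp add: f'_upd[OF x])
  qed
  also have "\<dots> = line_int (\<lambda>t. euler_int n (\<lambda>x. line_int (\<lambda>s. f' (x(n := t, Suc n := s)))))"
    using Suc.IH[OF constructible_line_int(2)[OF f']] .
  also have "\<dots> = line_int (\<lambda>t. euler_int n (\<lambda>x. line_int (\<lambda>s. f (x(n := s, Suc n := t)))))"
  proof -
    have "euler_int n (\<lambda>x. line_int (\<lambda>s. f' (x(n := t, Suc n := s)))) =
        euler_int n (\<lambda>x. line_int (\<lambda>s. f (x(n := s, Suc n := t))))" for t
      by (rule euler_int_cong) (simp add: f'_upd)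
    then show ?thesis by simp
  qed
  finally show ?case by simp
qed simp

section \<open>Fubini's theorem for products\<close>

lemma pair_pt_upd: "pair_pt n x (y(m := t)) = (pair_pt n x y)(n + m := t)"
  by (auto simp: pair_pt_def fun_eq_iff fun_upd_apply)

lemma pair_pt_zero: "x \<in> Rn n \<Longrightarrow> pair_pt n x (\<lambda>_. 0) = x"
  by (auto simp: pair_pt_def fun_eq_iff Rn_iff)

lemma euler_int_pair:
  "euler_int (n + m) f = euler_int n (\<lambda>x. euler_int m (\<lambda>y. f (pair_pt n x y)))"
proof (induction m arbitrary: f)
  case 0
  show ?case by (simp, rule euler_int_cong) (simp add: pair_pt_zero)
next
  case (Suc m)
  show ?case by (simp add: Suc pair_pt_upd)
qed

text \<open>The innermost variable of \<open>y\<close> is moved past \<open>x\<close> by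
  \<open>fubini_line\<close>, the others by induction on \<open>m\<close>.\<close>

lemma fubini:
  "constructible (n + m) f \<Longrightarrow> euler_int n (\<lambda>x. euler_int m (\<lambda>y. f (pair_pt n x y))) =
    euler_int m (\<lambda>y. euler_int n (\<lambda>x. f (pair_pt n x y)))"
proof (induction m arbitrary: f)
  case (Suc m)
  have f: "constructible (Suc (n + m)) f" using Suc.prems by simp
  have "euler_int n (\<lambda>x. euler_int (Suc m) (\<lambda>y. f (pair_pt n x y))) =
      euler_int m (\<lambda>y. euler_int n (\<lambda>x. line_int (\<lambda>t. f ((pair_pt n x y)(n + m := t)))))"
    using Suc.IH[OF constructible_line_int(2)[OF f]] by (simp add: pair_pt_upd)
  also have "\<dots> = euler_int m (\<lambda>y. line_int (\<lambda>t. euler_int n (\<lambda>x. f ((pair_pt n x y)(n + m := t)))))"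
  proof (rule euler_int_cong)
    fix y assume y: "y \<in> Rn m"
    \<comment> \<open>For fixed \<open>y\<close> this presents \<open>f\<close> as a function on
      (n+1)-space with \<open>t\<close> in the last place, the form that \<open>fubini_line\<close>
      treats.\<close>
    define g where "g w = f ((pair_pt n (restr n w) y)(n + m := w n))" for w
    have g: "constructible (Suc n) g"
      unfolding g_def by (rule constructible_subst[OF f]) (intro def_intros y)
    have gx: "g (x(n := t)) = f ((pair_pt n x y)(n + m := t))" if "x \<in> Rn n" for x t
      using that by (simp add: g_def fun_upd_apply)
    have "euler_int n (\<lambda>x. line_int (\<lambda>t. f ((pair_pt n x y)(n + m := t)))) =
        euler_int n (\<lambda>x. line_int (\<lambda>t. g (x(n := t))))"
      by (rule euler_int_cong) (simp add: gx)
    also have "\<dots> = line_int (\<lambda>t. euler_int n (\<lambda>x. g (x(n := t))))" by (rule fubini_line[OF g])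
    also have "\<dots> = line_int (\<lambda>t. euler_int n (\<lambda>x. f ((pair_pt n x y)(n + m := t))))"
    proof -
      have "euler_int n (\<lambda>x. g (x(n := t))) = euler_int n (\<lambda>x. f ((pair_pt n x y)(n + m := t)))" for t
        by (rule euler_int_cong) (simp add: gx)
      then show ?thesis by simp
    qed
    finally show "euler_int n (\<lambda>x. line_int (\<lambda>t. f ((pair_pt n x y)(n + m := t)))) =
      line_int (\<lambda>t. euler_int n (\<lambda>x. f ((pair_pt n x y)(n + m := t))))" .
  qed
  finally show ?case by (simp add: pair_pt_upd)
qed simp

end

section \<open>Circle actions\<close>

text \<open>Infinitely many elements of the compact circle include two distinct ones that are close;
  their quotient \<open>h\<close> is close to 1 but not 1, and its powers come close to every
  \<open>u\<close>. Closedness then gives \<open>u\<close> itself.\<close>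

lemma closed_infinite_circle_subgroup:
  fixes H :: "complex set"
  assumes sub: "H \<subseteq> sphere 0 1" and cl: "closed H" and inf: "infinite H"
    and mult: "\<And>z w. z \<in> H \<Longrightarrow> w \<in> H \<Longrightarrow> z * w \<in> H" and inv: "\<And>z. z \<in> H \<Longrightarrow> inverse z \<in> H"
  shows "H = sphere 0 1"
proof
  show "sphere 0 1 \<subseteq> H"
  proof
    fix u :: complex assume u: "u \<in> sphere 0 1"
    have "\<exists>z\<in>H. dist z u < e" if e: "e > 0" for e
    proof -
      \<comment> \<open>Continuity of \<open>Arg\<close> at 1 turns closeness of \<open>h\<close> to
        1 into a small step along the circle.\<close>
      have "isCont Arg 1" by (rule continuous_at_Arg) simp
      then have "\<exists>d>0. \<forall>h. dist h 1 < d \<longrightarrow> dist (Arg h) (Arg 1) < e"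
        using e unfolding continuous_at_eps_delta dist_norm by blast
      then obtain d where d: "d > 0" "\<And>h. dist h 1 < d \<Longrightarrow> \<bar>Arg h\<bar> < e"
        by (auto simp: dist_real_def)
      obtain x where x: "x islimpt H"
        using Heine_Borel_imp_Bolzano_Weierstrass[OF compact_sphere inf sub] by blast
      then have "infinite (H \<inter> ball x (d / 2))" using d(1) unfolding islimpt_eq_infinite_ball by simp
      then have "\<exists>z w. z \<in> H \<inter> ball x (d / 2) \<and> w \<in> H \<inter> ball x (d / 2) \<and> z \<noteq> w"
        by (metis finite.emptyI finite.insertI finite_subset insertI1 subsetI)
      then obtain z w where zw: "z \<in> H" "w \<in> H" "z \<noteq> w" "dist z x < d / 2" "dist w x < d / 2"
        by (auto simp: dist_commute)
      define h where "h = z * inverse w"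
      have h: "h \<in> H" using zw mult inv by (simp add: h_def)
      have w1: "norm w = 1" and z1: "norm z = 1" and h1: "norm h = 1" using zw h sub by auto
      have "w \<noteq> 0" using w1 by auto
      have hn: "h \<noteq> 1" using zw \<open>w \<noteq> 0\<close> by (auto simp: h_def field_simps)
      have "dist h 1 = norm ((z - w) * inverse w)" using \<open>w \<noteq> 0\<close> by (simp add: h_def dist_norm field_simps)
      also have "\<dots> = dist z w" by (simp add: norm_mult norm_inverse w1 dist_norm)
      also have "\<dots> < d" using zw(4,5) dist_triangle2[of z w x] by linarith
      finally have th: "\<bar>Arg h\<bar> < e" by (rule d(2))
      define t where "t = Arg h"
      have "h \<noteq> 0" using h1 by auto
      then have ht: "h = cis t" using h1 cis_Arg[of h] by (simp add: t_def sgn_div_norm)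
      have t0: "t \<noteq> 0" using hn ht by auto
      have "u \<noteq> 0" using u by auto
      then have ua: "u = cis (Arg u)" using u cis_Arg[of u] by (simp add: sgn_div_norm)
      \<comment> \<open>The multiple \<open>k * t\<close> differs from \<open>Arg u\<close> by at
        most one step; \<open>t\<close>, and so \<open>k\<close>, may be negative.\<close>
      define k where "k = \<lfloor>Arg u / t\<rfloor>"
      have "0 \<le> Arg u / t - k" "Arg u / t - k < 1" unfolding k_def by linarith+
      then have "\<bar>Arg u / t - k\<bar> * \<bar>t\<bar> \<le> 1 * \<bar>t\<bar>" by (intro mult_right_mono) auto
      moreover have "(Arg u / t - k) * t = Arg u - k * t" using t0 by (simp add: field_simps)
      ultimately have "\<bar>Arg u - k * t\<bar> \<le> \<bar>t\<bar>" by (metis abs_mult mult_1)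
      then have le: "\<bar>k * t - Arg u\<bar> < e" using th by (simp add: abs_minus_commute t_def)
      have nat: "h ^ m \<in> H" for m
      proof (induction m)
        case 0
        then show ?case using mult[OF h inv[OF h]] \<open>h \<noteq> 0\<close> by simp
      qed (simp add: mult h)
      have "cis (k * t) \<in> H"
      proof (cases "k \<ge> 0")
        case True
        then have "cis (k * t) = h ^ nat k" unfolding ht Complex.DeMoivre by simp
        then show ?thesis using nat by simp
      next
        case False
        then have "cis (k * t) = inverse (h ^ nat (- k))" unfolding ht Complex.DeMoivre cis_inverse by simp
        then show ?thesis using nat inv by simp
      qed
      \<comment> \<open>A chord is no longer than its arc.\<close>
      moreover have "dist (cis (k * t)) u \<le> \<bar>k * t - Arg u\<bar>"
      proof -
        let ?x = "k * t - Arg u"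
        have "dist (cis (k * t)) u = norm (cis (Arg u) * (cis ?x - 1))"
          by (subst ua) (simp add: dist_norm right_diff_distrib cis_mult)
        also have "\<dots> = dist (exp (\<i> * ?x)) 1" by (simp add: norm_mult dist_norm cis_conv_exp)
        also have "\<dots> = 2 * \<bar>sin (?x / 2)\<bar>" unfolding dist_norm by (rule dist_exp_i_1)
        also have "\<dots> \<le> \<bar>?x\<bar>" using abs_sin_x_le_abs_x[of "?x / 2"] by simp
        finally show ?thesis .
      qed
      ultimately show ?thesis using le by (intro bexI[of _ "cis (k * t)"]) auto
    qed
    then show "u \<in> H" using cl closure_approachable[of u H] by (simp add: closure_closed)
  qed
qed (use sub in auto)

definition circ :: "(nat \<Rightarrow> real) set"
  where "circ = {w \<in> Rn 2. w 0 * w 0 + w 1 * w 1 = 1}"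

definition to_c :: "(nat \<Rightarrow> real) \<Rightarrow> complex"
  where "to_c w = Complex (w 0) (w 1)"

lemma bij_betw_to_c: "bij_betw to_c circ (sphere 0 1)"
proof (rule bij_betw_byWitness[where f' = "\<lambda>z. pt2 (Re z) (Im z)"])
  show "\<forall>w\<in>circ. pt2 (Re (to_c w)) (Im (to_c w)) = w"
    by (auto simp: circ_def to_c_def Rn_iff fun_eq_iff fun_upd_def numeral_2_eq_2)
  show "\<forall>z\<in>sphere 0 1. to_c (pt2 (Re z) (Im z)) = z"
    by (auto simp: to_c_def fun_upd_apply)
  show "to_c ` circ \<subseteq> sphere 0 1"
    by (auto simp: circ_def to_c_def cmod_def power2_eq_square)
  show "(\<lambda>z. pt2 (Re z) (Im z)) ` sphere 0 1 \<subseteq> circ"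
    using pt2_in by (auto simp: circ_def cmod_def power2_eq_square numeral_2_eq_2[symmetric] fun_upd_apply)
qed

section \<open>Level sets of constructible functions, finite sets and the circle\<close>

context o_minimal_structure
begin

lemma constructible_pair_int:
  "constructible (n + m) f \<Longrightarrow> constructible n (\<lambda>x. euler_int m (\<lambda>y. f (pair_pt n x y)))"
proof (induction m arbitrary: f)
  case 0
  then show ?case by (auto intro: constructible.agree simp: pair_pt_zero)
next
  case (Suc m)
  have f: "constructible (Suc (n + m)) f" using Suc.prems by simp
  from Suc.IH[OF constructible_line_int(2)[OF f]] show ?case by (simp add: pair_pt_upd)
qed

text \<open>Applied to the Euler characteristic of the stabilizer, this leaves finitely many orders
  of stabilizers and makes each class of points definable.\<close>

lemma constructible_levels:
  assumes "constructible n f"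
  shows "finite (f ` Rn n)" "{x \<in> Rn n. f x = c} \<in> D n"
proof -
  have "finite (f ` Rn n) \<and> (\<forall>c. {x \<in> Rn n. f x = c} \<in> D n)"
    using assms
  proof (induction rule: constructible.induct)
    case (indicat A)
    have "(\<lambda>x. of_bool (x \<in> A)) ` Rn n \<subseteq> {0, 1::int}" by auto
    moreover have "{x \<in> Rn n. of_bool (x \<in> A) = c} \<in> D n" for c :: int
    proof -
      have "{x \<in> Rn n. of_bool (x \<in> A) = c} = (if c = 1 then A else if c = 0 then Rn n - A else {})"
        using definable_subset[OF indicat] by auto
      then show ?thesis using indicat by (simp add: definable_compl)
    qed
    ultimately show ?case using finite_subset by blast
  next
    case (add f g)
    have "(\<lambda>x. f x + g x) ` Rn n \<subseteq> (\<lambda>(a, b). a + b) ` (f ` Rn n \<times> g ` Rn n)" by auto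
    then have "finite ((\<lambda>x. f x + g x) ` Rn n)" using add.IH finite_subset by blast
    moreover have "{x \<in> Rn n. f x + g x = c} \<in> D n" for c
    proof -
      have "{x \<in> Rn n. f x + g x = c} = (\<Union>a\<in>f ` Rn n. {x \<in> Rn n. f x = a} \<inter> {x \<in> Rn n. g x = c - a})"
        by auto
      then show ?thesis using add.IH by (simp only:) (intro definable_UNION definable_Int, auto)
    qed
    ultimately show ?case by blast
  next
    case (cmult f k)
    have "(\<lambda>x. k * f x) ` Rn n = (\<lambda>a. k * a) ` (f ` Rn n)" by auto
    moreover have "{x \<in> Rn n. k * f x = c} \<in> D n" for c
    proof -
      have "{x \<in> Rn n. k * f x = c} = (\<Union>a\<in>{a \<in> f ` Rn n. k * a = c}. {x \<in> Rn n. f x = a})" by auto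
      then show ?thesis using cmult.IH by (simp only:) (intro definable_UNION, auto)
    qed
    ultimately show ?case using cmult.IH by simp
  next
    case (agree f g)
    have "g ` Rn n = f ` Rn n" "{x \<in> Rn n. g x = c} = {x \<in> Rn n. f x = c}" for c
      using agree.hyps(2) by (auto simp: image_iff)
    then show ?case using agree.IH by simp
  qed
  then show "finite (f ` Rn n)" "{x \<in> Rn n. f x = c} \<in> D n" by auto
qed

lemma definable_singleton: "a \<in> Rn n \<Longrightarrow> {a} \<in> D n"
proof -
  assume a: "a \<in> Rn n"
  have "{x \<in> Rn n. \<forall>i<n. x i = a i} \<in> D n" by (rule definable_Collect_Def) (intro def_intros)
  moreover have "{x \<in> Rn n. \<forall>i<n. x i = a i} = {a}"
    using a by (auto simp: Rn_iff fun_eq_iff) (metis not_le)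
  ultimately show ?thesis by simp
qed

lemma euler_int_singleton: "a \<in> Rn n \<Longrightarrow> euler_int n (\<lambda>x. of_bool (x = a)) = 1"
proof (induction n arbitrary: a)
  case 0
  then have "a = (\<lambda>_. 0)" by (auto simp: Rn_iff)
  then show ?case by simp
next
  case (Suc n)
  obtain b t where b: "a = b(n := t)" "b \<in> Rn n" using Suc.prems by (rule Rn_Suc_cases)
  have "euler_int (Suc n) (\<lambda>x. of_bool (x = a)) = euler_int n (\<lambda>x. of_bool (x = b))"
    unfolding euler_int.simps
  proof (rule euler_int_cong)
    fix x assume x: "x \<in> Rn n"
    show "line_int (\<lambda>s. of_bool (x(n := s) = a)) = of_bool (x = b)"
      unfolding b(1) upd_eq_iff[OF x b(2)]
      using tame_point tame_zero by (cases "x = b") simp_all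
  qed
  then show ?case using Suc.IH[OF b(2)] by simp
qed

lemma euler_int_finite:
  assumes "finite F" "F \<subseteq> Rn n"
  shows "euler_int n (\<lambda>x. of_bool (x \<in> F)) = int (card F)"
proof -
  have "(of_bool (x \<in> F) :: int) = (\<Sum>a\<in>F. of_bool (x = a))" for x
    using assms(1) by (simp add: of_bool_def sum.delta)
  then have "euler_int n (\<lambda>x. of_bool (x \<in> F)) = euler_int n (\<lambda>x. \<Sum>a\<in>F. of_bool (x = a))" by simp
  also have "\<dots> = (\<Sum>a\<in>F. euler_int n (\<lambda>x. of_bool (x = a)))"
  proof (rule euler_int_sum[OF assms(1)])
    fix a assume "a \<in> F"
    then have "{a} \<in> D n" using assms definable_singleton by blast
    from constructible.indicat[OF this] show "constructible n (\<lambda>x. of_bool (x = a))" by simp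
  qed
  also have "\<dots> = (\<Sum>a\<in>F. 1)" using assms(2) euler_int_singleton by (intro sum.cong) auto
  finally show ?thesis by simp
qed

lemma definable_circ: "circ \<in> D 2"
  unfolding circ_def by (rule definable_Collect_Def) (intro def_intros)

text \<open>Over each point of \<open>{-1<..<1}\<close> lie two points of the circle, over each end
  one: \<open>2 * (-1) + 1 + 1 = 0\<close>.\<close>

lemma euler_int_circ: "euler_int 2 (\<lambda>w. of_bool (w \<in> circ)) = 0"
proof -
  have mem: "pt2 s t \<in> circ \<longleftrightarrow> s * s + t * t = 1" for s t
    using pt2_in by (simp add: circ_def numeral_2_eq_2 fun_upd_apply)
  have inner: "line_int (\<lambda>t. of_bool (s * s + t * t = 1)) =
      2 * of_bool (s \<in> {-1<..<1}) + (of_bool (s = 1) + of_bool (s = -1))" for s :: real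
  proof -
    have ss: "s * s < 1 \<longleftrightarrow> s \<in> {-1<..<1}" "s * s = 1 \<longleftrightarrow> s = 1 \<or> s = -1"
      using abs_square_less_1[of s] square_eq_1_iff[of s] by (auto simp: power2_eq_square abs_less_iff)
    consider "s * s < 1" | "s * s = 1" | "s * s > 1" by linarith
    then show ?thesis
    proof cases
      case 1
      let ?r = "sqrt (1 - s * s)"
      have r: "?r > 0" "?r * ?r = 1 - s * s" using 1 by auto
      have "s * s + t * t = 1 \<longleftrightarrow> t = ?r \<or> t = - ?r" for t
      proof -
        have "s * s + t * t = 1 \<longleftrightarrow> t * t = ?r * ?r" using r(2) by auto
        also have "\<dots> \<longleftrightarrow> t = ?r \<or> t = - ?r" by (rule square_eq_iff)
        finally show ?thesis .
      qed
      then have "(\<lambda>t. of_bool (s * s + t * t = 1)) = (\<lambda>t. of_bool (t = ?r) + of_bool (t = - ?r) :: int)"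
        using r(1) by (auto intro!: ext)
      then have "line_int (\<lambda>t. of_bool (s * s + t * t = 1)) = 2"
        using tame_add(2)[OF tame_point(1) tame_point(1)] tame_point(2) by simp
      then show ?thesis using 1 ss by auto
    next
      case 2
      then have "(\<lambda>t. of_bool (s * s + t * t = 1)) = (\<lambda>t. of_bool (t = 0) :: int)" by auto
      then show ?thesis using 2 ss tame_point(2) by auto
    next
      case 3
      have "s * s + t * t \<noteq> 1" for t using 3 zero_le_square[of t] by linarith
      then show ?thesis using 3 ss tame_zero(2) by auto
    qed
  qed
  have I: "open {-1<..<1::real}" "is_interval {-1<..<1::real}" "{-1<..<1::real} \<noteq> {}"
    by (auto simp: is_interval_oo)
  note t = tame_open_interval[OF I]
  have "euler_int 2 (\<lambda>w. of_bool (w \<in> circ)) =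
      line_int (\<lambda>s. 2 * of_bool (s \<in> {-1<..<1}) + (of_bool (s = 1) + of_bool (s = -1)))"
    by (simp only: numeral_2_eq_2 euler_int.simps mem inner)
  also have "\<dots> = 2 * (-1) + (1 + 1)"
    using tame_add(2)[OF tame_cmult(1)[OF t(1), of 2] tame_add(1)[OF tame_point(1) tame_point(1)], of 1 "-1"]
      tame_add(2)[OF tame_point(1) tame_point(1), of 1 "-1"] tame_cmult(2)[OF t(1), of 2] t(2) tame_point(2)
    by simp
  finally show ?thesis by simp
qed

end

text \<open>The action in coordinates. Group elements are complex numbers in \<open>a\<close> but
  points of the plane in the graph \<open>Gr\<close>, with \<open>to_c\<close> between them.
  Continuity in \<open>z\<close> makes stabilizers closed and lets coordinates attain minima along
  orbits.\<close>

locale definable_circle_action = o_minimal_structure D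
  for D :: "nat \<Rightarrow> (nat \<Rightarrow> real) set set" +
  fixes n :: nat and X :: "(nat \<Rightarrow> real) set" and a :: "complex \<Rightarrow> (nat \<Rightarrow> real) \<Rightarrow> nat \<Rightarrow> real"
    and Gr :: "(nat \<Rightarrow> real) set"
  assumes X: "X \<in> D n"
    and a_in: "z \<in> sphere 0 1 \<Longrightarrow> x \<in> X \<Longrightarrow> a z x \<in> X"
    and a_one: "x \<in> X \<Longrightarrow> a 1 x = x"
    and a_mult: "z \<in> sphere 0 1 \<Longrightarrow> z' \<in> sphere 0 1 \<Longrightarrow> x \<in> X \<Longrightarrow> a (z * z') x = a z (a z' x)"
    and a_cont: "x \<in> X \<Longrightarrow> continuous_on (sphere 0 1) (\<lambda>z. a z x i)"
    and Gr: "Gr \<in> D (2 + n + n)"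
    and Gr_iff: "w \<in> Rn 2 \<Longrightarrow> x \<in> Rn n \<Longrightarrow> y \<in> Rn n \<Longrightarrow>
      pair_pt (2 + n) (pair_pt 2 w x) y \<in> Gr \<longleftrightarrow> w \<in> circ \<and> x \<in> X \<and> y = a (to_c w) x"
begin

lemma X_sub: "X \<subseteq> Rn n"
  using X definable_subset by blast

definition gr :: "(nat \<Rightarrow> real) \<Rightarrow> (nat \<Rightarrow> real) \<Rightarrow> (nat \<Rightarrow> real) \<Rightarrow> bool"
  where "gr w x y \<longleftrightarrow> pair_pt (2 + n) (pair_pt 2 w x) y \<in> Gr"

lemma Def_gr [def_intros]:
  "poly_vec 2 w \<Longrightarrow> poly_vec n x \<Longrightarrow> poly_vec n y \<Longrightarrow> Def (\<lambda>e. gr (w e) (x e) (y e))"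
  unfolding gr_def by (rule Def_in[OF Gr]) (intro def_intros)

lemma gr_iff: "w \<in> Rn 2 \<Longrightarrow> x \<in> Rn n \<Longrightarrow> y \<in> Rn n \<Longrightarrow>
    gr w x y \<longleftrightarrow> w \<in> circ \<and> x \<in> X \<and> y = a (to_c w) x"
  unfolding gr_def by (rule Gr_iff)

lemma sphere_mult: "z \<in> sphere 0 1 \<Longrightarrow> w \<in> sphere 0 1 \<Longrightarrow> z * w \<in> sphere (0::complex) 1"
  by (simp add: norm_mult)

lemma sphere_inverse: "z \<in> sphere 0 1 \<Longrightarrow> inverse z \<in> sphere (0::complex) 1"
  by (simp add: norm_inverse)

lemma sphere_nonzero: "z \<in> sphere (0::complex) 1 \<Longrightarrow> z \<noteq> 0"
  by auto

lemma a_inverse: "z \<in> sphere 0 1 \<Longrightarrow> x \<in> X \<Longrightarrow> a (inverse z) (a z x) = x"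
  using a_mult[of "inverse z" z x] sphere_inverse[of z] sphere_nonzero[of z] a_one by simp

lemma a_commute: "z \<in> sphere 0 1 \<Longrightarrow> w \<in> sphere 0 1 \<Longrightarrow> x \<in> X \<Longrightarrow> a z (a w x) = a w (a z x)"
  using a_mult[of z w x] a_mult[of w z x] by (simp add: mult.commute)

definition Fx :: "(nat \<Rightarrow> real) set"
  where "Fx = {x \<in> X. \<forall>z\<in>sphere 0 1. a z x = x}"

lemma circ_sub: "w \<in> circ \<Longrightarrow> w \<in> Rn 2"
  by (simp add: circ_def)

lemma to_c_in: "w \<in> circ \<Longrightarrow> to_c w \<in> sphere 0 1"
  using bij_betw_to_c by (auto simp: bij_betw_def)

lemma to_c_surj: "z \<in> sphere 0 1 \<Longrightarrow> \<exists>w\<in>circ. to_c w = z"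
  using bij_betw_to_c by (auto simp: bij_betw_def image_iff) (metis imageE mem_sphere_0)

lemma Fx_definable: "Fx \<in> D n"
proof -
  have "Fx = {x \<in> Rn n. x \<in> X \<and> (\<forall>w\<in>Rn 2. w \<in> circ \<longrightarrow> gr w x x)}"
    using X_sub to_c_surj to_c_in circ_sub by (auto simp: Fx_def gr_iff subset_iff) (metis mem_sphere_0)+
  also have "\<dots> \<in> D n"
    by (rule definable_Collect, unfold restr_def) (intro def_intros Def_in[OF X] Def_in[OF definable_circ])
  finally show ?thesis .
qed

section \<open>Stabilizers and orbit representatives\<close>

definition stab :: "(nat \<Rightarrow> real) \<Rightarrow> (nat \<Rightarrow> real) set"
  where "stab x = {w \<in> Rn 2. gr w x x}"

lemma stab_eq: "x \<in> X \<Longrightarrow> stab x = {w \<in> circ. a (to_c w) x = x}"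
  using X_sub by (auto simp: stab_def gr_iff circ_def)

text \<open>The stabilizer is a closed subgroup of the circle, and not the whole circle.\<close>

lemma finite_stab:
  assumes x: "x \<in> X" "x \<notin> Fx" shows "finite (stab x)"
proof -
  define H where "H = {z \<in> sphere 0 1. a z x = x}"
  have "finite H"
  proof (rule ccontr)
    assume inf: "infinite H"
    have "H = (\<Inter>i. sphere 0 1 \<inter> (\<lambda>z. a z x i) -` {x i})" by (auto simp: H_def)
    moreover have "closed (sphere 0 1 \<inter> (\<lambda>z. a z x i) -` {x i})" for i
      by (rule continuous_closed_preimage[OF a_cont[OF x(1)]]) auto
    ultimately have cl: "closed H" by (simp only:) (intro closed_INT, blast)
    have "H = sphere 0 1"
    proof (rule closed_infinite_circle_subgroup[OF _ cl inf])
      fix z w assume "z \<in> H" "w \<in> H"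
      then show "z * w \<in> H" using a_mult[of z w x] sphere_mult x(1) by (auto simp: H_def norm_mult)
    next
      fix z assume "z \<in> H"
      then show "inverse z \<in> H" using a_inverse[of z x] x(1) by (auto simp: H_def norm_inverse)
    qed (auto simp: H_def)
    then show False using x by (auto simp: Fx_def H_def)
  qed
  moreover have "stab x = {w \<in> circ. to_c w \<in> H}"
    using to_c_in by (auto simp: stab_eq[OF x(1)] H_def)
  moreover have "inj_on to_c {w \<in> circ. to_c w \<in> H}"
    using bij_betw_to_c by (auto simp: bij_betw_def inj_on_def)
  ultimately show ?thesis using finite_imageD[of to_c "stab x"] finite_subset[of "to_c ` stab x" H] by auto
qed

lemma stab_nonempty: "x \<in> X \<Longrightarrow> stab x \<noteq> {}"
  using to_c_surj[of 1] a_one by (force simp: stab_eq)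

text \<open>Conjugation is trivial in a commutative group.\<close>

lemma stab_orbit: "x \<in> X \<Longrightarrow> z \<in> sphere 0 1 \<Longrightarrow> stab (a z x) = stab x"
proof -
  assume x: "x \<in> X" and z: "z \<in> sphere 0 1"
  have "a w (a z x) = a z x \<longleftrightarrow> a w x = x" if w: "w \<in> sphere 0 1" for w
  proof
    assume "a w (a z x) = a z x"
    then have "a z (a w x) = a z x" using a_commute[OF z w x] by simp
    then show "a w x = x" using a_inverse[OF z a_in[OF w x]] a_inverse[OF z x] by simp
  next
    assume "a w x = x"
    then show "a w (a z x) = a z x" using a_commute[OF w z x] by simp
  qed
  then show ?thesis
    unfolding stab_eq[OF x] stab_eq[OF a_in[OF z x]] using to_c_in by blast
qed

lemma Fx_orbit: "x \<in> X \<Longrightarrow> z \<in> sphere 0 1 \<Longrightarrow> a z x \<in> Fx \<Longrightarrow> x \<in> Fx"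
proof -
  assume x: "x \<in> X" and z: "z \<in> sphere 0 1" and "a z x \<in> Fx"
  then have "a (inverse z) (a z x) = a z x" using sphere_inverse[OF z] by (auto simp: Fx_def)
  then have "a z x = x" using a_inverse[OF z x] by simp
  then show "x \<in> Fx" using \<open>a z x \<in> Fx\<close> by simp
qed

text \<open>
  \<open>lex_least Y n\<close> picks from each orbit in \<open>Y\<close> its lexicographically least point, which exists since
  orbits are compact; \<open>lex_least Y i\<close> minimizes the first \<open>i\<close> coordinates.
\<close>

primrec lex_least :: "(nat \<Rightarrow> real) set \<Rightarrow> nat \<Rightarrow> (nat \<Rightarrow> real) set"
  where
    "lex_least Y 0 = Y"
  | "lex_least Y (Suc i) = {x \<in> lex_least Y i. \<forall>z\<in>sphere 0 1. a z x \<in> lex_least Y i \<longrightarrow> x i \<le> a z x i}"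

lemma lex_least_sub: "lex_least Y i \<subseteq> Y"
  by (induction i) auto

lemma lex_least_definable:
  assumes "Y \<in> D n" "Y \<subseteq> X" shows "lex_least Y i \<in> D n"
proof (induction i)
  case (Suc i)
  have sub: "lex_least Y i \<subseteq> X" using lex_least_sub assms by blast
  have "lex_least Y (Suc i) = {x \<in> Rn n. x \<in> lex_least Y i \<and>
    (\<forall>w\<in>Rn 2. \<forall>y\<in>Rn n. gr w x y \<and> y \<in> lex_least Y i \<longrightarrow> x i \<le> y i)}" (is "?L = ?R")
  proof
    show "?L \<subseteq> ?R" using sub X_sub to_c_in by (auto simp: gr_iff subset_iff)
    show "?R \<subseteq> ?L"
    proof
      fix x assume x: "x \<in> ?R"
      have "x i \<le> a z x i" if z: "z \<in> sphere 0 1" "a z x \<in> lex_least Y i" for z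
      proof -
        obtain w where w: "w \<in> circ" "to_c w = z" using to_c_surj[OF z(1)] by blast
        have "gr w x (a z x)" using w x sub X_sub z circ_sub by (auto simp: gr_iff subset_iff)
        then show ?thesis using x w z(2) circ_sub sub X_sub by blast
      qed
      then show "x \<in> ?L" using x by simp
    qed
  qed
  also have "\<dots> \<in> D n"
    by (rule definable_Collect, unfold restr_def) (intro def_intros Def_in[OF Suc])
  finally show ?case .
qed (use assms in simp)

text \<open>Minimization takes place in the group: \<open>K i\<close> consists of the elements that
  carry \<open>y\<close> into \<open>lex_least Y i\<close>. Compactness of the circle and continuity
  of one coordinate of \<open>a z y\<close> in \<open>z\<close> give a nonempty compact set of
  minimizers at every stage.\<close>

lemma lex_least_orbit:
  assumes Y: "Y \<subseteq> X" "\<And>x z. x \<in> Y \<Longrightarrow> z \<in> sphere 0 1 \<Longrightarrow> a z x \<in> Y" and y: "y \<in> Y"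
  defines "K \<equiv> \<lambda>i. {z \<in> sphere 0 1. a z y \<in> lex_least Y i}"
  shows "compact (K i) \<and> K i \<noteq> {} \<and> (\<forall>z\<in>K i. \<forall>w\<in>K i. \<forall>j<i. a z y j = a w y j)"
proof (induction i)
  case 0
  have "K 0 = sphere 0 1" using Y y by (auto simp: K_def)
  moreover have "(1::complex) \<in> sphere 0 1" by simp
  ultimately show ?case using compact_sphere by (metis empty_iff not_less_zero)
next
  case (Suc i)
  have yX: "y \<in> X" using y Y by blast
  have cont: "continuous_on (K i) (\<lambda>z. a z y i)"
    by (rule continuous_on_subset[OF a_cont[OF yX]]) (auto simp: K_def)
  obtain m where m: "m \<in> K i" "\<forall>w\<in>K i. a m y i \<le> a w y i"
    using continuous_attains_inf[OF _ _ cont] Suc by blast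
  have K: "K (Suc i) = {z \<in> K i. \<forall>w\<in>K i. a z y i \<le> a w y i}" (is "_ = ?R")
  proof
    show "K (Suc i) \<subseteq> ?R"
    proof
      fix z assume z: "z \<in> K (Suc i)"
      then have zs: "z \<in> sphere 0 1" "z \<in> K i" by (auto simp: K_def)
      have "a z y i \<le> a w y i" if w: "w \<in> K i" for w
      proof -
        \<comment> \<open>This element carries \<open>a z y\<close> to \<open>a w y\<close>, so
          comparing along the orbit of \<open>a z y\<close> amounts to comparing over
          \<open>K i\<close>.\<close>
        let ?u = "w * inverse z"
        have ws: "w \<in> sphere 0 1" using w by (simp add: K_def)
        have u: "?u \<in> sphere 0 1" using sphere_mult[OF ws sphere_inverse[OF zs(1)]] .
        have uz: "?u * z = w" using sphere_nonzero[OF zs(1)] by simp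
        have "a ?u (a z y) = a w y" using a_mult[OF u zs(1) yX] unfolding uz by simp
        moreover have "a w y \<in> lex_least Y i" using w by (simp add: K_def)
        moreover have "\<forall>u\<in>sphere 0 1. a u (a z y) \<in> lex_least Y i \<longrightarrow> a z y i \<le> a u (a z y) i"
          using z by (simp add: K_def)
        ultimately show ?thesis using u by metis
      qed
      then show "z \<in> ?R" using zs by blast
    qed
    show "?R \<subseteq> K (Suc i)"
    proof
      fix z assume z: "z \<in> ?R"
      then have zs: "z \<in> sphere 0 1" by (simp add: K_def)
      have "a z y i \<le> a u (a z y) i" if "u \<in> sphere 0 1" "a u (a z y) \<in> lex_least Y i" for u
        using that z a_mult[OF that(1) zs yX] sphere_mult[OF that(1) zs] by (auto simp: K_def)
      then show "z \<in> K (Suc i)" using z by (auto simp: K_def)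
    qed
  qed
  \<comment> \<open>As a sublevel set at the minimum, the set of minimizers is closed.\<close>
  have K': "K (Suc i) = K i \<inter> (\<lambda>z. a z y i) -` {..a m y i}"
    unfolding K using m by (auto intro: order_trans)
  have "closed (K (Suc i))"
    unfolding K' using Suc by (intro continuous_closed_preimage[OF cont]) (auto intro: compact_imp_closed)
  then have "compact (K i \<inter> K (Suc i))" using Suc by (intro compact_Int_closed) auto
  moreover have "K i \<inter> K (Suc i) = K (Suc i)" using K by blast
  ultimately have "compact (K (Suc i))" by (simp only:)
  moreover have "K (Suc i) \<noteq> {}" using m K by blast
  moreover have "\<forall>z\<in>K (Suc i). \<forall>w\<in>K (Suc i). \<forall>j<Suc i. a z y j = a w y j"
  proof (intro ballI allI impI)
    fix z w j assume zw: "z \<in> K (Suc i)" "w \<in> K (Suc i)" and j: "j < Suc i"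
    have R: "z \<in> K i" "w \<in> K i" "a z y i \<le> a w y i" "a w y i \<le> a z y i"
      using zw unfolding K by blast+
    show "a z y j = a w y j"
    proof (cases "j = i")
      case True
      then show ?thesis using R by simp
    next
      case False
      then show ?thesis using Suc R j by (metis less_antisym)
    qed
  qed
  ultimately show ?case by blast
qed

lemma lex_least_unique:
  assumes Y: "Y \<subseteq> X" "\<And>x z. x \<in> Y \<Longrightarrow> z \<in> sphere 0 1 \<Longrightarrow> a z x \<in> Y" and y: "y \<in> Y"
  obtains z where "z \<in> sphere 0 1" "a z y \<in> lex_least Y n"
    "\<And>w. w \<in> sphere 0 1 \<Longrightarrow> a w y \<in> lex_least Y n \<Longrightarrow> a w y = a z y"
proof -
  note L = lex_least_orbit[OF Y y, of n]
  then obtain z where z: "z \<in> sphere 0 1" "a z y \<in> lex_least Y n" by blast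
  show ?thesis
  proof (rule that[OF z])
    fix w assume w: "w \<in> sphere 0 1" "a w y \<in> lex_least Y n"
    have "a w y i = a z y i" for i
    proof (cases "i < n")
      case True
      then show ?thesis using L z w by blast
    next
      case False
      have "a w y \<in> Rn n" "a z y \<in> Rn n" using z w lex_least_sub Y X_sub by blast+
      then show ?thesis using False by (simp add: Rn_iff)
    qed
    then show "a w y = a z y" by blast
  qed
qed

text \<open>For fixed \<open>y\<close> in \<open>Y\<close>, \<open>s\<close> must be the
  representative of the orbit of \<open>y\<close>, and the \<open>g\<close> with
  \<open>g s = y\<close> form a coset of the stabilizer, so there are \<open>c\<close> pairs. For
  fixed \<open>s\<close> in \<open>S\<close> and \<open>g\<close> there is exactly one
  \<open>y\<close>.\<close>

lemma euler_int_constant_stab: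
  assumes YD: "Y \<in> D n" and YX: "Y \<subseteq> X - Fx" and inv: "\<And>x z. x \<in> Y \<Longrightarrow> z \<in> sphere 0 1 \<Longrightarrow> a z x \<in> Y"
    and c: "\<And>x. x \<in> Y \<Longrightarrow> card (stab x) = c" and c0: "c \<noteq> 0"
  shows "euler_int n (\<lambda>x. of_bool (x \<in> Y)) = 0"
proof -
  define S where "S = lex_least Y n"
  have YX': "Y \<subseteq> X" using YX by blast
  have S: "S \<in> D n" "S \<subseteq> Y" using lex_least_definable[OF YD YX'] lex_least_sub by (auto simp: S_def)
  \<comment> \<open>Coordinates are ordered as \<open>y\<close>, \<open>s\<close>, \<open>g\<close>,
    so that \<open>fubini\<close> separates \<open>y\<close> from the pair and
    \<open>euler_int_pair\<close> then splits the pair.\<close>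
  define \<Gamma> where "\<Gamma> = {p \<in> Rn (n + (n + 2)). restr n (\<lambda>i. p (n + i)) \<in> S \<and>
    gr (restr 2 (\<lambda>i. p (n + (n + i)))) (restr n (\<lambda>i. p (n + i))) (restr n p)}"
  have \<Gamma>: "\<Gamma> \<in> D (n + (n + 2))"
    unfolding \<Gamma>_def by (rule definable_Collect_Def) (intro def_intros Def_in[OF S(1)])
  have mem: "pair_pt n y (pair_pt n s w) \<in> \<Gamma> \<longleftrightarrow> s \<in> S \<and> w \<in> circ \<and> y = a (to_c w) s"
    if "y \<in> Rn n" "s \<in> Rn n" "w \<in> Rn 2" for y s w
  proof -
    have e: "restr n (\<lambda>i. pair_pt n y (pair_pt n s w) (n + i)) = s"
      "restr 2 (\<lambda>i. pair_pt n y (pair_pt n s w) (n + (n + i))) = w"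
      "restr n (pair_pt n y (pair_pt n s w)) = y"
      using that by (auto simp: pair_pt_def restr_def Rn_iff fun_eq_iff)
    have R: "pair_pt n y (pair_pt n s w) \<in> Rn (n + (n + 2))"
      using that by (intro pair_pt_in)
    have "pair_pt n y (pair_pt n s w) \<in> \<Gamma> \<longleftrightarrow> s \<in> S \<and> gr w s y"
      by (simp only: \<Gamma>_def mem_Collect_eq e R simp_thms)
    then show ?thesis using S YX' gr_iff[OF that(3,2,1)] by blast
  qed
  define f where "f p = (of_bool (p \<in> \<Gamma>) :: int)" for p
  have f: "constructible (n + (n + 2)) f" unfolding f_def by (rule constructible.indicat[OF \<Gamma>])
  have "euler_int (n + 2) (\<lambda>q. f (pair_pt n y q)) = int c * of_bool (y \<in> Y)" if y: "y \<in> Rn n" for y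
  proof -
    define F where "F = {q \<in> Rn (n + 2). pair_pt n y q \<in> \<Gamma>}"
    have eq: "euler_int (n + 2) (\<lambda>q. f (pair_pt n y q)) = euler_int (n + 2) (\<lambda>q. of_bool (q \<in> F))"
      by (rule euler_int_cong) (simp add: f_def F_def)
    have F: "F = {pair_pt n s w | s w. s \<in> S \<and> w \<in> circ \<and> y = a (to_c w) s}" (is "_ = ?R")
    proof
      show "F \<subseteq> ?R"
      proof
        fix q assume q: "q \<in> F"
        then have qR: "q \<in> Rn (n + 2)" by (simp add: F_def)
        have sp: "q = pair_pt n (restr n q) (\<lambda>i. q (n + i))" using pair_pt_split[OF qR] by simp
        have "(\<lambda>i. q (n + i)) \<in> Rn 2" using qR by (auto simp: Rn_iff)
        then show "q \<in> ?R" using mem[OF y restr_in, of "\<lambda>i. q (n + i)" q] q sp by (auto simp: F_def)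
      qed
      show "?R \<subseteq> F"
      proof
        fix q assume "q \<in> ?R"
        then obtain s w where q: "q = pair_pt n s w" "s \<in> S" "w \<in> circ" "y = a (to_c w) s" by blast
        have sw: "s \<in> Rn n" "w \<in> Rn 2" using q S YX' X_sub circ_sub by blast+
        show "q \<in> F" unfolding F_def mem_Collect_eq q(1)
          using mem[OF y sw] q pair_pt_in[OF sw(2)] by blast
      qed
    qed
    show ?thesis
    proof (cases "y \<in> Y")
      case False
      then have "F = {}" using F S(2) inv to_c_in by blast
      then show ?thesis using eq False euler_int_zero by simp
    next
      case True
      have yX: "y \<in> X" using True YX' by blast
      obtain z where z: "z \<in> sphere 0 1" "a z y \<in> S"
        "\<And>w. w \<in> sphere 0 1 \<Longrightarrow> a w y \<in> S \<Longrightarrow> a w y = a z y"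
        using lex_least_unique[OF YX' inv True] unfolding S_def by blast
      define s where "s = a z y"
      have "s \<in> S" using z(2) by (simp add: s_def)
      then have s: "s \<in> S" "s \<in> X" "s \<in> Y" using S YX' by blast+
      have ys: "y = a (inverse z) s" using a_inverse[OF z(1) yX] by (simp add: s_def)
      have "F = (\<lambda>w. pair_pt n s w) ` {w \<in> circ. y = a (to_c w) s}" (is "_ = ?I")
      proof
        show "F \<subseteq> ?I"
        proof
          fix q assume "q \<in> F"
          then obtain s' w where q: "q = pair_pt n s' w" "s' \<in> S" "w \<in> circ" "y = a (to_c w) s'" using F by blast
          then have "s' = a (inverse (to_c w)) y" using a_inverse[OF to_c_in[OF q(3)]] S YX' by auto
          then have "s' = s" using z(3)[OF sphere_inverse[OF to_c_in[OF q(3)]]] q(2) by (simp add: s_def)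
          then show "q \<in> ?I" using q by blast
        qed
        show "?I \<subseteq> F" using F s by blast
      qed
      moreover have "inj_on (\<lambda>w. pair_pt n s w) {w \<in> circ. y = a (to_c w) s}"
      proof (rule inj_onI, rule ext)
        fix v w i assume "pair_pt n s v = pair_pt n s w"
        from fun_cong[OF this, of "n + i"] show "v i = w i" by (simp add: pair_pt_def)
      qed
      ultimately have cF: "card F = card {w \<in> circ. y = a (to_c w) s}" by (simp add: card_image)
      have b1: "bij_betw to_c {w \<in> circ. P (to_c w)} {g \<in> sphere 0 1. P g}" for P
        using bij_betw_to_c unfolding bij_betw_def inj_on_def by (auto simp: image_iff)
      \<comment> \<open>The coset: \<open>inverse z\<close> carries \<open>s\<close> to
        \<open>y\<close>, and its products with the stabilizer are all the elements that do.\<close>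
      have b2: "bij_betw (\<lambda>g. g * inverse z) {g \<in> sphere 0 1. a g s = s} {g \<in> sphere 0 1. y = a g s}"
      proof (rule bij_betw_byWitness[where f' = "\<lambda>g. g * z"])
        have z0: "z \<noteq> 0" using sphere_nonzero[OF z(1)] .
        show "\<forall>g\<in>{g \<in> sphere 0 1. a g s = s}. g * inverse z * z = g" using z0 by simp
        show "\<forall>g\<in>{g \<in> sphere 0 1. y = a g s}. g * z * inverse z = g" using z0 by simp
        have iz: "inverse z \<in> sphere 0 1" using sphere_inverse[OF z(1)] .
        show "(\<lambda>g. g * inverse z) ` {g \<in> sphere 0 1. a g s = s} \<subseteq> {g \<in> sphere 0 1. y = a g s}"
        proof (rule image_subsetI)
          fix g assume "g \<in> {g \<in> sphere 0 1. a g s = s}"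
          then have g: "g \<in> sphere 0 1" "a g s = s" by auto
          have "a (g * inverse z) s = a (inverse z) (a g s)"
            using a_mult[OF g(1) iz s(2)] a_commute[OF g(1) iz s(2)] by simp
          then show "g * inverse z \<in> {g \<in> sphere 0 1. y = a g s}"
            using g ys sphere_mult[OF g(1) iz] by simp
        qed
        show "(\<lambda>g. g * z) ` {g \<in> sphere 0 1. y = a g s} \<subseteq> {g \<in> sphere 0 1. a g s = s}"
        proof (rule image_subsetI)
          fix g assume "g \<in> {g \<in> sphere 0 1. y = a g s}"
          then have g: "g \<in> sphere 0 1" "y = a g s" by auto
          have "a (g * z) s = a z y"
            using a_mult[OF g(1) z(1) s(2)] a_commute[OF g(1) z(1) s(2)] unfolding g(2) by simp
          then show "g * z \<in> {g \<in> sphere 0 1. a g s = s}"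
            using sphere_mult[OF g(1) z(1)] by (simp add: s_def)
        qed
      qed
      have "card {w \<in> circ. y = a (to_c w) s} = card {g \<in> sphere 0 1. y = a g s}"
        using bij_betw_same_card[OF b1[of "\<lambda>g. y = a g s"]] .
      also have "\<dots> = card {g \<in> sphere 0 1. a g s = s}" using bij_betw_same_card[OF b2] by simp
      also have "\<dots> = card (stab s)"
        using bij_betw_same_card[OF b1[of "\<lambda>g. a g s = s"]] stab_eq[OF s(2)] by simp
      finally have "card F = c" using cF c s by simp
      \<comment> \<open>\<open>card\<close> is 0 on infinite sets, so \<open>c \<noteq> 0\<close>
        yields finiteness.\<close>
      moreover then have "finite F" using c0 by (metis card.infinite)
      moreover have "F \<subseteq> Rn (n + 2)" by (auto simp: F_def)
      ultimately show ?thesis using eq euler_int_finite[of F "n + 2"] True by simp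
    qed
  qed
  then have "euler_int n (\<lambda>y. euler_int (n + 2) (\<lambda>q. f (pair_pt n y q))) =
      euler_int n (\<lambda>y. int c * of_bool (y \<in> Y))"
    by (rule euler_int_cong)
  also have "\<dots> = int c * euler_int n (\<lambda>y. of_bool (y \<in> Y))"
    by (rule euler_int_cmult[OF constructible.indicat[OF YD]])
  finally have L: "euler_int n (\<lambda>y. euler_int (n + 2) (\<lambda>q. f (pair_pt n y q))) =
      int c * euler_int n (\<lambda>y. of_bool (y \<in> Y))" .
  have inner: "euler_int n (\<lambda>y. f (pair_pt n y (pair_pt n s w))) = of_bool (w \<in> circ) * of_bool (s \<in> S)"
    if sw: "s \<in> Rn n" "w \<in> Rn 2" for s w
  proof (cases "s \<in> S \<and> w \<in> circ")
    case True
    have aR: "a (to_c w) s \<in> Rn n" using True S(2) YX' X_sub a_in to_c_in by blast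
    have "euler_int n (\<lambda>y. f (pair_pt n y (pair_pt n s w))) = euler_int n (\<lambda>y. of_bool (y = a (to_c w) s))"
      by (rule euler_int_cong) (use mem sw True in \<open>auto simp: f_def\<close>)
    then show ?thesis using euler_int_singleton[OF aR] True by simp
  next
    case False
    have "euler_int n (\<lambda>y. f (pair_pt n y (pair_pt n s w))) = euler_int n (\<lambda>y. 0)"
      by (rule euler_int_cong) (use mem sw False in \<open>auto simp: f_def\<close>)
    then show ?thesis using euler_int_zero False by auto
  qed
  have "euler_int (n + 2) (\<lambda>q. euler_int n (\<lambda>y. f (pair_pt n y q))) =
      euler_int n (\<lambda>s. euler_int 2 (\<lambda>w. euler_int n (\<lambda>y. f (pair_pt n y (pair_pt n s w)))))"
    by (rule euler_int_pair)
  also have "\<dots> = euler_int n (\<lambda>s. 0)"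
  proof (rule euler_int_cong)
    fix s assume s: "s \<in> Rn n"
    have "euler_int 2 (\<lambda>w. euler_int n (\<lambda>y. f (pair_pt n y (pair_pt n s w)))) =
        euler_int 2 (\<lambda>w. of_bool (s \<in> S) * of_bool (w \<in> circ))"
      by (rule euler_int_cong) (simp add: inner[OF s] mult.commute)
    also have "\<dots> = of_bool (s \<in> S) * euler_int 2 (\<lambda>w. of_bool (w \<in> circ))"
      by (rule euler_int_cmult[OF constructible.indicat[OF definable_circ]])
    finally show "euler_int 2 (\<lambda>w. euler_int n (\<lambda>y. f (pair_pt n y (pair_pt n s w)))) = 0"
      by (simp add: euler_int_circ)
  qed
  finally have "int c * euler_int n (\<lambda>y. of_bool (y \<in> Y)) = 0"
    using fubini[OF f] L euler_int_zero by simp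
  then show ?thesis using c0 by simp
qed

text \<open>The classes \<open>Y c\<close> of non-fixed points are level sets of the constructible
  function \<open>k\<close>, hence definable and finite in number. They are invariant, so
  \<open>euler_int_constant_stab\<close> removes each of them.\<close>

theorem euler_int_fixed_points:
  "euler_int n (\<lambda>x. of_bool (x \<in> X)) = euler_int n (\<lambda>x. of_bool (x \<in> Fx))"
proof -
  define k where "k x = euler_int 2 (\<lambda>w. of_bool (w \<in> stab x))" for x
  define A where "A = {p \<in> Rn (n + 2). gr (restr 2 (\<lambda>i. p (n + i))) (restr n p) (restr n p)}"
  have A: "A \<in> D (n + 2)"
    unfolding A_def by (rule definable_Collect_Def) (intro def_intros)
  have k: "constructible n k"
  proof (rule constructible.agree[OF constructible_pair_int[OF constructible.indicat[OF A]]])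
    fix x assume x: "x \<in> Rn n"
    show "euler_int 2 (\<lambda>y. of_bool (pair_pt n x y \<in> A)) = k x"
      unfolding k_def
    proof (rule euler_int_cong)
      fix y assume y: "y \<in> Rn 2"
      have "restr 2 (\<lambda>i. pair_pt n x y (n + i)) = y" "restr n (pair_pt n x y) = x"
        using x y by (auto simp: pair_pt_def restr_def Rn_iff fun_eq_iff)
      then show "of_bool (pair_pt n x y \<in> A) = (of_bool (y \<in> stab x) :: int)"
        using y pair_pt_in[OF y, of n x] by (simp add: A_def stab_def)
    qed
  qed
  \<comment> \<open>Outside \<open>Fx\<close> the stabilizer is finite, so its Euler characteristic
    is its order.\<close>
  have kc: "k x = int (card (stab x))" if "x \<in> X - Fx" for x
    unfolding k_def using that by (intro euler_int_finite finite_stab) (auto simp: stab_def)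
  define V where "V = k ` Rn n"
  have V: "finite V" unfolding V_def using constructible_levels(1)[OF k] .
  define Y where "Y c = (X - Fx) \<inter> {x \<in> Rn n. k x = c}" for c
  have YD: "Y c \<in> D n" for c
    unfolding Y_def by (intro definable_Int definable_Diff X Fx_definable constructible_levels(2)[OF k])
  have Y0: "euler_int n (\<lambda>x. of_bool (x \<in> Y c)) = 0" for c
  proof (cases "Y c = {}")
    case True
    then show ?thesis using euler_int_zero by simp
  next
    case False
    then obtain y where y: "y \<in> Y c" by blast
    then have yX: "y \<in> X - Fx" "k y = c" by (auto simp: Y_def)
    have card: "card (stab x) = nat c" if "x \<in> Y c" for x
      using kc[of x] that by (auto simp: Y_def)
    have "card (stab y) \<noteq> 0" using yX finite_stab stab_nonempty by auto
    then have "nat c \<noteq> 0" using card[OF y] by simp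
    moreover have "a z x \<in> Y c" if "x \<in> Y c" "z \<in> sphere 0 1" for x z
    proof -
      have x: "x \<in> X" "x \<notin> Fx" "k x = c" using that by (auto simp: Y_def)
      then have "a z x \<in> X" "a z x \<notin> Fx" "k (a z x) = c"
        using a_in[OF that(2)] Fx_orbit[OF _ that(2)] stab_orbit[OF _ that(2)] by (auto simp: k_def)
      then show ?thesis using X_sub by (auto simp: Y_def)
    qed
    ultimately show ?thesis
      using card by (intro euler_int_constant_stab[OF YD]) (auto simp: Y_def)
  qed
  have "(of_bool (x \<in> X) :: int) = of_bool (x \<in> Fx) + (\<Sum>c\<in>V. of_bool (x \<in> Y c))" for x
  proof (cases "x \<in> X - Fx")
    case True
    then have "k x \<in> V" using X_sub by (auto simp: V_def)
    have "(\<Sum>c\<in>V. of_bool (x \<in> Y c) :: int) = (\<Sum>c\<in>V. if k x = c then 1 else 0)"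
      using True X_sub by (intro sum.cong) (auto simp: Y_def)
    then show ?thesis using True V \<open>k x \<in> V\<close> by (simp add: sum.delta)
  next
    case False
    then have "(\<Sum>c\<in>V. of_bool (x \<in> Y c) :: int) = 0" by (intro sum.neutral) (auto simp: Y_def)
    moreover have "Fx \<subseteq> X" by (auto simp: Fx_def)
    ultimately show ?thesis using False by auto
  qed
  then have "euler_int n (\<lambda>x. of_bool (x \<in> X)) =
      euler_int n (\<lambda>x. of_bool (x \<in> Fx) + (\<Sum>c\<in>V. of_bool (x \<in> Y c)))" by simp
  also have "\<dots> = euler_int n (\<lambda>x. of_bool (x \<in> Fx)) + euler_int n (\<lambda>x. \<Sum>c\<in>V. of_bool (x \<in> Y c))"
    by (intro euler_int_add constructible_sum V constructible.indicat Fx_definable YD)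
  also have "euler_int n (\<lambda>x. \<Sum>c\<in>V. of_bool (x \<in> Y c)) = 0"
    using euler_int_sum[OF V, of n "\<lambda>c x. of_bool (x \<in> Y c)"] constructible.indicat[OF YD] Y0 by simp
  finally show ?thesis by simp
qed

end

section \<open>Torus actions\<close>

definition coord_elt :: "nat \<Rightarrow> nat \<Rightarrow> complex \<Rightarrow> nat \<Rightarrow> complex"
  where "coord_elt l j z = (\<lambda>i\<in>{..<l}. if i = j then z else 1)"

lemma carrier_torus: "carrier (torus l) = (\<Pi>\<^sub>E i\<in>{..<l}. sphere 0 1)"
  by (simp add: torus_def circle_group_def)

lemma mult_torus: "x \<otimes>\<^bsub>torus l\<^esub> y = (\<lambda>i\<in>{..<l}. x i * y i)"
  by (simp add: torus_def circle_group_def)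

lemma one_torus: "\<one>\<^bsub>torus l\<^esub> = (\<lambda>i\<in>{..<l}. 1)"
  by (simp add: torus_def circle_group_def)

lemma coord_elt_in: "z \<in> sphere 0 1 \<Longrightarrow> coord_elt l j z \<in> carrier (torus l)"
  by (auto simp: carrier_torus coord_elt_def)

lemma coord_elt_one: "coord_elt l j 1 = \<one>\<^bsub>torus l\<^esub>"
  by (auto simp: coord_elt_def one_torus)

lemma coord_elt_mult: "coord_elt l j (z * w) = coord_elt l j z \<otimes>\<^bsub>torus l\<^esub> coord_elt l j w"
  by (auto simp: coord_elt_def mult_torus restrict_def)

lemma torus_commute: "x \<otimes>\<^bsub>torus l\<^esub> y = y \<otimes>\<^bsub>torus l\<^esub> x"
  by (simp add: mult_torus mult.commute)

lemma topspace_torus_space: "points (torus_space l) = carrier (torus l)"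
  by (simp add: torus_space_def carrier_torus)

lemma embed_torus_in: "embed (torus_space l) g \<in> Rn (2 * l)"
  by (simp add: torus_space_def Rn_iff)

lemma inj_embed_torus: "inj_on (embed (torus_space l)) (carrier (torus l))"
proof (rule inj_onI)
  fix g h assume g: "g \<in> carrier (torus l)" and h: "h \<in> carrier (torus l)"
    and eq: "embed (torus_space l) g = embed (torus_space l) h"
  have "g i = h i" if "i < l" for i
    using fun_cong[OF eq, of "2 * i"] fun_cong[OF eq, of "2 * i + 1"] that
    by (simp add: torus_space_def complex_eq_iff)
  then show "g = h" using g h unfolding carrier_torus by (intro PiE_ext[of g _ _ h]) auto
qed

lemma pair_pt_inject:
  assumes "x \<in> Rn n" "x' \<in> Rn n" "pair_pt n x y = pair_pt n x' y'"
  shows "x = x'" "y = y'"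
proof -
  show "x = x'"
  proof
    fix i show "x i = x' i"
      using fun_cong[OF assms(3), of i] assms(1,2) by (cases "i < n") (auto simp: pair_pt_def Rn_iff)
  qed
  show "y = y'"
  proof
    fix i show "y i = y' i" using fun_cong[OF assms(3), of "n + i"] by (simp add: pair_pt_def)
  qed
qed

text \<open>The \<open>j\<close>-th circle factor in the real coordinates of the torus, with
  \<open>(1, 0)\<close> in every other factor. It is polynomial in \<open>w\<close>, so substituting
  it in the graph of the torus action keeps definability.\<close>

definition coord_vec :: "nat \<Rightarrow> nat \<Rightarrow> (nat \<Rightarrow> real) \<Rightarrow> nat \<Rightarrow> real"
  where "coord_vec l j w = (\<lambda>i. if i < 2 * l then
    (if i div 2 = j then (if even i then w 0 else w 1) else (if even i then 1 else 0)) else 0)"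

lemma coord_vec_eq: "coord_vec l j w = embed (torus_space l) (coord_elt l j (to_c w))"
  by (auto simp: coord_vec_def torus_space_def coord_elt_def to_c_def fun_eq_iff less_mult_imp_div_less mult.commute)

text \<open>The circle factors generate the torus: \<open>g\<close> is built up one coordinate at a
  time.\<close>

lemma fixed_by_coord_elts:
  assumes act: "group_action (torus l) E \<phi>" and x: "x \<in> E"
    and fixed: "\<And>i z. i < l \<Longrightarrow> z \<in> sphere 0 1 \<Longrightarrow> \<phi> (coord_elt l i z) x = x"
    and g: "g \<in> carrier (torus l)"
  shows "\<phi> g x = x"
proof -
  interpret group_action "torus l" E \<phi> by (rule act)
  define h where "h k = (\<lambda>i\<in>{..<l}. if i < k then g i else 1)" for k
  have gs: "g i \<in> sphere 0 1" if "i < l" for i using g that by (auto simp: carrier_torus PiE_iff)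
  have h: "h k \<in> carrier (torus l)" for k
    using gs by (auto simp: h_def carrier_torus)
  have "k \<le> l \<Longrightarrow> \<phi> (h k) x = x" for k
  proof (induction k)
    case 0
    have "h 0 = \<one>\<^bsub>torus l\<^esub>" by (auto simp: h_def one_torus)
    then show ?case using id_eq_one x by (metis restrict_apply')
  next
    case (Suc k)
    have "h (Suc k) = coord_elt l k (g k) \<otimes>\<^bsub>torus l\<^esub> h k"
      by (auto simp: h_def coord_elt_def mult_torus fun_eq_iff less_Suc_eq)
    then have "\<phi> (h (Suc k)) x = \<phi> (coord_elt l k (g k)) (\<phi> (h k) x)"
      using composition_rule[OF x coord_elt_in[OF gs] h, of k] Suc.prems by simp
    then show ?case using Suc fixed[of k "g k"] gs by simp
  qed
  moreover have "h l = g" using g by (auto simp: h_def carrier_torus PiE_iff extensional_def fun_eq_iff)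
  ultimately show ?thesis by (metis order_refl)
qed

context o_minimal_structure
begin

text \<open>Since the torus is commutative, factor \<open>j\<close> acts on the points fixed by the
  factors before it, and its fixed points there form the next stage;
  \<open>euler_int_fixed_points\<close> is applied once per factor.\<close>

lemma torus_euler_int:
  fixes X :: "'a embedded_space"
  assumes X: "affine_definable_space D X" and act: "definable_action D (torus l) (torus_space l) X \<phi>"
  defines "N \<equiv> ambient_dim X" and "e \<equiv> embed X" and "P \<equiv> points X"
  defines "Y \<equiv> \<lambda>j. e ` {x \<in> P. \<forall>i<j. \<forall>z\<in>sphere 0 1. \<phi> (coord_elt l i z) x = x}"
  shows "j \<le> l \<Longrightarrow> Y j \<in> D N \<and>
    euler_int N (\<lambda>y. of_bool (y \<in> Y 0)) = euler_int N (\<lambda>y. of_bool (y \<in> Y j))"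
proof (induction j)
  case 0
  show ?case using X by (auto simp: affine_definable_space_def N_def e_def P_def Y_def)
next
  case (Suc j)
  have ga: "group_action (torus l) P \<phi>" using act by (simp add: definable_action_def P_def)
  interpret group_action "torus l" P \<phi> by (rule ga)
  have j: "j < l" and YD: "Y j \<in> D N" using Suc by auto
  have homeo: "homeomorphic_map (top_of X) (subtopology (Euclidean_space N) (e ` P)) e"
    using X by (simp add: affine_definable_space_def embedding_map_def N_def e_def P_def)
  then have inj: "inj_on e P" and e_cont: "continuous_map (top_of X) (Euclidean_space N) e"
    by (auto simp: homeomorphic_eq_everything_map P_def continuous_map_in_subtopology)
  have eR: "e x \<in> Rn N" if "x \<in> P" for x
    using continuous_map_image_subset_topspace[OF e_cont] that unfolding P_def by blast
  let ?inv = "inv_into P e"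
  have inv_e: "?inv (e x) = x" if "x \<in> P" for x using inv_into_f_f[OF inj that] .
  let ?T = "torus_space l" and ?eT = "embed (torus_space l)"
  let ?TX = "prod_space (torus_space l) X"
  have TX: "points ?TX = carrier (torus l) \<times> P" "ambient_dim ?TX = 2 * l + N"
    "embed ?TX (g, x) = pair_pt (2 * l) (?eT g) (e x)" for g x
    by (simp_all add: prod_space_def topspace_torus_space[symmetric] P_def N_def e_def)
      (simp_all add: torus_space_def)
  have injTX: "inj_on (embed ?TX) (points ?TX)"
  proof (rule inj_onI)
    fix p q assume p: "p \<in> points ?TX" and q: "q \<in> points ?TX" and eq: "embed ?TX p = embed ?TX q"
    obtain g x h y where gx: "p = (g, x)" "q = (h, y)" by (cases p, cases q)
    then have in_: "g \<in> carrier (torus l)" "x \<in> P" "h \<in> carrier (torus l)" "y \<in> P"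
      using p q by (auto simp: TX)
    have eq': "pair_pt (2 * l) (?eT g) (e x) = pair_pt (2 * l) (?eT h) (e y)" using eq gx by (simp add: TX)
    from pair_pt_inject[OF embed_torus_in embed_torus_in eq'] have "?eT g = ?eT h" "e x = e y" by auto
    then show "p = q" using gx in_ inj inj_embed_torus by (metis inj_onD)
  qed
  have mor: "definable_morphism D ?TX X (\<lambda>(g, x). \<phi> g x)"
    using act by (simp add: definable_action_def)
  have cont: "continuous_map (prod_topology (top_of ?T) (top_of X)) (top_of X) (\<lambda>(g, x). \<phi> g x)"
    using mor by (simp add: definable_morphism_def prod_space_def)
  define F where "F = e \<circ> (\<lambda>(g, x). \<phi> g x) \<circ> inv_into (points ?TX) (embed ?TX)"
  define G0 where "G0 = {pair_pt (2 * l + N) p (F p) | p. p \<in> embed ?TX ` points ?TX}"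
  have G0: "G0 \<in> D (2 * l + N + N)"
    using mor unfolding definable_morphism_def definable_map_def TX(2) N_def[symmetric] e_def[symmetric]
      F_def[symmetric] G0_def by simp
  have Fval: "F (pair_pt (2 * l) (?eT g) (e x)) = e (\<phi> g x)" if "g \<in> carrier (torus l)" "x \<in> P" for g x
  proof -
    have gx: "(g, x) \<in> points ?TX" using that by (simp add: TX)
    have "inv_into (points ?TX) (embed ?TX) (pair_pt (2 * l) (?eT g) (e x)) = (g, x)"
      using inv_into_f_f[OF injTX gx] unfolding TX(3) .
    then show ?thesis by (simp add: F_def)
  qed
  have G0_iff: "pair_pt (2 * l + N) (pair_pt (2 * l) (?eT g) (e x)) y \<in> G0 \<longleftrightarrow> y = e (\<phi> g x)"
    if gx: "g \<in> carrier (torus l)" "x \<in> P" for g x y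
  proof -
    have pR: "pair_pt (2 * l) (?eT h) (e u) \<in> Rn (2 * l + N)" if "u \<in> P" for h u
      using pair_pt_in[OF eR[OF that]] .
    have "pair_pt (2 * l) (?eT g) (e x) \<in> embed ?TX ` points ?TX"
      using gx by (intro image_eqI[of _ _ "(g, x)"]) (simp_all add: TX)
    moreover have "y = F (pair_pt (2 * l) (?eT g) (e x))"
      if in_: "pair_pt (2 * l + N) (pair_pt (2 * l) (?eT g) (e x)) y \<in> G0"
    proof -
      obtain p where p: "pair_pt (2 * l + N) (pair_pt (2 * l) (?eT g) (e x)) y = pair_pt (2 * l + N) p (F p)"
        "p \<in> embed ?TX ` points ?TX" using in_ unfolding G0_def by blast
      then obtain h u where hu: "p = pair_pt (2 * l) (?eT h) (e u)" "u \<in> P" by (auto simp: TX)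
      from pair_pt_inject[OF pR[OF gx(2)] _ p(1)] show ?thesis using pR[OF hu(2)] hu(1) by metis
    qed
    ultimately show ?thesis unfolding Fval[OF gx, symmetric] G0_def by blast
  qed
  define a where "a z p = e (\<phi> (coord_elt l j z) (?inv p))" for z p
  have Y_iff: "y \<in> Y k \<longleftrightarrow> (\<exists>x\<in>P. y = e x \<and> (\<forall>i<k. \<forall>z\<in>sphere 0 1. \<phi> (coord_elt l i z) x = x))" for k y
    by (auto simp: Y_def)
  have P_in: "\<phi> g x \<in> P" if "g \<in> carrier (torus l)" "x \<in> P" for g x
    using element_image[OF that] by blast
  have comm: "\<phi> g (\<phi> h x) = \<phi> h (\<phi> g x)" if "g \<in> carrier (torus l)" "h \<in> carrier (torus l)" "x \<in> P" for g h x
    using composition_rule[OF that(3,1,2)] composition_rule[OF that(3,2,1)] torus_commute[where x = g and y = h and l = l] by simp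
  \<comment> \<open>The graph \<open>G0\<close> of the whole action pulled back along
    \<open>coord_vec\<close>, with the group element on the circle and the point in
    \<open>Y j\<close>. The first two entries of \<open>p\<close> are the group element, and
    \<open>coord_vec l j p\<close> reads just these.\<close>
  define Gr where "Gr = {p \<in> Rn (2 + N + N). restr 2 p \<in> circ \<and> restr N (\<lambda>i. p (2 + i)) \<in> Y j \<and>
    pair_pt (2 * l + N) (pair_pt (2 * l) (coord_vec l j p) (restr N (\<lambda>i. p (2 + i)))) (restr N (\<lambda>i. p (2 + N + i))) \<in> G0}"
  interpret C: definable_circle_action D N "Y j" a Gr
  proof unfold_locales
    show "Y j \<in> D N" by (rule YD)
  next
    fix z :: complex and y assume z: "z \<in> sphere 0 1" and "y \<in> Y j"
    then obtain x where x: "x \<in> P" "y = e x" "\<And>i w. i < j \<Longrightarrow> w \<in> sphere 0 1 \<Longrightarrow> \<phi> (coord_elt l i w) x = x"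
      unfolding Y_iff by blast
    have "\<phi> (coord_elt l i w) (\<phi> (coord_elt l j z) x) = \<phi> (coord_elt l j z) x"
      if "i < j" "w \<in> sphere 0 1" for i w
      using comm[OF coord_elt_in[OF that(2)] coord_elt_in[OF z] x(1)] x(3)[OF that] by simp
    then show "a z y \<in> Y j"
      unfolding a_def x(2) inv_e[OF x(1)] Y_iff using P_in[OF coord_elt_in[OF z] x(1)] by blast
  next
    fix y assume "y \<in> Y j"
    then obtain x where x: "x \<in> P" "y = e x" unfolding Y_iff by blast
    have "\<phi> (coord_elt l j 1) x = x" using id_eq_one x(1) by (metis coord_elt_one restrict_apply')
    then show "a 1 y = y" by (simp add: a_def x inv_e)
  next
    fix z w :: complex and y assume z: "z \<in> sphere 0 1" and w: "w \<in> sphere 0 1" and "y \<in> Y j"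
    then obtain x where x: "x \<in> P" "y = e x" unfolding Y_iff by blast
    show "a (z * w) y = a z (a w y)"
      using composition_rule[OF x(1) coord_elt_in[OF z] coord_elt_in[OF w]] P_in[OF coord_elt_in[OF w] x(1)]
      by (simp add: a_def x inv_e coord_elt_mult)
  next
    fix y i assume "y \<in> Y j"
    then obtain x where x: "x \<in> P" "y = e x" unfolding Y_iff by blast
    have "continuous_map (top_of_set (sphere 0 1)) (top_of ?T) (coord_elt l j)"
      by (auto simp: torus_space_def continuous_map_componentwise coord_elt_def)
    moreover have "continuous_map (top_of_set (sphere (0::complex) 1)) (top_of X) (\<lambda>z. x)"
      using x by (simp add: P_def)
    ultimately have "continuous_map (top_of_set (sphere 0 1)) (prod_topology (top_of ?T) (top_of X)) (\<lambda>z. (coord_elt l j z, x))"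
      by (rule continuous_map_pairedI)
    from continuous_map_compose[OF continuous_map_compose[OF this cont] e_cont]
    have "continuous_map (top_of_set (sphere 0 1)) (Euclidean_space N) (\<lambda>z. a z y)"
      by (simp add: o_def a_def x inv_e)
    then have "continuous_map (top_of_set (sphere 0 1)) (powertop_real UNIV) (\<lambda>z. a z y)"
      by (simp add: Euclidean_space_def continuous_map_in_subtopology)
    then show "continuous_on (sphere 0 1) (\<lambda>z. a z y i)"
      by (simp add: continuous_map_componentwise_UNIV)
  next
    have "poly_vec (2 * l) (\<lambda>e. coord_vec l j e)"
      unfolding coord_vec_def by (intro def_intros)
    then show "Gr \<in> D (2 + N + N)"
      unfolding Gr_def by (intro definable_Collect_Def)
        (intro def_intros Def_in[OF definable_circ] Def_in[OF YD] Def_in[OF G0])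
  next
    fix w x y assume wxy: "w \<in> Rn 2" "x \<in> Rn N" "y \<in> Rn N"
    let ?p = "pair_pt (2 + N) (pair_pt 2 w x) y"
    have p: "restr 2 ?p = w" "restr N (\<lambda>i. ?p (2 + i)) = x" "restr N (\<lambda>i. ?p (2 + N + i)) = y"
      using wxy by (auto simp: pair_pt_def restr_def Rn_iff fun_eq_iff)
    have pv: "coord_vec l j ?p = coord_vec l j w"
      by (simp add: coord_vec_def pair_pt_def)
    have pR: "?p \<in> Rn (2 + N + N)" using wxy by (intro pair_pt_in)
    have "?p \<in> Gr \<longleftrightarrow> w \<in> circ \<and> x \<in> Y j \<and> pair_pt (2 * l + N) (pair_pt (2 * l) (coord_vec l j w) x) y \<in> G0"
      by (simp only: Gr_def mem_Collect_eq p pv pR simp_thms)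
    also have "\<dots> \<longleftrightarrow> w \<in> circ \<and> x \<in> Y j \<and> y = a (to_c w) x"
    proof (intro conj_cong refl)
      assume w: "w \<in> circ" and "x \<in> Y j"
      then obtain u where u: "u \<in> P" "x = e u" unfolding Y_iff by blast
      have "to_c w \<in> sphere 0 1" using w bij_betw_to_c by (auto simp: bij_betw_def)
      from G0_iff[OF coord_elt_in[OF this] u(1)]
      show "pair_pt (2 * l + N) (pair_pt (2 * l) (coord_vec l j w) x) y \<in> G0 \<longleftrightarrow> y = a (to_c w) x"
        unfolding coord_vec_eq u(2) a_def inv_e[OF u(1)] .
    qed
    finally show "?p \<in> Gr \<longleftrightarrow> w \<in> circ \<and> x \<in> Y j \<and> y = a (to_c w) x" .
  qed
  have Fx: "C.Fx = Y (Suc j)"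
  proof (rule Set.set_eqI)
    fix y
    have "y \<in> C.Fx \<longleftrightarrow> (\<exists>x\<in>P. y = e x \<and> (\<forall>i<j. \<forall>z\<in>sphere 0 1. \<phi> (coord_elt l i z) x = x) \<and>
        (\<forall>z\<in>sphere 0 1. a z y = y))"
      unfolding C.Fx_def mem_Collect_eq Y_iff by blast
    also have "\<dots> \<longleftrightarrow> y \<in> Y (Suc j)"
      unfolding Y_iff
    proof (rule bex_cong[OF refl], rule conj_cong[OF refl])
      fix x assume x: "x \<in> P" and y: "y = e x"
      have "a z y = y \<longleftrightarrow> \<phi> (coord_elt l j z) x = x" if "z \<in> sphere 0 1" for z
        unfolding y a_def inv_e[OF x] using inj_on_eq_iff[OF inj P_in[OF coord_elt_in[OF that] x] x] .
      then show "((\<forall>i<j. \<forall>z\<in>sphere 0 1. \<phi> (coord_elt l i z) x = x) \<and> (\<forall>z\<in>sphere 0 1. a z y = y)) \<longleftrightarrow>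
          (\<forall>i<Suc j. \<forall>z\<in>sphere 0 1. \<phi> (coord_elt l i z) x = x)"
        unfolding less_Suc_eq by blast
    qed
    finally show "y \<in> C.Fx \<longleftrightarrow> y \<in> Y (Suc j)" .
  qed
  show ?case using C.Fx_definable C.euler_int_fixed_points Suc unfolding Fx by simp
qed

end

theorem theorem3p1:
  fixes D :: "nat \<Rightarrow> (nat \<Rightarrow> real) set set"
    and l :: nat
    and X :: "'a embedded_space"
    and \<phi> :: "(nat \<Rightarrow> complex) \<Rightarrow> 'a \<Rightarrow> 'a"
  assumes "o_minimal_structure D"
    and "affine_definable_space D X"
    and "definable_action D (torus l) (torus_space l) X \<phi>"
  shows "space_euler_char D X (points X) = space_euler_char D X (fixed_points (torus l) X \<phi>) \<and>
    (fixed_points (torus l) X \<phi> = {} \<longrightarrow> space_euler_char D X (points X) = 0)"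
proof -
  interpret o_minimal_structure D by (rule assms(1))
  have ga: "group_action (torus l) (points X) \<phi>" using assms(3) by (simp add: definable_action_def)
  note T = torus_euler_int[OF assms(2,3), of l]
  have "{x \<in> points X. \<forall>i<l. \<forall>z\<in>sphere 0 1. \<phi> (coord_elt l i z) x = x} = fixed_points (torus l) X \<phi>"
    using fixed_by_coord_elts[OF ga] coord_elt_in unfolding fixed_points_def by blast
  then have D: "embed X ` points X \<in> D (ambient_dim X)"
      "embed X ` fixed_points (torus l) X \<phi> \<in> D (ambient_dim X)"
    and eq: "euler_int (ambient_dim X) (\<lambda>y. of_bool (y \<in> embed X ` points X)) =
      euler_int (ambient_dim X) (\<lambda>y. of_bool (y \<in> embed X ` fixed_points (torus l) X \<phi>))"
    using T assms(2) by (simp_all add: affine_definable_space_def)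
  have "space_euler_char D X (points X) = space_euler_char D X (fixed_points (torus l) X \<phi>)"
    unfolding space_euler_char_def euler_char_eq[OF D(1)] euler_char_eq[OF D(2)] by (rule eq)
  moreover have "space_euler_char D X {} = 0"
    unfolding space_euler_char_def image_empty euler_char_eq[OF definable_empty] by (simp add: euler_int_zero)
  ultimately show ?thesis by metis
qed

end
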